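(* Let $n,m\ge2$ and let $\psi:\mathcal C_n\to\mathcal C_m$ be a homeomorphism. Then $F_n^\psi\le F_m$ if and only if $\psi$ is order-preserving or order-reversing, and $\psi$ is a rational homeomorphism whose minimal transducer is semi-synchronizing.
   Context: Let $X_n=\{0,\dots,n-1\}$, let $\mathcal W_n=X_n^*$ be the set of finite words (including the empty word $\varepsilon$), and let $\mathcal C_n=X_n^{\mathbb N}$ be the Cantor space of infinite words, with the lexicographic order; for $u\in\mathcal W_n$ let $U_u=u\mathcal C_n$. Order-preserving/reversing means strictly preserving/reversing the lexicographic order. $F_n$ is viewed as the group of all order-preserving homeomorphisms $f$ of $\mathcal C_n$ given by finite prefix replacement: there are finite complete prefix codes $\{u_1<\dots<u_k\}$ and $\{v_1<\dots<v_k\}$ in $\mathcal W_n$ (a finite prefix code is complete if its cylinders partition $\mathcal C_n$) with $f(u_i\omega)=v_i\omega$ for all $i$ and $\omega\in\mathcal C_n$. The notation $F_n^\psi$ means $\{\omega\mapsto\psi(f(\psi^{-1}(\omega))) : f\in F_n\}$, a group of homeomorphisms of $\mathcal C_m$. An initial $(n,m)$-transducer is $T=(S,t,o,s_0)$ with state set $S$, transition function $t:S\times X_n\to S$, output function $o:S\times X_n\to\mathcal W_m$, and initial state $s_0\in S$. Both functions extend to words by $t(s,\varepsilon)=s$, $o(s,\varepsilon)=\varepsilon$, $t(s,ui)=t(t(s,u),i)$, $o(s,ui)=o(s,u)\,o(t(s,u),i)$; it is assumed that on every infinite input, from every state, the concatenated output is infinite. Each state $s$ induces a map $h_s:\mathcal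 C_n\to\mathcal C_m$ sending an infinite input to its infinite output; $T$ represents $h_{s_0}$. A homeomorphism is rational if it is represented by a finite initial transducer. The minimal transducer of a homeomorphism $\psi$ is the unique (up to isomorphism) initial transducer representing $\psi$ in which every state is reachable from $s_0$, distinct states induce distinct maps, and no state has incomplete response (i.e. for every state $s$ and letter $i$, $o(s,i)$ is the greatest common prefix of $h_s(U_i)$). It is finite when $\psi$ is rational. Concretely: for $u\in\mathcal W_n$ let $\theta_\psi(u)$ be the greatest common prefix of $\psi(U_u)$ and let the local action $\psi_u:\mathcal C_n\to\mathcal C_m$ be defined by $\psi(u\omega)=\theta_\psi(u)\psi_u(\omega)$; the states are the distinct maps $\psi_u$, the initial state is $\psi$, $t(f,i)=f_i$, and $o(f,i)=\theta_f(i)$. A word $u\in\mathcal W_n$ is inner if it is nonempty and is neither of the form $0^k$ nor of the form $(n-1)^k$. Put $\sigma_n(u_1\cdots u_r)=\sum_j u_j \bmod (n-1)$. An initial transducer $T=(S,t,o,s_0)$ is semi-synchronizing if: (i) there are states $s_L,s_R$ with $t(s_L,0)=s_L$ and $t(s_R,n-1)=s_R$, where $s_L$ is reached from $s_0$ by some word $0^r$ and $s_R$ is reached from $s_0$ by some word $(n-1)^r$ ($r\ge0$); (ii) there exists $k\ge0$ such that $t(s_0,uw)=t(s_0,vw)$ for all inner words $u,v\in\mathcal W_n$ with $\sigma_n(u)=\sigma_n(v)$ and all words $w\in X_n^k$. *)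

theory Defs
  imports
    "HOL-Analysis.Analysis"
    "HOL-Algebra.Bij"
    "HOL-Library.Omega_Words_Fun"
    "HOL-Library.Fun_Lexorder"
    "HOL-Library.Sublist"
    "HOL-Library.Disjoint_Sets"
begin

hide_const (open) Sublist.prefix Sublist.suffix

section \<open>Words and Cantor spaces\<close>

text \<open>
  The alphabet is \<open>{..<n}\<close>, finite words are lists and infinite words are functions on
  \<open>nat\<close>; \<open>u \<frown> \<omega>\<close> is concatenation. The lexicographic order on infinite words is
  \<^const>\<open>less_fun\<close>.
\<close>

definition cantor_space :: "nat \<Rightarrow> nat word topology" where
  "cantor_space n = product_topology (\<lambda>_. discrete_topology {..<n}) UNIV"

abbreviation cantor :: "nat \<Rightarrow> nat word set" where
  "cantor n \<equiv> topspace (cantor_space n)"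

abbreviation words :: "nat \<Rightarrow> nat list set" where
  "words n \<equiv> lists {..<n}"

definition cylinder :: "nat \<Rightarrow> nat list \<Rightarrow> nat word set" where
  "cylinder n u = (\<lambda>\<omega>. u \<frown> \<omega>) ` cantor n"

definition order_preserving :: "nat \<Rightarrow> (nat word \<Rightarrow> nat word) \<Rightarrow> bool" where
  "order_preserving n f \<longleftrightarrow> monotone_on (cantor n) less_fun less_fun f"

definition order_reversing :: "nat \<Rightarrow> (nat word \<Rightarrow> nat word) \<Rightarrow> bool" where
  "order_reversing n f \<longleftrightarrow> monotone_on (cantor n) less_fun (\<lambda>x y. less_fun y x) f"


section \<open>The group \<open>F_n\<close>\<close>

definition complete_prefix_code :: "nat \<Rightarrow> nat list set \<Rightarrow> bool" where
  "complete_prefix_code n A \<longleftrightarrow>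
     finite A \<and> A \<subseteq> words n \<and> pairwise (\<parallel>) A \<and> partition_on (cantor n) (cylinder n ` A)"

definition prefix_replacement :: "nat \<Rightarrow> (nat word \<Rightarrow> nat word) \<Rightarrow> bool" where
  "prefix_replacement n f \<longleftrightarrow>
     (\<exists>us vs. length us = length vs
        \<and> sorted_wrt ord_class.lexordp us \<and> sorted_wrt ord_class.lexordp vs
        \<and> complete_prefix_code n (set us) \<and> complete_prefix_code n (set vs)
        \<and> (\<forall>i<length us. \<forall>\<omega>\<in>cantor n. f (us ! i \<frown> \<omega>) = vs ! i \<frown> \<omega>))"

text \<open>
  As in \<^const>\<open>BijGroup\<close>, self-maps of \<open>cantor n\<close> are extensional functions, so that
  maps that agree on \<open>cantor n\<close> are equal.
\<close>

definition F_group :: "nat \<Rightarrow> (nat word \<Rightarrow> nat word) monoid" where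
  "F_group n = (BijGroup (cantor n))
     \<lparr>carrier := {f \<in> extensional (cantor n).
        homeomorphic_map (cantor_space n) (cantor_space n) f
        \<and> order_preserving n f \<and> prefix_replacement n f}\<rparr>"

definition F_conj :: "nat \<Rightarrow> nat \<Rightarrow> (nat word \<Rightarrow> nat word) \<Rightarrow> (nat word \<Rightarrow> nat word) set" where
  "F_conj n m \<psi> = {\<lambda>\<omega>\<in>cantor m. \<psi> (f (inv_into (cantor n) \<psi> \<omega>)) | f. f \<in> carrier (F_group n)}"


section \<open>Initial transducers\<close>

record 's transducer =
  states :: "'s set"
  step :: "'s \<Rightarrow> nat \<Rightarrow> 's"
  emit :: "'s \<Rightarrow> nat \<Rightarrow> nat list"
  start :: 's

definition step_word :: "('s, 'z) transducer_scheme \<Rightarrow> 's \<Rightarrow> nat list \<Rightarrow> 's" where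
  "step_word T s u = foldl (step T) s u"

primrec emit_word :: "('s, 'z) transducer_scheme \<Rightarrow> 's \<Rightarrow> nat list \<Rightarrow> nat list" where
  "emit_word T s [] = []"
| "emit_word T s (i # u) = emit T s i @ emit_word T (step T s i) u"

lemma step_word_Nil [simp]: "step_word T s [] = s"
  by (simp add: step_word_def)

lemma step_word_Cons [simp]: "step_word T s (i # u) = step_word T (step T s i) u"
  by (simp add: step_word_def)

lemma step_word_snoc [simp]: "step_word T s (u @ [i]) = step T (step_word T s u) i"
  by (simp add: step_word_def)

lemma emit_word_snoc: "emit_word T s (u @ [i]) = emit_word T s u @ emit T (step_word T s u) i"
  by (induction u arbitrary: s) auto

definition is_transducer :: "nat \<Rightarrow> nat \<Rightarrow> 's transducer \<Rightarrow> bool" where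
  "is_transducer n m T \<longleftrightarrow>
     start T \<in> states T
     \<and> (\<forall>s\<in>states T. \<forall>i<n. step T s i \<in> states T \<and> emit T s i \<in> words m)
     \<and> (\<forall>s\<in>states T. \<forall>\<omega>\<in>cantor n. \<forall>N. \<exists>k. N \<le> length (emit_word T s (prefix k \<omega>)))"

text \<open>
  The output on \<open>\<omega>\<close> is the infinite word that extends the outputs on all finite prefixes of
  \<open>\<omega>\<close>; it is unique because these outputs are unboundedly long in a transducer.
\<close>

definition state_map :: "'s transducer \<Rightarrow> 's \<Rightarrow> nat word \<Rightarrow> nat word" where
  "state_map T s \<omega> = (THE x. \<forall>k. \<exists>y. x = emit_word T s (prefix k \<omega>) \<frown> y)"

definition represents :: "nat \<Rightarrow> 's transducer \<Rightarrow> (nat word \<Rightarrow> nat word) \<Rightarrow> bool" where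
  "represents n T \<psi> \<longleftrightarrow> (\<forall>\<omega>\<in>cantor n. state_map T (start T) \<omega> = \<psi> \<omega>)"

text \<open>States in \<^typ>\<open>nat\<close> are no restriction, since the state set is finite.\<close>

definition rational :: "nat \<Rightarrow> nat \<Rightarrow> (nat word \<Rightarrow> nat word) \<Rightarrow> bool" where
  "rational n m \<psi> \<longleftrightarrow>
     (\<exists>T :: nat transducer. is_transducer n m T \<and> finite (states T) \<and> represents n T \<psi>)"


section \<open>The minimal transducer\<close>

text \<open>
  Greatest common prefix. The maximum exists whenever the set has at least two elements.
\<close>

definition gcp :: "nat word set \<Rightarrow> nat list" where
  "gcp A = (ARG_MAX length u. \<forall>x\<in>A. \<exists>y. x = u \<frown> y)"

definition theta :: "nat \<Rightarrow> (nat word \<Rightarrow> nat word) \<Rightarrow> nat list \<Rightarrow> nat list" where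
  "theta n f u = gcp (f ` cylinder n u)"

definition local_action :: "nat \<Rightarrow> (nat word \<Rightarrow> nat word) \<Rightarrow> nat list \<Rightarrow> nat word \<Rightarrow> nat word" where
  "local_action n f u = (\<lambda>\<omega>\<in>cantor n. suffix (length (theta n f u)) (f (u \<frown> \<omega>)))"

definition minimal_transducer ::
    "nat \<Rightarrow> (nat word \<Rightarrow> nat word) \<Rightarrow> (nat word \<Rightarrow> nat word) transducer" where
  "minimal_transducer n \<psi> =
     \<lparr>states = local_action n \<psi> ` words n,
      step = (\<lambda>f i. local_action n f [i]),
      emit = (\<lambda>f i. theta n f [i]),
      start = restrict \<psi> (cantor n)\<rparr>"

text \<open>
  The abstract characterization of the minimal transducer. For a homeomorphism it is satisfied
  by \<^const>\<open>minimal_transducer\<close>, and by nothing else up to isomorphism; see the two theorems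
  at the end of this theory.
\<close>

definition is_minimal_transducer ::
    "nat \<Rightarrow> nat \<Rightarrow> (nat word \<Rightarrow> nat word) \<Rightarrow> 's transducer \<Rightarrow> bool" where
  "is_minimal_transducer n m \<psi> T \<longleftrightarrow>
     is_transducer n m T \<and> represents n T \<psi>
     \<and> (\<forall>s\<in>states T. \<exists>u\<in>words n. s = step_word T (start T) u)
     \<and> inj_on (\<lambda>s. restrict (state_map T s) (cantor n)) (states T)
     \<and> (\<forall>s\<in>states T. \<forall>i<n. emit T s i = gcp (state_map T s ` cylinder n [i]))"


section \<open>Semi-synchronizing transducers\<close>

definition inner :: "nat \<Rightarrow> nat list \<Rightarrow> bool" where
  "inner n u \<longleftrightarrow> u \<in> words n \<and> u \<noteq> []
     \<and> (\<forall>k. u \<noteq> replicate k 0) \<and> (\<forall>k. u \<noteq> replicate k (n - 1))"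

definition sigma :: "nat \<Rightarrow> nat list \<Rightarrow> nat" where
  "sigma n u = sum_list u mod (n - 1)"

definition semi_synchronizing :: "nat \<Rightarrow> 's transducer \<Rightarrow> bool" where
  "semi_synchronizing n T \<longleftrightarrow>
     (\<exists>sL\<in>states T. step T sL 0 = sL \<and> (\<exists>r. step_word T (start T) (replicate r 0) = sL))
     \<and> (\<exists>sR\<in>states T. step T sR (n - 1) = sR
          \<and> (\<exists>r. step_word T (start T) (replicate r (n - 1)) = sR))
     \<and> (\<exists>k. \<forall>u v w. inner n u \<and> inner n v \<and> sigma n u = sigma n v \<and> w \<in> words n \<and> length w = k
          \<longrightarrow> step_word T (start T) (u @ w) = step_word T (start T) (v @ w))"


section \<open>Existence and uniqueness of the minimal transducer\<close>

lemma cantor_iff: "\<omega> \<in> cantor n \<longleftrightarrow> (\<forall>i. \<omega> i < n)"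
  by (auto simp: cantor_space_def topspace_product_topology PiE_iff)

lemma conc_in_cantor_iff: "u \<frown> \<omega> \<in> cantor n \<longleftrightarrow> u \<in> words n \<and> \<omega> \<in> cantor n"
proof
  assume h: "u \<frown> \<omega> \<in> cantor n"
  have "u ! i < n" if "i < length u" for i
    using h that unfolding cantor_iff by (metis conc_fst)
  moreover have "\<omega> i < n" for i
    using h unfolding cantor_iff conc_def by (auto dest!: spec[of _ "length u + i"])
  ultimately show "u \<in> words n \<and> \<omega> \<in> cantor n"
    by (auto simp: cantor_iff in_set_conv_nth in_lists_conv_set)
next
  assume "u \<in> words n \<and> \<omega> \<in> cantor n"
  then show "u \<frown> \<omega> \<in> cantor n"
    by (auto simp: cantor_iff conc_def in_lists_conv_set)
qed

lemma prefix_in_words: "\<omega> \<in> cantor n \<Longrightarrow> prefix k \<omega> \<in> words n"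
  by (auto simp: cantor_iff)

lemma conc_prefix_iff: "(\<exists>y. x = u \<frown> y) \<longleftrightarrow> prefix (length u) x = u"
  by (metis prefix_conc_length prefix_suffix)

lemma common_prefix_bound:
  assumes "x \<noteq> x'" obtains N where "\<And>u. \<exists>y. x = u \<frown> y \<Longrightarrow> \<exists>y. x' = u \<frown> y \<Longrightarrow> length u \<le> N"
proof -
  obtain N where N: "x N \<noteq> x' N" using assms by blast
  have "length u \<le> N" if "\<exists>y. x = u \<frown> y" "\<exists>y. x' = u \<frown> y" for u
  proof (rule ccontr)
    assume "\<not> length u \<le> N"
    then have "x N = u ! N" "x' N = u ! N" using that by auto
    then show False using N by simp
  qed
  then show thesis using that by blast
qed

lemma gcp_props:
  assumes "x \<in> A" "x' \<in> A" "x \<noteq> x'"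
  shows gcp_common: "\<And>z. z \<in> A \<Longrightarrow> \<exists>y. z = gcp A \<frown> y"
    and gcp_max: "\<And>u. (\<And>z. z \<in> A \<Longrightarrow> \<exists>y. z = u \<frown> y) \<Longrightarrow> length u \<le> length (gcp A)"
proof -
  let ?P = "\<lambda>u. \<forall>z\<in>A. \<exists>y. z = u \<frown> y"
  obtain N where N: "\<And>u. \<exists>y. x = u \<frown> y \<Longrightarrow> \<exists>y. x' = u \<frown> y \<Longrightarrow> length u \<le> N"
    using common_prefix_bound[OF assms(3)] by metis
  have b: "\<forall>u. ?P u \<longrightarrow> length u < Suc N"
    using N assms by (metis less_Suc_eq_le)
  have e: "?P []" by simp
  have "?P (gcp A)" "\<And>u. ?P u \<Longrightarrow> length u \<le> length (gcp A)"
    unfolding gcp_def using arg_max_nat_lemma[of ?P, OF e b] by blast+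
  then show "\<And>z. z \<in> A \<Longrightarrow> \<exists>y. z = gcp A \<frown> y"
    "\<And>u. (\<And>z. z \<in> A \<Longrightarrow> \<exists>y. z = u \<frown> y) \<Longrightarrow> length u \<le> length (gcp A)" by blast+
qed

lemma gcp_eqI:
  assumes "x \<in> A" "x' \<in> A" "x \<noteq> x'"
    and c: "\<And>z. z \<in> A \<Longrightarrow> \<exists>y. z = u \<frown> y"
    and m: "\<And>v. (\<And>z. z \<in> A \<Longrightarrow> \<exists>y. z = v \<frown> y) \<Longrightarrow> length v \<le> length u"
  shows "gcp A = u"
proof -
  note g = gcp_common[OF assms(1-3)] gcp_max[OF assms(1-3)]
  have "length (gcp A) = length u" using g(1) g(2)[OF c] m by (meson le_antisym)
  moreover have "prefix (length (gcp A)) x = gcp A" "prefix (length u) x = u"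
    using g(1)[OF assms(1)] c[OF assms(1)] by (simp_all add: conc_prefix_iff)
  ultimately show ?thesis by metis
qed

lemma gcp_conc:
  assumes "x \<in> A" "x' \<in> A" "x \<noteq> x'"
  shows "gcp ((\<lambda>y. w \<frown> y) ` A) = w @ gcp A"
proof (rule gcp_eqI)
  show "w \<frown> x \<in> (\<lambda>y. w \<frown> y) ` A" "w \<frown> x' \<in> (\<lambda>y. w \<frown> y) ` A" using assms by auto
  show "w \<frown> x \<noteq> w \<frown> x'" using assms by simp
  show "\<exists>y. z = (w @ gcp A) \<frown> y" if "z \<in> (\<lambda>y. w \<frown> y) ` A" for z
    using that gcp_common[OF assms] by (metis (no_types, lifting) conc_conc imageE)
  fix v assume v: "\<And>z. z \<in> (\<lambda>y. w \<frown> y) ` A \<Longrightarrow> \<exists>y. z = v \<frown> y"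
  show "length v \<le> length (w @ gcp A)"
  proof (cases "length w \<le> length v")
    case True
    have "\<exists>y. z = drop (length w) v \<frown> y" if z: "z \<in> A" for z
    proof -
      obtain y where "w \<frown> z = v \<frown> y" using v z by blast
      then have "suffix (length w) (w \<frown> z) = suffix (length w) (v \<frown> y)" by simp
      then show ?thesis using True by (metis suffix_conc_fst suffix_conc_length)
    qed
    from gcp_max[OF assms this] show ?thesis by simp
  qed simp
qed

lemma conc_cylinder: "(\<lambda>\<omega>. u \<frown> \<omega>) ` cylinder n v = cylinder n (u @ v)"
  by (auto simp: cylinder_def image_image)

lemma cylinder_subset: "u \<in> words n \<Longrightarrow> cylinder n u \<subseteq> cantor n"
  by (auto simp: cylinder_def conc_in_cantor_iff)

lemma cylinder_Nil: "cylinder n [] = cantor n"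
  by (simp add: cylinder_def)

lemma local_action_image:
  assumes n: "2 \<le> n" and inj: "inj_on f (cantor n)" and u: "u \<in> words n"
  shows theta_local_action: "\<And>\<omega>. \<omega> \<in> cantor n \<Longrightarrow> f (u \<frown> \<omega>) = theta n f u \<frown> local_action n f u \<omega>"
    and inj_local_action: "inj_on (local_action n f u) (cantor n)"
    and theta_append: "\<And>v. v \<in> words n \<Longrightarrow>
      theta n f (u @ v) = theta n f u @ theta n (local_action n f u) v"
    and local_action_append: "\<And>v. v \<in> words n \<Longrightarrow>
      local_action n f (u @ v) = local_action n (local_action n f u) v"
proof -
  let ?a = "\<lambda>_::nat. 0::nat" and ?b = "\<lambda>_::nat. 1::nat"
  have ab: "?a \<in> cantor n" "?b \<in> cantor n" "?a \<noteq> ?b"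
    using n by (auto simp: cantor_iff dest: fun_cong)
  have two: "\<exists>x\<in>g ` cylinder n v. \<exists>x'\<in>g ` cylinder n v. x \<noteq> x'"
    if g: "inj_on g (cantor n)" and v: "v \<in> words n" for g :: "nat word \<Rightarrow> nat word" and v
  proof -
    have "v \<frown> ?a \<in> cylinder n v" "v \<frown> ?b \<in> cylinder n v" "v \<frown> ?a \<noteq> v \<frown> ?b"
      using ab by (auto simp: cylinder_def)
    moreover from this have "g (v \<frown> ?a) \<noteq> g (v \<frown> ?b)"
      using cylinder_subset[OF v] inj_on_contraD[OF g] by blast
    ultimately show ?thesis by blast
  qed
  show 1: "f (u \<frown> \<omega>) = theta n f u \<frown> local_action n f u \<omega>" if "\<omega> \<in> cantor n" for \<omega>
  proof -
    have "f (u \<frown> \<omega>) \<in> f ` cylinder n u" using that by (auto simp: cylinder_def)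
    then obtain y where "f (u \<frown> \<omega>) = theta n f u \<frown> y"
      using two[OF inj u] gcp_common unfolding theta_def by metis
    then show ?thesis using that by (simp add: local_action_def)
  qed
  show 2: "inj_on (local_action n f u) (cantor n)"
  proof (rule inj_onI)
    fix x y assume xy: "x \<in> cantor n" "y \<in> cantor n" "local_action n f u x = local_action n f u y"
    then have "f (u \<frown> x) = f (u \<frown> y)" by (simp add: 1)
    moreover have "u \<frown> x \<in> cantor n" "u \<frown> y \<in> cantor n"
      using xy u by (auto simp: conc_in_cantor_iff)
    ultimately have "u \<frown> x = u \<frown> y" using inj by (meson inj_onD)
    then show "x = y" by simp
  qed
  show 3: "theta n f (u @ v) = theta n f u @ theta n (local_action n f u) v"
    if v: "v \<in> words n" for v
  proof -
    have "f ` cylinder n (u @ v) = (\<lambda>y. theta n f u \<frown> y) ` local_action n f u ` cylinder n v"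
      unfolding conc_cylinder[symmetric] image_image
      by (rule image_cong[OF refl]) (use 1 cylinder_subset[OF v] in blast)
    then show ?thesis
      using two[OF 2 v] gcp_conc unfolding theta_def by metis
  qed
  show "local_action n f (u @ v) = local_action n (local_action n f u) v" if v: "v \<in> words n" for v
  proof
    fix \<omega>
    show "local_action n f (u @ v) \<omega> = local_action n (local_action n f u) v \<omega>"
    proof (cases "\<omega> \<in> cantor n")
      case True
      then have "v \<frown> \<omega> \<in> cantor n" using v by (simp add: conc_in_cantor_iff)
      from 1[OF this] have "f ((u @ v) \<frown> \<omega>) = theta n f u \<frown> local_action n f u (v \<frown> \<omega>)" by simp
      then show ?thesis using True unfolding local_action_def[of n f "u @ v"]
          local_action_def[of n "local_action n f u" v]
        by (simp add: 3[OF v])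
    qed (simp add: local_action_def)
  qed
qed

lemma state_map_eqI:
  assumes "\<And>N. \<exists>k. N \<le> length (emit_word T s (prefix k \<omega>))"
    and x: "\<And>k. \<exists>y. x = emit_word T s (prefix k \<omega>) \<frown> y"
  shows "state_map T s \<omega> = x"
  unfolding state_map_def
proof (rule the_equality)
  show "\<forall>k. \<exists>y. x = emit_word T s (prefix k \<omega>) \<frown> y" using x by blast
  fix x' assume x': "\<forall>k. \<exists>y. x' = emit_word T s (prefix k \<omega>) \<frown> y"
  show "x' = x"
  proof
    fix i
    obtain k where "Suc i \<le> length (emit_word T s (prefix k \<omega>))" using assms(1) by blast
    moreover obtain y y' where "x = emit_word T s (prefix k \<omega>) \<frown> y"
      "x' = emit_word T s (prefix k \<omega>) \<frown> y'" using x x' by blast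
    ultimately show "x' i = x i" by simp
  qed
qed

lemma nth_length_mono: "j \<le> k \<Longrightarrow>
    \<exists>v. emit_word T s (prefix k \<omega>) = emit_word T s (prefix j \<omega>) @ v"
proof (induction k)
  case (Suc k)
  show ?case
  proof (cases "j = Suc k")
    case False
    then obtain v where "emit_word T s (prefix k \<omega>) = emit_word T s (prefix j \<omega>) @ v"
      using Suc by auto
    then show ?thesis by (simp add: emit_word_snoc)
  qed simp
qed simp

lemma state_map_extends:
  assumes unb: "\<And>N. \<exists>k. N \<le> length (emit_word T s (prefix k \<omega>))"
  shows "\<exists>y. state_map T s \<omega> = emit_word T s (prefix k \<omega>) \<frown> y"
proof -
  let ?e = "\<lambda>k. emit_word T s (prefix k \<omega>)"
  define K where "K i = (SOME k. Suc i \<le> length (?e k))" for i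
  have K: "i < length (?e (K i))" for i
    using someI_ex[OF unb[of "Suc i"]] unfolding K_def by simp
  define x where "x i = ?e (K i) ! i" for i
  have agree: "?e j ! i = ?e k ! i" if "i < length (?e j)" "i < length (?e k)" for i j k
    by (metis nth_length_mono[of _ _ T s \<omega>] nle_le nth_append that)
  have ex: "\<exists>y. x = ?e k \<frown> y" for k
  proof -
    have "prefix (length (?e k)) x = ?e k"
      by (rule nth_equalityI) (auto simp: x_def intro!: agree K)
    then show ?thesis by (simp add: conc_prefix_iff)
  qed
  have "state_map T s \<omega> = x" by (rule state_map_eqI[OF unb ex])
  then show ?thesis using ex by simp
qed

lemma state_map_build:
  assumes T: "is_transducer n m T" and s: "s \<in> states T" and i: "i < n" and \<omega>: "\<omega> \<in> cantor n"
  shows "state_map T s ([i] \<frown> \<omega>) = emit T s i \<frown> state_map T (step T s i) \<omega>"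
proof (rule state_map_eqI)
  have i\<omega>: "[i] \<frown> \<omega> \<in> cantor n" using i \<omega> by (subst conc_in_cantor_iff) auto
  show "\<exists>k. N \<le> length (emit_word T s (prefix k ([i] \<frown> \<omega>)))" for N
    using T s i\<omega> unfolding is_transducer_def by blast
  have st: "step T s i \<in> states T" using T s i unfolding is_transducer_def by blast
  fix k
  show "\<exists>y. emit T s i \<frown> state_map T (step T s i) \<omega> = emit_word T s (prefix k ([i] \<frown> \<omega>)) \<frown> y"
  proof (cases k)
    case 0
    then show ?thesis by auto
  next
    case (Suc j)
    have p: "prefix k ([i] \<frown> \<omega>) = i # prefix j \<omega>"
      using Suc by (subst prefix_conc_snd) auto
    have "\<exists>y. state_map T (step T s i) \<omega> = emit_word T (step T s i) (prefix j \<omega>) \<frown> y"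
      by (rule state_map_extends) (use T st \<omega> in \<open>auto simp: is_transducer_def\<close>)
    then show ?thesis unfolding p by (metis conc_conc emit_word.simps(2))
  qed
qed

lemma continuous_prefix:
  assumes c: "continuous_map (cantor_space n) (cantor_space m) f" and \<omega>: "\<omega> \<in> cantor n"
  shows "\<exists>k. \<forall>x\<in>cantor n. prefix k x = prefix k \<omega> \<longrightarrow> prefix N (f x) = prefix N (f \<omega>)"
proof -
  have one: "\<exists>k. \<forall>x\<in>cantor n. prefix k x = prefix k \<omega> \<longrightarrow> f x i = f \<omega> i" for i
  proof -
    have p: "continuous_map (cantor_space m) (discrete_topology {..<m}) (\<lambda>y. y i)"
      unfolding cantor_space_def by (rule continuous_map_product_projection) simp
    have c': "continuous_map (cantor_space n) (discrete_topology {..<m}) (\<lambda>x. f x i)"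
      using continuous_map_compose[OF c p] by (simp add: comp_def)
    have "f \<omega> \<in> cantor m" using continuous_map_image_subset_topspace[OF c] \<omega> by blast
    then have "f \<omega> i < m" by (simp add: cantor_iff)
    then have "openin (discrete_topology {..<m}) {f \<omega> i}" by simp
    with c' have "openin (cantor_space n) {x \<in> cantor n. f x i \<in> {f \<omega> i}}"
      by (rule openin_continuous_map_preimage)
    moreover have "\<omega> \<in> {x \<in> cantor n. f x i \<in> {f \<omega> i}}" using \<omega> by simp
    ultimately obtain U where U: "finite {j. U j \<noteq> {..<n}}" "\<omega> \<in> Pi\<^sub>E UNIV U"
      "Pi\<^sub>E UNIV U \<subseteq> {x \<in> cantor n. f x i \<in> {f \<omega> i}}"
      unfolding cantor_space_def openin_product_topology_alt by auto
    obtain k where k: "\<And>j. U j \<noteq> {..<n} \<Longrightarrow> j < k"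
      using finite_nat_set_iff_bounded[THEN iffD1, OF U(1)] by auto
    have "f x i = f \<omega> i" if x: "x \<in> cantor n" "prefix k x = prefix k \<omega>" for x
    proof -
      have "x j \<in> U j" for j
      proof (cases "j < k")
        case True
        then have "x j = \<omega> j" using x(2) by (metis add_0 diff_zero subsequence_nth)
        then show ?thesis using U(2) by auto
      next
        case False
        then show ?thesis using k x(1) by (auto simp: cantor_iff)
      qed
      then show ?thesis using U(3) by auto
    qed
    then show ?thesis by blast
  qed
  then obtain K where K: "\<And>i x. x \<in> cantor n \<Longrightarrow> prefix (K i) x = prefix (K i) \<omega> \<Longrightarrow> f x i = f \<omega> i"
    by metis
  define k where "k = Max (insert 0 (K ` {..<N}))"
  have "prefix N (f x) = prefix N (f \<omega>)" if x: "x \<in> cantor n" "prefix k x = prefix k \<omega>" for x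
  proof (rule nth_equalityI)
    fix i assume "i < length (prefix N (f x))"
    then have "K i \<le> k" unfolding k_def by (intro Max_ge) auto
    then have "prefix (K i) x = prefix (K i) \<omega>"
      using x(2) by (metis min.absorb2 min.commute add_0 subsequence_take)
    then show "prefix N (f x) ! i = prefix N (f \<omega>) ! i"
      using K x(1) \<open>i < _\<close> by simp
  qed simp
  then show ?thesis by blast
qed

context
  fixes n m :: nat and \<psi> :: "nat word \<Rightarrow> nat word"
  assumes n: "2 \<le> n" and m: "2 \<le> m"
    and \<psi>: "homeomorphic_map (cantor_space n) (cantor_space m) \<psi>"
begin

lemma psi_bij: "inj_on \<psi> (cantor n)" "\<psi> ` cantor n = cantor m"
  using \<psi> by (auto simp: homeomorphic_eq_everything_map)

lemma local_action_Nil: "local_action n \<psi> [] = restrict \<psi> (cantor n)"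
proof -
  let ?a = "\<lambda>_::nat. 0::nat" and ?b = "\<lambda>_::nat. 1::nat"
  have ab: "?a \<in> cantor m" "?b \<in> cantor m" "?a \<noteq> ?b"
    using m by (auto simp: cantor_iff dest: fun_cong)
  have "gcp (cantor m) = []"
  proof (rule gcp_eqI[OF ab])
    fix v assume v: "\<And>z. z \<in> cantor m \<Longrightarrow> \<exists>y. z = v \<frown> y"
    then obtain y y' where "?a = v \<frown> y" "?b = v \<frown> y'" using ab by blast
    then have "length v > 0 \<Longrightarrow> (0::nat) = 1" by (metis conc_fst)
    then show "length v \<le> length ([]::nat list)" by auto
  qed auto
  then have "theta n \<psi> [] = []" by (simp add: theta_def cylinder_Nil psi_bij)
  then show ?thesis by (auto simp: local_action_def)
qed

lemma mt_step_word:
  assumes "u \<in> words n" "v \<in> words n"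
  shows "step_word (minimal_transducer n \<psi>) (local_action n \<psi> u) v = local_action n \<psi> (u @ v)"
  using assms(2,1)
proof (induction v rule: rev_induct)
  case (snoc i v)
  then have "local_action n \<psi> ((u @ v) @ [i]) = local_action n (local_action n \<psi> (u @ v)) [i]"
    by (intro local_action_append[OF n psi_bij(1)]) auto
  with snoc show ?case by (simp add: minimal_transducer_def)
qed simp

lemma mt_emit_word:
  assumes "u \<in> words n" "v \<in> words n"
  shows "theta n \<psi> (u @ v) =
    theta n \<psi> u @ emit_word (minimal_transducer n \<psi>) (local_action n \<psi> u) v"
  using assms(2,1)
proof (induction v rule: rev_induct)
  case (snoc i v)
  then have "theta n \<psi> ((u @ v) @ [i]) = theta n \<psi> (u @ v) @ theta n (local_action n \<psi> (u @ v)) [i]"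
    by (intro theta_append[OF n psi_bij(1)]) auto
  with snoc show ?case
    by (simp add: emit_word_snoc mt_step_word) (simp add: minimal_transducer_def)
qed simp

lemma mt_unbounded:
  assumes u: "u \<in> words n" and \<omega>: "\<omega> \<in> cantor n"
  shows "\<exists>k. N \<le> length (emit_word (minimal_transducer n \<psi>) (local_action n \<psi> u) (prefix k \<omega>))"
proof -
  let ?M = "N + length (theta n \<psi> u)"
  have u\<omega>: "u \<frown> \<omega> \<in> cantor n" using u \<omega> by (simp add: conc_in_cantor_iff)
  have c: "continuous_map (cantor_space n) (cantor_space m) \<psi>"
    using \<psi> by (simp add: homeomorphic_imp_continuous_map)
  obtain k where k: "\<And>x. x \<in> cantor n \<Longrightarrow> prefix k x = prefix k (u \<frown> \<omega>) \<Longrightarrow>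
      prefix ?M (\<psi> x) = prefix ?M (\<psi> (u \<frown> \<omega>))"
    using continuous_prefix[OF c u\<omega>] by blast
  let ?v = "u @ prefix k \<omega>"
  have v: "?v \<in> words n" using u prefix_in_words[OF \<omega>] by auto
  have kv: "k \<le> length ?v" by simp
  have pw: "prefix ?M (\<psi> x) = prefix ?M (\<psi> (u \<frown> \<omega>))" if xv: "x \<in> cylinder n ?v" for x
  proof (rule k)
    show "x \<in> cantor n" using xv cylinder_subset[OF v] by blast
    obtain y where "x = ?v \<frown> y" using xv unfolding cylinder_def by blast
    then have "prefix k x = take k ?v" using kv by (metis prefix_conc_fst)
    moreover have "u \<frown> \<omega> = ?v \<frown> suffix k \<omega>" by (metis conc_conc prefix_suffix)
    then have "prefix k (u \<frown> \<omega>) = take k ?v" using kv by (metis prefix_conc_fst)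
    ultimately show "prefix k x = prefix k (u \<frown> \<omega>)" by simp
  qed
  let ?a = "\<lambda>_::nat. 0::nat" and ?b = "\<lambda>_::nat. 1::nat"
  have ab: "?a \<in> cantor n" "?b \<in> cantor n" "?a \<noteq> ?b"
    using n by (auto simp: cantor_iff dest: fun_cong)
  have "?v \<frown> ?a \<in> cylinder n ?v" "?v \<frown> ?b \<in> cylinder n ?v" "?v \<frown> ?a \<noteq> ?v \<frown> ?b"
    using ab by (auto simp: cylinder_def)
  then have ab': "\<psi> (?v \<frown> ?a) \<in> \<psi> ` cylinder n ?v" "\<psi> (?v \<frown> ?b) \<in> \<psi> ` cylinder n ?v"
      "\<psi> (?v \<frown> ?a) \<noteq> \<psi> (?v \<frown> ?b)"
    using cylinder_subset[OF v] psi_bij(1) by (blast, blast, metis inj_on_contraD subsetD)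
  have "length (prefix ?M (\<psi> (u \<frown> \<omega>))) \<le> length (gcp (\<psi> ` cylinder n ?v))"
  proof (rule gcp_max[OF ab'])
    fix z assume "z \<in> \<psi> ` cylinder n ?v"
    then show "\<exists>y. z = prefix ?M (\<psi> (u \<frown> \<omega>)) \<frown> y" using pw by (auto simp: conc_prefix_iff)
  qed
  then have "?M \<le> length (theta n \<psi> ?v)" by (simp add: theta_def[of n \<psi> ?v])
  then have "N \<le> length (emit_word (minimal_transducer n \<psi>) (local_action n \<psi> u) (prefix k \<omega>))"
    using mt_emit_word[OF u prefix_in_words[OF \<omega>]] by simp
  then show ?thesis by blast
qed

lemma mt_state_map:
  assumes u: "u \<in> words n" and \<omega>: "\<omega> \<in> cantor n"
  shows "state_map (minimal_transducer n \<psi>) (local_action n \<psi> u) \<omega> = local_action n \<psi> u \<omega>"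
proof (rule state_map_eqI)
  show "\<exists>k. N \<le> length (emit_word (minimal_transducer n \<psi>) (local_action n \<psi> u) (prefix k \<omega>))" for N
    by (rule mt_unbounded[OF u \<omega>])
  fix k
  let ?p = "prefix k \<omega>"
  have p: "?p \<in> words n" by (rule prefix_in_words[OF \<omega>])
  have sc: "suffix k \<omega> \<in> cantor n" using \<omega> by (simp add: cantor_iff)
  have up: "u @ ?p \<in> words n" using u p by auto
  have "theta n \<psi> u \<frown> local_action n \<psi> u \<omega> = \<psi> (u \<frown> \<omega>)"
    by (rule theta_local_action[OF n psi_bij(1) u \<omega>, symmetric])
  also have "\<dots> = \<psi> ((u @ ?p) \<frown> suffix k \<omega>)" by (metis conc_conc prefix_suffix)
  also have "\<dots> = theta n \<psi> (u @ ?p) \<frown> local_action n \<psi> (u @ ?p) (suffix k \<omega>)"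
    by (rule theta_local_action[OF n psi_bij(1) up sc])
  also have "\<dots> = theta n \<psi> u \<frown> emit_word (minimal_transducer n \<psi>) (local_action n \<psi> u) ?p
      \<frown> local_action n \<psi> (u @ ?p) (suffix k \<omega>)"
    by (simp add: mt_emit_word[OF u p])
  finally have "local_action n \<psi> u \<omega> = emit_word (minimal_transducer n \<psi>) (local_action n \<psi> u) ?p
      \<frown> local_action n \<psi> (u @ ?p) (suffix k \<omega>)" by (simp only: same_concat_eq)
  then show "\<exists>y. local_action n \<psi> u \<omega> =
      emit_word (minimal_transducer n \<psi>) (local_action n \<psi> u) ?p \<frown> y" by blast
qed

theorem minimal_transducer_is_minimal:
  "is_minimal_transducer n m \<psi> (minimal_transducer n \<psi>)"
proof -
  let ?T = "minimal_transducer n \<psi>"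
  have st: "states ?T = local_action n \<psi> ` words n" by (simp add: minimal_transducer_def)
  have s0: "start ?T = local_action n \<psi> []"
    by (simp add: local_action_Nil) (simp add: minimal_transducer_def)
  have la: "local_action n \<psi> u = restrict (local_action n \<psi> u) (cantor n)" for u
    by (auto simp: local_action_def)
  have em: "emit ?T (local_action n \<psi> u) i \<in> words m" if u: "u \<in> words n" and i: "i < n" for u i
  proof -
    let ?a = "\<lambda>_::nat. 0::nat"
    have a: "?a \<in> cantor n" using n by (simp add: cantor_iff)
    have ui: "u @ [i] \<in> words n" using u i by auto
    then have "\<psi> ((u @ [i]) \<frown> ?a) \<in> cantor m"
      using psi_bij(2) a by (metis conc_in_cantor_iff imageI)
    then have "theta n \<psi> (u @ [i]) \<in> words m"
      using theta_local_action[OF n psi_bij(1) ui a] by (metis conc_in_cantor_iff)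
    moreover have "theta n \<psi> (u @ [i]) = theta n \<psi> u @ emit ?T (local_action n \<psi> u) i"
      using mt_emit_word[OF u, of "[i]"] i by simp
    ultimately show ?thesis by simp
  qed
  have sp: "step ?T (local_action n \<psi> u) i = local_action n \<psi> (u @ [i])"
    if "u \<in> words n" "i < n" for u i
    using mt_step_word[of u "[i]"] that by simp
  have "is_transducer n m ?T"
    unfolding is_transducer_def st s0 using em mt_unbounded by (auto simp: sp)
  moreover have "represents n ?T \<psi>"
    unfolding represents_def s0 using mt_state_map[of "[]"] by (simp add: local_action_Nil)
  moreover have "\<forall>s\<in>states ?T. \<exists>u\<in>words n. s = step_word ?T (start ?T) u"
    unfolding st s0 using mt_step_word[of "[]"] by auto
  moreover have "inj_on (\<lambda>s. restrict (state_map ?T s) (cantor n)) (states ?T)"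
  proof (rule inj_on_inverseI[where g = id])
    fix s assume "s \<in> states ?T"
    then obtain u where "u \<in> words n" "s = local_action n \<psi> u" using st by auto
    then show "id (restrict (state_map ?T s) (cantor n)) = s"
      using mt_state_map la by (metis id_apply restrict_ext)
  qed
  moreover have "\<forall>s\<in>states ?T. \<forall>i<n. emit ?T s i = gcp (state_map ?T s ` cylinder n [i])"
  proof (intro ballI allI impI)
    fix s i assume "s \<in> states ?T" and i: "i < n"
    then obtain u where u: "u \<in> words n" "s = local_action n \<psi> u" using st by auto
    have "state_map ?T s ` cylinder n [i] = s ` cylinder n [i]"
      using u i cylinder_subset[of "[i]" n] mt_state_map
      by (intro image_cong) auto
    then show "emit ?T s i = gcp (state_map ?T s ` cylinder n [i])"
      by (simp add: minimal_transducer_def theta_def)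
  qed
  ultimately show ?thesis unfolding is_minimal_transducer_def by blast
qed

theorem minimal_transducer_unique:
  fixes T :: "'s transducer"
  assumes T: "is_minimal_transducer n m \<psi> T"
  shows "\<exists>h. bij_betw h (states T) (states (minimal_transducer n \<psi>))
     \<and> h (start T) = start (minimal_transducer n \<psi>)
     \<and> (\<forall>s\<in>states T. \<forall>i<n. h (step T s i) = step (minimal_transducer n \<psi>) (h s) i
          \<and> emit T s i = emit (minimal_transducer n \<psi>) (h s) i)"
proof -
  let ?M = "minimal_transducer n \<psi>"
  define h where "h s = restrict (state_map T s) (cantor n)" for s
  from T have tr: "is_transducer n m T" and rep: "represents n T \<psi>"
    and reach: "\<And>s. s \<in> states T \<Longrightarrow> \<exists>u\<in>words n. s = step_word T (start T) u"
    and inj: "inj_on h (states T)"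
    and resp: "\<And>s i. s \<in> states T \<Longrightarrow> i < n \<Longrightarrow> emit T s i = gcp (state_map T s ` cylinder n [i])"
    unfolding is_minimal_transducer_def h_def by auto
  have s0: "h (start T) = start ?M"
    using rep by (auto simp: h_def represents_def minimal_transducer_def)
  have em: "emit T s i = theta n (h s) [i]" if "s \<in> states T" "i < n" for s i
  proof -
    have "state_map T s ` cylinder n [i] = h s ` cylinder n [i]"
      using that cylinder_subset[of "[i]" n] unfolding h_def by (intro image_cong) auto
    then show ?thesis using resp[OF that] by (simp add: theta_def)
  qed
  have sp: "h (step T s i) = local_action n (h s) [i]" if s: "s \<in> states T" and i: "i < n" for s i
  proof
    fix \<omega>
    show "h (step T s i) \<omega> = local_action n (h s) [i] \<omega>"
    proof (cases "\<omega> \<in> cantor n")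
      case True
      then have "[i] \<frown> \<omega> \<in> cantor n" using i by (subst conc_in_cantor_iff) auto
      then have "h s ([i] \<frown> \<omega>) = theta n (h s) [i] \<frown> state_map T (step T s i) \<omega>"
        using state_map_build[OF tr s i True] em[OF s i] by (simp only: h_def restrict_apply') 
      then have "suffix (length (theta n (h s) [i])) (h s ([i] \<frown> \<omega>)) = state_map T (step T s i) \<omega>"
        by (simp only: suffix_conc_length)
      then show ?thesis using True by (simp only: h_def[of "step T s i"] local_action_def restrict_apply')
    qed (simp add: h_def local_action_def)
  qed
  have sw: "step_word T (start T) u \<in> states T
      \<and> h (step_word T (start T) u) = step_word ?M (start ?M) u" if "u \<in> words n" for u
    using that
  proof (induction u rule: rev_induct)
    case Nil
    then show ?case using tr s0 by (simp add: is_transducer_def)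
  next
    case (snoc i u)
    then have "step T (step_word T (start T) u) i \<in> states T"
      using tr by (simp add: is_transducer_def)
    with snoc show ?case by (simp add: sp) (simp add: minimal_transducer_def)
  qed
  have reachM: "\<exists>u\<in>words n. s = step_word ?M (start ?M) u" if "s \<in> states ?M" for s
    using minimal_transducer_is_minimal that unfolding is_minimal_transducer_def by blast
  have memM: "step_word ?M (start ?M) u \<in> states ?M" if "u \<in> words n" for u
    using mt_step_word[of "[]" u] that local_action_Nil by (simp add: minimal_transducer_def)
  have "h ` states T = states ?M"
  proof
    show "h ` states T \<subseteq> states ?M" using reach sw memM by fastforce
    show "states ?M \<subseteq> h ` states T" using reachM sw by (metis imageI subsetI)
  qed
  with inj have "bij_betw h (states T) (states ?M)" by (simp add: bij_betw_def)
  moreover have "\<forall>s\<in>states T. \<forall>i<n. h (step T s i) = step ?M (h s) i \<and> emit T s i = emit ?M (h s) i"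
    using sp em by (simp add: minimal_transducer_def)
  ultimately show ?thesis using s0 by blast
qed

end

end

theory Submission
  imports Defs
begin

text \<open>
  If \<open>f \<in> F_n\<close> maps \<open>u \<frown> \<omega>\<close> to \<open>v \<frown> \<omega>\<close> and its conjugate lies in \<open>F_m\<close>, then the conjugate replaces a
  prefix of \<open>\<psi> (u \<frown> w \<frown> \<omega>)\<close> as soon as \<open>w\<close> is long enough, so the local actions of \<open>\<psi>\<close> at \<open>u @ w\<close>
  and \<open>v @ w\<close> agree. Inner words with the same digit sum modulo \<open>n - 1\<close> are exchanged by elements
  of \<open>F_n\<close>; finitely many such pairs, together with \<open>0 \<mapsto> 00\<close> and its mirror image, generate all
  the others, which makes the length of \<open>w\<close> uniform. Monotonicity holds because \<open>\<psi>\<close> maps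
  the two global fixed points of \<open>F_n\<close> to the two of \<open>F_m\<close>, while a point can be pushed towards the left end with
  a larger point held fixed.

  Conversely, the index of a leaf in an ordered complete prefix code determines its digit sum
  modulo \<open>n - 1\<close>. Hence corresponding leaves have, after extension by a long enough word, the same
  local action, so the conjugate is a prefix replacement near every point, and by compactness
  uniformly so. Rationality is automatic: a semi-synchronizing minimal transducer is finite.
\<close>

section \<open>Words\<close>

text \<open>The modulus \<open>n - 1\<close> comes from trees: splitting a leaf into its
  \<open>n\<close> children adds \<open>n - 1\<close> leaves, so the number of leaves to the left of
  a leaf \<open>u\<close> can be adjusted only by multiples of \<open>n - 1\<close>, and in the
  smallest code containing \<open>u\<close> that number is the digit sum of \<open>u\<close>. The
  words \<open>0^k\<close> and \<open>(n-1)^k\<close> are special because nothing lies on one side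
  of them, and an empty side cannot be subdivided; the loops in (i) take care of them. An element of
  \<open>F_m\<close> replaces prefixes only from some depth on, while \<open>\<psi>\<close> may
  output little on \<open>u\<close>; this is what the extension \<open>w\<close> is for. Each pair
  of words brings its own length of \<open>w\<close>, and one length must serve infinitely many
  pairs. So inner words are compared with representatives \<open>0 c\<close> of length 2; a further
  letter leads to a word of length 3, still among the finitely many words treated directly, and the
  length of \<open>w\<close> does not grow. Membership in \<open>F_m\<close> is tested by a
  condition on cylinders of one fixed depth, which survives composition and can be checked near each
  point; matching codes are recovered from it by monotonicity.\<close>

lemma words_append_iff [simp]: "u @ v \<in> words n \<longleftrightarrow> u \<in> words n \<and> v \<in> words n"
  by auto

lemma words_replicate: "i < n \<Longrightarrow> replicate k i \<in> words n"
  by auto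

lemma const_in_cantor: "i < n \<Longrightarrow> (\<lambda>_. i) \<in> cantor n"
  by (simp add: cantor_iff)

lemma suffix_in_cantor: "\<omega> \<in> cantor n \<Longrightarrow> suffix k \<omega> \<in> cantor n"
  by (simp add: cantor_iff)

lemma finite_words_length: "finite {u \<in> words n. length u = N}"
  by (rule rev_finite_subset[OF finite_lists_length_eq[of "{..<n}" N]]) auto

lemma finite_words_length_le: "finite {u \<in> words n. length u \<le> N}"
  by (rule rev_finite_subset[OF finite_lists_length_le[of "{..<n}" N]]) auto

lemma conc_replicate_const [simp]: "replicate k i \<frown> (\<lambda>_. i) = (\<lambda>_. i)"
  by (auto simp: conc_def)

lemma prefix_const: "prefix k (\<lambda>_. i) = replicate k i"
  by (rule nth_equalityI) auto

lemma conc_const_cancel: "u \<frown> \<omega> = (\<lambda>_. i) \<Longrightarrow> u = replicate (length u) i"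
  by (metis prefix_conc_length prefix_const)

lemma conc_eq_cases:
  assumes "u \<frown> x = v \<frown> y"
  shows "(\<exists>r. u = v @ r) \<or> (\<exists>r. v = u @ r)"
proof (cases "length u \<le> length v")
  case True
  then have "u = take (length u) v"
    using assms by (metis prefix_conc_fst prefix_conc_length)
  then show ?thesis by (metis append_take_drop_id)
next
  case False
  then have "v = take (length v) u"
    using assms by (metis nle_le prefix_conc_fst prefix_conc_length)
  then show ?thesis by (metis append_take_drop_id)
qed

lemma conc_eq_longer:
  assumes "u \<frown> x = v \<frown> y" "length u \<le> length v"
  obtains r where "v = u @ r" "x = r \<frown> y"
  using conc_eq_cases[OF assms(1)]
proof
  assume "\<exists>r. u = v @ r"
  then show thesis using assms that[of "[]"] by auto
next
  assume "\<exists>r. v = u @ r"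
  then obtain r where r: "v = u @ r" by blast
  then have "x = r \<frown> y" using assms by (metis conc_conc same_concat_eq)
  with r that show thesis by blast
qed

lemma less_fun_total: "x \<noteq> y \<Longrightarrow> less_fun x y \<or> less_fun y x" for x y :: "nat \<Rightarrow> nat"
proof -
  assume "x \<noteq> y"
  then have ex: "\<exists>i. x i \<noteq> y i" by auto
  define k where "k = (LEAST i. x i \<noteq> y i)"
  have "x k \<noteq> y k" unfolding k_def using ex by (rule LeastI_ex)
  moreover have "x i = y i" if "i < k" for i using that not_less_Least unfolding k_def by blast
  ultimately show ?thesis unfolding less_fun_def by (metis linorder_neqE_nat)
qed

lemma less_fun_conc_cancel [simp]: "less_fun (u \<frown> x) (u \<frown> y) \<longleftrightarrow> less_fun x y"
  for x y :: "nat word"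
proof
  assume "less_fun (u \<frown> x) (u \<frown> y)"
  then obtain k where k: "(u \<frown> x) k < (u \<frown> y) k" "\<And>i. i < k \<Longrightarrow> (u \<frown> x) i = (u \<frown> y) i"
    unfolding less_fun_def by blast
  have l: "length u \<le> k" using k(1) by (metis conc_fst less_irrefl not_le_imp_less)
  have "x i = y i" if "i < k - length u" for i
    using k(2)[of "length u + i"] that by simp
  moreover have "x (k - length u) < y (k - length u)" using k(1) l by simp
  ultimately show "less_fun x y" unfolding less_fun_def by blast
next
  assume "less_fun x y"
  then obtain k where k: "x k < y k" "\<And>i. i < k \<Longrightarrow> x i = y i"
    unfolding less_fun_def by blast
  show "less_fun (u \<frown> x) (u \<frown> y)"
    unfolding less_fun_def by (rule exI[of _ "length u + k"]) (use k in \<open>auto simp: conc_def\<close>)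
qed

lemma less_fun_decomp:
  fixes x y :: "nat word"
  assumes "less_fun x y"
  obtains p a b x' y' where "x = (p @ [a]) \<frown> x'" "y = (p @ [b]) \<frown> y'" "a < b"
proof -
  obtain k where k: "x k < y k" "\<And>i. i < k \<Longrightarrow> x i = y i"
    using assms unfolding less_fun_def by blast
  have "prefix k x = prefix k y" by (rule nth_equalityI) (use k in auto)
  then have "x = (prefix k x @ [x k]) \<frown> suffix (Suc k) x"
    "y = (prefix k x @ [y k]) \<frown> suffix (Suc k) y"
    by (metis prefix_suffix subseq_to_Suc zero_le)+
  with k(1) that show thesis by blast
qed

lemma less_funI_conc: "a < b \<Longrightarrow> less_fun ((p @ a # s) \<frown> x) ((p @ b # t) \<frown> y)"
  for a b :: nat
  unfolding less_fun_def by (rule exI[of _ "length p"]) (simp add: nth_append)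

lemma not_less_fun_const_0: "\<not> less_fun x (\<lambda>_. 0)" for x :: "nat word"
  by (auto elim: less_funE)

lemma not_const_max_less_fun: "x \<in> cantor n \<Longrightarrow> \<not> less_fun (\<lambda>_. n - 1) x"
  unfolding less_fun_def cantor_iff
  by (metis One_nat_def Suc_pred leD less_Suc_eq_le less_nat_zero_code neq0_conv)

text \<open>The first position of difference decides the comparison, so any prefix that reaches it
  is enough.\<close>

lemma less_fun_open:
  assumes "less_fun x y"
  shows "\<exists>M. \<forall>y'. prefix M y' = prefix M y \<longrightarrow> less_fun x y'"
    and "\<exists>M. \<forall>x'. prefix M x' = prefix M x \<longrightarrow> less_fun x' y"
proof -
  obtain k where k: "x k < y k" "\<And>i. i < k \<Longrightarrow> x i = y i"
    using assms unfolding less_fun_def by blast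
  have eq: "z i = z' i" if "prefix (Suc k) z = prefix (Suc k) z'" "i \<le> k" for z z' :: "nat \<Rightarrow> 'b" and i
    using that by (metis add_0 diff_zero less_Suc_eq_le subsequence_nth)
  show "\<exists>M. \<forall>y'. prefix M y' = prefix M y \<longrightarrow> less_fun x y'"
    by (rule exI[of _ "Suc k"]) (metis eq k le_refl less_fun_def less_imp_le)
  show "\<exists>M. \<forall>x'. prefix M x' = prefix M x \<longrightarrow> less_fun x' y"
    by (rule exI[of _ "Suc k"]) (metis eq k le_refl less_fun_def less_imp_le)
qed


section \<open>Prefix codes in lexicographic order\<close>

text \<open>The lexicographic order without its prefix case. \<open>lexordp\<close> also relates a
  word to its proper extensions, whose cylinders are nested; \<open>left_of\<close> survives
  extension of both words and so describes the order of disjoint cylinders.\<close>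

definition left_of :: "nat list \<Rightarrow> nat list \<Rightarrow> bool" where
  "left_of u v \<longleftrightarrow> (\<exists>p a b s t. a < b \<and> u = p @ a # s \<and> v = p @ b # t)"

lemma left_of_append_right: "left_of u v \<Longrightarrow> left_of (u @ s) (v @ t)"
  unfolding left_of_def by fastforce

lemma left_of_less_fun: "left_of u v \<Longrightarrow> less_fun (u \<frown> x) (v \<frown> y)"
  unfolding left_of_def using less_funI_conc by blast

lemma left_of_incomparable: "left_of u v \<Longrightarrow> u \<frown> x \<noteq> v \<frown> y"
  using left_of_less_fun less_fun_irrefl by metis

lemma left_of_lexordp: "left_of u v \<Longrightarrow> ord_class.lexordp u v"
  unfolding left_of_def lexordp_iff by blast

lemma parallel_left_of: "u \<parallel> v \<Longrightarrow> left_of u v \<or> left_of v u"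
proof -
  assume "u \<parallel> v"
  then obtain p a b s t where "a \<noteq> b" "u = p @ a # s" "v = p @ b # t"
    using parallel_decomp by blast
  then show ?thesis unfolding left_of_def by (cases "a < b") (blast, metis linorder_neqE_nat)
qed

lemma left_of_iff: "left_of u v \<longleftrightarrow> ord_class.lexordp u v \<and> u \<parallel> v"
proof
  assume l: "left_of u v"
  have "u \<parallel> v"
    by (rule parallelI) (metis Sublist.prefix_def conc_conc l left_of_incomparable)+
  with l show "ord_class.lexordp u v \<and> u \<parallel> v" by (simp add: left_of_lexordp)
next
  assume "ord_class.lexordp u v \<and> u \<parallel> v"
  then show "left_of u v"
    using parallel_left_of left_of_lexordp by (metis lexordp_antisym)
qed

text \<open>Comparable words have intersecting cylinders, and a common point would have to be
  smaller than itself.\<close>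

lemma cylinders_ordered_left_of:
  assumes "0 < n" "u \<in> words n" "v \<in> words n"
    and less: "\<And>x y. x \<in> cantor n \<Longrightarrow> y \<in> cantor n \<Longrightarrow> less_fun (u \<frown> x) (v \<frown> y)"
  shows "left_of u v"
proof (cases "u \<parallel> v")
  case True
  then show ?thesis
    using less[OF const_in_cantor const_in_cantor, OF assms(1,1)] parallel_left_of left_of_less_fun
    by (metis less_fun_asym)
next
  case False
  have z: "(\<lambda>_. 0) \<in> cantor n" using assms(1) by (rule const_in_cantor)
  have "\<exists>x y. x \<in> cantor n \<and> y \<in> cantor n \<and> u \<frown> x = v \<frown> y"
  proof -
    consider r where "v = u @ r" | r where "u = v @ r"
      using False unfolding parallel_def Sublist.prefix_def by blast
    then show ?thesis
    proof cases
      case 1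
      then have "r \<frown> (\<lambda>_. 0) \<in> cantor n" "u \<frown> r \<frown> (\<lambda>_. 0) = v \<frown> (\<lambda>_. 0)"
        using assms by (auto simp: conc_in_cantor_iff const_in_cantor)
      then show ?thesis using z by blast
    next
      case 2
      then have "r \<frown> (\<lambda>_. 0) \<in> cantor n" "v \<frown> r \<frown> (\<lambda>_. 0) = u \<frown> (\<lambda>_. 0)"
        using assms by (auto simp: conc_in_cantor_iff const_in_cantor)
      then show ?thesis using z by metis
    qed
  qed
  then show ?thesis using less less_fun_irrefl by metis
qed

text \<open>A list rather than a set, because the position of a leaf is what matters later.
  Incomparability and disjointness are contained in \<open>left_of\<close>, so that only the
  covering condition is left of the partition.\<close>

definition ordered_code :: "nat \<Rightarrow> nat list list \<Rightarrow> bool" where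
  "ordered_code n us \<longleftrightarrow> set us \<subseteq> words n \<and> sorted_wrt left_of us
     \<and> (\<forall>\<omega>\<in>cantor n. \<exists>u\<in>set us. \<exists>y. \<omega> = u \<frown> y)"

lemma ordered_code_iff:
  assumes n: "0 < n"
  shows "ordered_code n us \<longleftrightarrow> sorted_wrt ord_class.lexordp us \<and> complete_prefix_code n (set us)"
proof
  assume oc: "ordered_code n us"
  then have w: "set us \<subseteq> words n" and s: "sorted_wrt left_of us"
    and c: "\<forall>\<omega>\<in>cantor n. \<exists>u\<in>set us. \<exists>y. \<omega> = u \<frown> y"
    by (auto simp: ordered_code_def)
  have dj: "u \<parallel> v" if uv: "u \<in> set us" "v \<in> set us" "u \<noteq> v" for u v
  proof -
    obtain i where i: "i < length us" "us ! i = u" using uv(1) by (auto simp: in_set_conv_nth)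
    obtain j where j: "j < length us" "us ! j = v" using uv(2) by (auto simp: in_set_conv_nth)
    have "i < j \<or> j < i" using i j uv(3) by (metis linorder_neqE_nat)
    then have "left_of u v \<or> left_of v u"
      using s i j unfolding sorted_wrt_iff_nth_less by blast
    then show ?thesis unfolding left_of_iff parallel_def by blast
  qed
  have disj: "disjoint (cylinder n ` set us)"
  proof (rule disjointI)
    fix A B assume "A \<in> cylinder n ` set us" "B \<in> cylinder n ` set us" "A \<noteq> B"
    then obtain u v where uv: "u \<in> set us" "v \<in> set us" "A = cylinder n u" "B = cylinder n v" "u \<noteq> v"
      by blast
    then have "left_of u v \<or> left_of v u" using dj parallel_left_of by blast
    then show "A \<inter> B = {}"
      using left_of_incomparable unfolding uv cylinder_def by (metis (no_types, lifting) disjoint_iff imageE)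
  qed
  have "\<Union> (cylinder n ` set us) = cantor n"
  proof
    show "\<Union> (cylinder n ` set us) \<subseteq> cantor n" using w cylinder_subset by blast
    show "cantor n \<subseteq> \<Union> (cylinder n ` set us)"
    proof
      fix \<omega> assume o: "\<omega> \<in> cantor n"
      then obtain u y where "u \<in> set us" "\<omega> = u \<frown> y" using c by blast
      then show "\<omega> \<in> \<Union> (cylinder n ` set us)"
        using o by (auto simp: cylinder_def conc_in_cantor_iff)
    qed
  qed
  moreover have "{} \<notin> cylinder n ` set us"
    using const_in_cantor[OF n] by (auto simp: cylinder_def)
  ultimately have "partition_on (cantor n) (cylinder n ` set us)"
    using disj unfolding partition_on_def by blast
  moreover have "sorted_wrt ord_class.lexordp us"
    using s by (rule sorted_wrt_mono_rel[rotated]) (simp add: left_of_lexordp)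
  ultimately show "sorted_wrt ord_class.lexordp us \<and> complete_prefix_code n (set us)"
    using w dj by (simp add: complete_prefix_code_def pairwise_def)
next
  assume "sorted_wrt ord_class.lexordp us \<and> complete_prefix_code n (set us)"
  then have s: "sorted_wrt ord_class.lexordp us" and w: "set us \<subseteq> words n"
    and p: "pairwise (\<parallel>) (set us)" and c: "\<Union> (cylinder n ` set us) = cantor n"
    by (auto simp: complete_prefix_code_def partition_on_def)
  have "left_of (us ! i) (us ! j)" if "i < j" "j < length us" for i j
  proof -
    have "ord_class.lexordp (us ! i) (us ! j)" using s that by (simp add: sorted_wrt_iff_nth_less)
    moreover from this have "us ! i \<noteq> us ! j" by (metis lexordp_irreflexive')
    then have "us ! i \<parallel> us ! j" using p that by (simp add: pairwise_def)
    ultimately show ?thesis by (simp add: left_of_iff)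
  qed
  then have "sorted_wrt left_of us" by (simp add: sorted_wrt_iff_nth_less)
  moreover have "\<exists>u\<in>set us. \<exists>y. \<omega> = u \<frown> y" if "\<omega> \<in> cantor n" for \<omega>
    using that unfolding c[symmetric] by (auto simp: cylinder_def)
  ultimately show "ordered_code n us" using w by (simp add: ordered_code_def)
qed

lemma ordered_code_Nil: "ordered_code n [[]]"
  by (auto simp: ordered_code_def)

text \<open>The elementary expansion of a tree. It adds \<open>n - 1\<close> leaves, which is where
  the modulus comes from.\<close>

lemma ordered_code_split:
  assumes "ordered_code n (xs @ u # ys)"
  shows "ordered_code n (xs @ map (\<lambda>i. u @ [i]) [0..<n] @ ys)"
proof -
  let ?m = "map (\<lambda>i. u @ [i]) [0..<n]"
  from assms have w: "set (xs @ u # ys) \<subseteq> words n" and s: "sorted_wrt left_of (xs @ u # ys)"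
    and c: "\<forall>\<omega>\<in>cantor n. \<exists>u\<in>set (xs @ u # ys). \<exists>y. \<omega> = u \<frown> y"
    by (auto simp: ordered_code_def)
  have "left_of (u @ [i]) (u @ [j])" if "i < j" for i j
    unfolding left_of_def using that by blast
  then have "sorted_wrt left_of ?m" by (auto simp: sorted_wrt_map sorted_wrt_iff_nth_less)
  moreover have "left_of x (u @ [i])" if "left_of x u" for x i
    using left_of_append_right[OF that, of "[]"] by simp
  moreover have "left_of (u @ [i]) x" if "left_of u x" for x i
    using left_of_append_right[OF that, of _ "[]"] by simp
  ultimately have "sorted_wrt left_of (xs @ ?m @ ys)"
    using s by (auto simp: sorted_wrt_append)
  moreover have "\<exists>u'\<in>set (xs @ ?m @ ys). \<exists>y. \<omega> = u' \<frown> y" if o: "\<omega> \<in> cantor n" for \<omega>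
  proof -
    obtain v y where v: "v \<in> set (xs @ u # ys)" "\<omega> = v \<frown> y" using c o by blast
    show ?thesis
    proof (cases "v = u")
      case True
      have "y \<in> cantor n" using v o by (simp add: conc_in_cantor_iff)
      then have "u @ [y 0] \<in> set ?m" by (auto simp: cantor_iff)
      moreover have "y = [y 0] \<frown> suffix 1 y"
        by (metis One_nat_def append_Nil prefix_suffix subseq_to_Suc subseq_to_zero zero_le)
      then have "\<omega> = (u @ [y 0]) \<frown> suffix 1 y" using v True by (metis conc_conc)
      ultimately show ?thesis by (metis Un_iff set_append)
    qed (use v in auto)
  qed
  ultimately show ?thesis using w by (auto simp: ordered_code_def)
qed

lemma ordered_code_nonempty: "0 < n \<Longrightarrow> ordered_code n us \<Longrightarrow> us \<noteq> []"
  unfolding ordered_code_def using const_in_cantor by fastforce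

lemma ordered_code_left_of_iff:
  assumes "ordered_code n us" "i < length us" "j < length us"
  shows "left_of (us ! i) (us ! j) \<longleftrightarrow> i < j"
proof -
  have "left_of (us ! a) (us ! b)" if "a < b" "b < length us" for a b
    using assms(1) that by (simp add: ordered_code_def sorted_wrt_iff_nth_less)
  moreover have False if "left_of (us ! i) (us ! j)" "left_of (us ! j) (us ! i) \<or> i = j"
    using that left_of_less_fun less_fun_asym less_fun_irrefl by metis
  ultimately show ?thesis using assms(2,3) by (metis linorder_neqE_nat)
qed

lemma ordered_code_index_unique:
  assumes "ordered_code n us" "i < length us" "j < length us" "us ! i \<frown> x = us ! j \<frown> y"
  shows "i = j"
proof (rule ccontr)
  assume "i \<noteq> j"
  then have "left_of (us ! i) (us ! j) \<or> left_of (us ! j) (us ! i)"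
    using assms(1-3) by (auto simp: ordered_code_left_of_iff)
  then show False using assms(4) left_of_incomparable by metis
qed

lemma ordered_code_obtain:
  assumes "ordered_code n us" "\<omega> \<in> cantor n"
  obtains i y where "i < length us" "\<omega> = us ! i \<frown> y" "y \<in> cantor n"
proof -
  obtain u y where "u \<in> set us" "\<omega> = u \<frown> y" using assms by (auto simp: ordered_code_def)
  moreover from this have "y \<in> cantor n" using assms(2) by (simp add: conc_in_cantor_iff)
  ultimately show thesis using that by (metis in_set_conv_nth)
qed

lemma ordered_code_words: "ordered_code n us \<Longrightarrow> i < length us \<Longrightarrow> us ! i \<in> words n"
  unfolding ordered_code_def by (meson nth_mem subsetD)

lemma ordered_code_length_exists:
  "\<exists>us. set us = {u \<in> words n. length u = N} \<and> ordered_code n us"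
proof -
  let ?A = "{u \<in> words n. length u = N}"
  interpret lx: linorder "lexordp_eq :: nat list \<Rightarrow> _" ord_class.lexordp by (rule lexordp_linorder)
  obtain us where us: "set us = ?A" "sorted_wrt lexordp_eq us" "distinct us"
    using lx.finite_sorted_distinct_unique[OF finite_words_length] by blast
  have "left_of (us ! i) (us ! j)" if "i < j" "j < length us" for i j
  proof -
    have ne: "us ! i \<noteq> us ! j" using us(3) that by (simp add: nth_eq_iff_index_eq)
    have "lexordp_eq (us ! i) (us ! j)" using us(2) that by (simp add: sorted_wrt_iff_nth_less)
    then have "ord_class.lexordp (us ! i) (us ! j)" using ne lx.le_less by blast
    moreover have "us ! i \<in> ?A" "us ! j \<in> ?A" using us(1) that by (metis less_trans nth_mem)+
    then have "us ! i \<parallel> us ! j" using ne by (intro not_equal_is_parallel) auto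
    ultimately show ?thesis by (simp add: left_of_iff)
  qed
  moreover have "\<exists>u\<in>set us. \<exists>y. \<omega> = u \<frown> y" if "\<omega> \<in> cantor n" for \<omega>
  proof
    show "\<exists>y. \<omega> = prefix N \<omega> \<frown> y" by (rule exI, rule prefix_suffix)
    show "prefix N \<omega> \<in> set us" using prefix_in_words[OF that] by (simp add: us(1))
  qed
  ultimately have "ordered_code n us"
    using us(1) by (auto simp: ordered_code_def sorted_wrt_iff_nth_less)
  with us(1) show ?thesis by blast
qed

section \<open>Continuity and compactness\<close>

text \<open>Compactness of the Cantor space in combinatorial form (Koenig's lemma).
  \<open>Good u\<close> says that \<open>P\<close> is reached at a uniform depth below
  \<open>u\<close>. If the root were not good, some child would not be good either, and repeating
  the choice gives an infinite branch without any prefix in \<open>P\<close>.\<close>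

lemma fan:
  assumes mono: "\<And>u v. P u \<Longrightarrow> v \<in> words n \<Longrightarrow> P (u @ v)"
    and bar: "\<And>\<omega>. \<omega> \<in> cantor n \<Longrightarrow> \<exists>k. P (prefix k \<omega>)"
  shows "\<exists>k. \<forall>w\<in>words n. length w = k \<longrightarrow> P w"
proof -
  define Good where "Good u \<longleftrightarrow> (\<exists>k. \<forall>w\<in>words n. length w = k \<longrightarrow> P (u @ w))" for u
  have step: "Good u" if g: "\<And>i. i < n \<Longrightarrow> Good (u @ [i])" for u
  proof -
    have "\<forall>i. \<exists>k. i < n \<longrightarrow> (\<forall>w\<in>words n. length w = k \<longrightarrow> P ((u @ [i]) @ w))"
      using g unfolding Good_def by blast
    then obtain K where K: "\<And>i w. i < n \<Longrightarrow> w \<in> words n \<Longrightarrow> length w = K i \<Longrightarrow> P ((u @ [i]) @ w)"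
      by metis
    \<comment> \<open>The inserted 0 gives \<open>Max\<close> a value also for the empty
      alphabet.\<close>
    define M where "M = Max (insert 0 (K ` {..<n}))"
    have "P (u @ w)" if w: "w \<in> words n" "length w = Suc M" for w
    proof -
      obtain i w' where iw: "w = i # w'" "length w' = M" using w(2) by (auto simp: length_Suc_conv)
      then have i: "i < n" "w' \<in> words n" using w by auto
      have "K i \<le> M" unfolding M_def using i by (intro Max_ge) auto
      then have "P ((u @ [i]) @ take (K i) w')"
        using i iw by (intro K) (auto dest: in_set_takeD)
      then have "P (((u @ [i]) @ take (K i) w') @ drop (K i) w')"
        by (rule mono) (use i in \<open>auto dest: in_set_dropD\<close>)
      then show ?thesis using iw by simp
    qed
    then show ?thesis unfolding Good_def by blast
  qed
  define nxt where "nxt u = (SOME i. i < n \<and> \<not> Good (u @ [i]))" for u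
  have nxt: "nxt u < n \<and> \<not> Good (u @ [nxt u])" if "\<not> Good u" for u
    unfolding nxt_def by (rule someI_ex) (use that step in blast)
  define g where "g = rec_nat [] (\<lambda>_ u. u @ [nxt u])"
  have g: "g 0 = []" "g (Suc k) = g k @ [nxt (g k)]" for k by (simp_all add: g_def)
  have "Good []"
  proof (rule ccontr)
    assume "\<not> Good []"
    then have ng: "\<not> Good (g k)" for k by (induction k) (auto simp: g nxt)
    define \<omega> where "\<omega> k = nxt (g k)" for k
    have "prefix k \<omega> = g k" for k by (induction k) (auto simp: g \<omega>_def)
    moreover have "\<omega> \<in> cantor n" using ng nxt by (simp add: cantor_iff \<omega>_def)
    ultimately obtain k where "P (g k)" using bar by metis
    then have "Good (g k)" unfolding Good_def by (intro exI[of _ 0]) simp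
    with ng show False by blast
  qed
  then show ?thesis by (simp add: Good_def)
qed

section \<open>Topology of the Cantor space through cylinders\<close>

lemma openin_cylinder:
  assumes "u \<in> words n"
  shows "openin (cantor_space n) (cylinder n u)"
proof -
  let ?X = "\<lambda>i. if i < length u then {u ! i} else {..<n}"
  have u: "u ! i < n" if "i < length u" for i using assms that by (auto dest: nth_mem)
  have "cylinder n u = (\<Pi>\<^sub>E i\<in>UNIV. ?X i)"
  proof
    show "cylinder n u \<subseteq> (\<Pi>\<^sub>E i\<in>UNIV. ?X i)"
      by (auto simp: cylinder_def cantor_iff conc_def)
    show "(\<Pi>\<^sub>E i\<in>UNIV. ?X i) \<subseteq> cylinder n u"
    proof
      fix x assume "x \<in> (\<Pi>\<^sub>E i\<in>UNIV. ?X i)"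
      then have x: "\<And>i. x i \<in> ?X i" by (simp only: PiE_UNIV_domain Pi_iff UNIV_I simp_thms)
      have "prefix (length u) x = u"

      proof (rule nth_equalityI)
        fix i assume "i < length (prefix (length u) x)"
        then show "prefix (length u) x ! i = u ! i" using x[of i] by simp
      qed simp
      moreover have "x i < n" for i using x[of i] u by (auto split: if_splits)
      ultimately show "x \<in> cylinder n u"
        unfolding cylinder_def by (metis cantor_iff image_eqI prefix_suffix suffix_nth)
    qed
  qed
  moreover have "openin (product_topology (\<lambda>_. discrete_topology {..<n}) UNIV) (\<Pi>\<^sub>E i\<in>UNIV. ?X i)"
    by (rule product_topology_basis) (use u in auto)
  ultimately show ?thesis by (simp add: cantor_space_def)
qed

lemma compact_cantor_space: "compact_space (cantor_space n)"
  by (simp add: cantor_space_def compact_space_product_topology compact_space_discrete_topology)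

lemma Hausdorff_cantor_space: "Hausdorff_space (cantor_space n)"
  by (simp add: cantor_space_def Hausdorff_space_product_topology)

text \<open>The factors are discrete, so continuity amounts to local constancy of each coordinate.
  This is a converse of \<open>continuous_prefix\<close>.\<close>

lemma continuous_map_cantorI:
  assumes into: "\<And>\<omega>. \<omega> \<in> cantor n \<Longrightarrow> f \<omega> \<in> cantor m"
    and loc: "\<And>\<omega> i. \<omega> \<in> cantor n \<Longrightarrow>
      \<exists>k. \<forall>x\<in>cantor n. prefix k x = prefix k \<omega> \<longrightarrow> f x i = f \<omega> i"
  shows "continuous_map (cantor_space n) (cantor_space m) f"
proof -
  have "continuous_map (cantor_space n) (discrete_topology {..<m}) (\<lambda>x. f x i)" for i
    unfolding continuous_map_def
  proof (intro conjI allI impI)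
    show "(\<lambda>x. f x i) \<in> cantor n \<rightarrow> topspace (discrete_topology {..<m})"
      using into by (auto simp: cantor_iff)
    fix U
    show "openin (cantor_space n) {x \<in> cantor n. f x i \<in> U}"
    proof (subst openin_subopen, intro ballI)
      fix \<omega> assume "\<omega> \<in> {x \<in> cantor n. f x i \<in> U}"
      then have o: "\<omega> \<in> cantor n" "f \<omega> i \<in> U" by auto
      obtain k where k: "\<And>x. x \<in> cantor n \<Longrightarrow> prefix k x = prefix k \<omega> \<Longrightarrow> f x i = f \<omega> i"
        using loc[OF o(1)] by blast
      have p: "prefix k \<omega> \<in> words n" using o(1) by (rule prefix_in_words)
      have "\<omega> \<in> cylinder n (prefix k \<omega>)"
        unfolding cylinder_def using suffix_in_cantor[OF o(1)] prefix_suffix by blast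
      moreover have "cylinder n (prefix k \<omega>) \<subseteq> {x \<in> cantor n. f x i \<in> U}"
      proof
        fix x assume x: "x \<in> cylinder n (prefix k \<omega>)"
        then have "prefix k x = prefix k \<omega>" by (auto simp: cylinder_def)
        moreover have "x \<in> cantor n" using x cylinder_subset[OF p] by blast
        ultimately show "x \<in> {x \<in> cantor n. f x i \<in> U}" using k o(2) by simp
      qed
      ultimately show "\<exists>T. openin (cantor_space n) T \<and> \<omega> \<in> T \<and> T \<subseteq> {x \<in> cantor n. f x i \<in> U}"
        using openin_cylinder[OF p] by blast
    qed
  qed
  then show ?thesis
    unfolding cantor_space_def[of m] continuous_map_componentwise_UNIV by blast
qed


section \<open>Maps between ordered prefix codes\<close>

lemma F_group_carrier_iff:
  "f \<in> carrier (F_group n) \<longleftrightarrow> f \<in> extensional (cantor n)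
    \<and> homeomorphic_map (cantor_space n) (cantor_space n) f
    \<and> order_preserving n f \<and> prefix_replacement n f"
  by (simp add: F_group_def)

lemma prefix_replacement_iff:
  assumes "0 < n"
  shows "prefix_replacement n f \<longleftrightarrow>
    (\<exists>us vs. length us = length vs \<and> ordered_code n us \<and> ordered_code n vs
      \<and> (\<forall>i<length us. \<forall>\<omega>\<in>cantor n. f (us ! i \<frown> \<omega>) = vs ! i \<frown> \<omega>))"
  unfolding prefix_replacement_def ordered_code_iff[OF assms] by (intro iff_exI) blast

text \<open>All elements of \<open>F_n\<close> used below come from here. The value is chosen by
  \<open>SOME\<close> over all decompositions of the point; it is well defined because the leaf
  above a point is unique. Strict monotonicity gives injectivity, and a continuous bijection between
  compact Hausdorff spaces is a homeomorphism.\<close>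

lemma F_group_map_between_codes:
  assumes n: "0 < n" and us: "ordered_code n us" and vs: "ordered_code n vs"
    and len: "length us = length vs"
  shows "\<exists>f\<in>carrier (F_group n). \<forall>i<length us. \<forall>\<omega>\<in>cantor n. f (us ! i \<frown> \<omega>) = vs ! i \<frown> \<omega>"
proof -
  define f where
    "f = (\<lambda>x\<in>cantor n. SOME y. \<exists>i \<omega>. i < length us \<and> x = us ! i \<frown> \<omega> \<and> y = vs ! i \<frown> \<omega>)"
  have fe: "f (us ! i \<frown> \<omega>) = vs ! i \<frown> \<omega>" if i: "i < length us" and o: "\<omega> \<in> cantor n" for i \<omega>
  proof -
    have x: "us ! i \<frown> \<omega> \<in> cantor n"
      using ordered_code_words[OF us i] o by (simp add: conc_in_cantor_iff)
    have "\<exists>j \<zeta>. j < length us \<and> us ! i \<frown> \<omega> = us ! j \<frown> \<zeta> \<and> f (us ! i \<frown> \<omega>) = vs ! j \<frown> \<zeta>"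
      unfolding f_def restrict_apply'[OF x]
      by (rule someI_ex[of "\<lambda>y. \<exists>j \<zeta>. j < length us \<and> us ! i \<frown> \<omega> = us ! j \<frown> \<zeta> \<and> y = vs ! j \<frown> \<zeta>"])
        (use i in blast)
    then obtain j \<zeta> where j: "j < length us" "us ! i \<frown> \<omega> = us ! j \<frown> \<zeta>" "f (us ! i \<frown> \<omega>) = vs ! j \<frown> \<zeta>"
      by blast
    then have "i = j" using ordered_code_index_unique[OF us i] by blast
    with j show ?thesis by simp
  qed
  have into: "f x \<in> cantor n" if x: "x \<in> cantor n" for x
    using ordered_code_obtain[OF us x] fe ordered_code_words[OF vs] len
    by (metis conc_in_cantor_iff)
  have mono: "less_fun (f x) (f y)" if xy: "x \<in> cantor n" "y \<in> cantor n" "less_fun x y" for x y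
  proof -
    obtain i a where i: "i < length us" "x = us ! i \<frown> a" "a \<in> cantor n"
      using ordered_code_obtain[OF us xy(1)] by blast
    obtain j b where j: "j < length us" "y = us ! j \<frown> b" "b \<in> cantor n"
      using ordered_code_obtain[OF us xy(2)] by blast
    have f: "f x = vs ! i \<frown> a" "f y = vs ! j \<frown> b" using i j fe by auto
    show ?thesis
    proof (cases i j rule: linorder_cases)
      case less
      then have "left_of (vs ! i) (vs ! j)" using ordered_code_left_of_iff[OF vs] i j len by simp
      then show ?thesis unfolding f by (rule left_of_less_fun)
    next
      case equal
      then show ?thesis using xy(3) i j unfolding f by simp
    next
      case greater
      then have "left_of (us ! j) (us ! i)" using ordered_code_left_of_iff[OF us] i j by simp
      then have "less_fun y x" unfolding i j by (rule left_of_less_fun)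
      then show ?thesis using xy(3) less_fun_asym by blast
    qed
  qed
  have inj: "inj_on f (cantor n)"
    by (rule inj_onI) (metis less_fun_irrefl less_fun_total mono)
  have surj: "y \<in> f ` cantor n" if y: "y \<in> cantor n" for y
  proof -
    obtain i b where i: "i < length vs" "y = vs ! i \<frown> b" "b \<in> cantor n"
      using ordered_code_obtain[OF vs y] by blast
    then have "us ! i \<frown> b \<in> cantor n"
      using ordered_code_words[OF us] len by (simp add: conc_in_cantor_iff)
    moreover have "y = f (us ! i \<frown> b)" using fe i len by simp
    ultimately show ?thesis by blast
  qed
  have "continuous_map (cantor_space n) (cantor_space n) f"
  proof (rule continuous_map_cantorI[OF into])
    fix x i assume x: "x \<in> cantor n"
    obtain j a where j: "j < length us" "x = us ! j \<frown> a" "a \<in> cantor n"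
      using ordered_code_obtain[OF us x] by blast
    \<comment> \<open>This prefix contains the leaf and \<open>Suc i\<close> further letters. Letter
      \<open>i\<close> of the image is either in \<open>vs ! j\<close> or is letter
      \<open>i - length (vs ! j)\<close> of the remainder, hence one of these.\<close>
    let ?k = "length (us ! j) + Suc i"
    have "f y i = f x i" if y: "y \<in> cantor n" "prefix ?k y = prefix ?k x" for y
    proof -
      let ?b = "suffix (length (us ! j)) y"
      have "prefix (length (us ! j)) y = take (length (us ! j)) (prefix ?k y)" by simp
      also have "\<dots> = us ! j" unfolding y(2) j by simp
      finally have yb: "y = us ! j \<frown> ?b" by (metis prefix_suffix)
      have "prefix (Suc i) ?b = drop (length (us ! j)) (prefix ?k y)" by simp
      also have "\<dots> = prefix (Suc i) a" unfolding y(2) j by simp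
      finally have pe: "prefix (Suc i) ?b = prefix (Suc i) a" .
      have ba: "?b l = a l" if "l \<le> i" for l
        using arg_cong[OF pe, of "\<lambda>p. p ! l"] that by (simp del: subseq_to_Suc)
      have "f y = vs ! j \<frown> ?b" using fe[OF j(1) suffix_in_cantor[OF y(1)]] yb by metis
      moreover have "f x = vs ! j \<frown> a" using fe j by simp
      ultimately show ?thesis
        using ba[of "i - length (vs ! j)"] by (cases "i < length (vs ! j)") (simp_all del: suffix_nth)
    qed
    then show "\<exists>k. \<forall>y\<in>cantor n. prefix k y = prefix k x \<longrightarrow> f y i = f x i" by blast
  qed
  then have "homeomorphic_map (cantor_space n) (cantor_space n) f"
    by (intro continuous_imp_homeomorphic_map compact_cantor_space Hausdorff_cantor_space inj)
      (use into surj in auto)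
  moreover have "order_preserving n f"
    using mono by (auto simp: order_preserving_def monotone_on_def)
  moreover have "prefix_replacement n f"
    unfolding prefix_replacement_iff[OF n]
    by (intro exI[of _ us] exI[of _ vs]) (use us vs len fe in simp)
  moreover have "f \<in> extensional (cantor n)" by (simp add: f_def)
  ultimately have "f \<in> carrier (F_group n)" by (simp add: F_group_carrier_iff)
  with fe show ?thesis by blast
qed

text \<open>Only the depth in the domain is uniform; nothing is asked of the words \<open>v\<close>.
  This makes the property easy to verify for composites and conjugates, where matching codes would
  need common refinements. The next lemmas show that for an increasing bijection it is as good as
  \<open>prefix_replacement\<close>.\<close>

definition locally_prefix_replacing :: "nat \<Rightarrow> (nat word \<Rightarrow> nat word) \<Rightarrow> bool" where
  "locally_prefix_replacing n f \<longleftrightarrow>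
    (\<exists>N. \<forall>u\<in>words n. length u = N \<longrightarrow> (\<exists>v. \<forall>\<omega>\<in>cantor n. f (u \<frown> \<omega>) = v \<frown> \<omega>))"

lemma locally_prefix_replacing_obtain:
  assumes "locally_prefix_replacing n f"
  obtains N where "\<And>u. u \<in> words n \<Longrightarrow> N \<le> length u \<Longrightarrow> \<exists>v. \<forall>\<omega>\<in>cantor n. f (u \<frown> \<omega>) = v \<frown> \<omega>"
proof -
  obtain N where N: "\<And>u. u \<in> words n \<Longrightarrow> length u = N \<Longrightarrow> \<exists>v. \<forall>\<omega>\<in>cantor n. f (u \<frown> \<omega>) = v \<frown> \<omega>"
    using assms by (auto simp: locally_prefix_replacing_def)
  have "\<exists>v. \<forall>\<omega>\<in>cantor n. f (u \<frown> \<omega>) = v \<frown> \<omega>" if u: "u \<in> words n" "N \<le> length u" for u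
  proof -
    have w: "take N u \<in> words n" "drop N u \<in> words n"
      using u(1) by (metis append_take_drop_id words_append_iff)+
    obtain v where v: "\<And>\<omega>. \<omega> \<in> cantor n \<Longrightarrow> f (take N u \<frown> \<omega>) = v \<frown> \<omega>"
      using N[OF w(1)] u(2) by auto
    have "f (u \<frown> \<omega>) = (v @ drop N u) \<frown> \<omega>" if "\<omega> \<in> cantor n" for \<omega>
      using v[of "drop N u \<frown> \<omega>"] w(2) that by (simp add: conc_in_cantor_iff)
    then show ?thesis by blast
  qed
  with that show thesis by blast
qed

lemma prefix_replacement_imp_local:
  assumes n: "0 < n" and f: "prefix_replacement n f"
  shows "locally_prefix_replacing n f"
proof -
  obtain us vs where us: "ordered_code n us"
    and f: "\<And>i \<omega>. i < length us \<Longrightarrow> \<omega> \<in> cantor n \<Longrightarrow> f (us ! i \<frown> \<omega>) = vs ! i \<frown> \<omega>"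
    using f by (auto simp: prefix_replacement_iff[OF n])
  define N where "N = Max (length ` set us)"
  have "\<exists>v. \<forall>\<omega>\<in>cantor n. f (u \<frown> \<omega>) = v \<frown> \<omega>" if u: "u \<in> words n" "length u = N" for u
  proof -
    have "u \<frown> (\<lambda>_. 0) \<in> cantor n" using u n by (simp add: conc_in_cantor_iff const_in_cantor)
    then obtain i y where i: "i < length us" "us ! i \<frown> y = u \<frown> (\<lambda>_. 0)"
      using ordered_code_obtain[OF us] by metis
    have "length (us ! i) \<le> N" unfolding N_def using i by (intro Max_ge) auto
    then obtain r where r: "u = us ! i @ r"
      using conc_eq_longer[OF i(2)] u(2) by metis
    have "f (u \<frown> \<omega>) = (vs ! i @ r) \<frown> \<omega>" if "\<omega> \<in> cantor n" for \<omega>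
      using f[OF i(1), of "r \<frown> \<omega>"] r u(1) that by (simp add: conc_in_cantor_iff)
    then show ?thesis by blast
  qed
  then show ?thesis unfolding locally_prefix_replacing_def by blast
qed

text \<open>All words of length \<open>N\<close> serve as the first code. Their replacements form
  the second one: monotonicity makes the image cylinders ordered, hence the words incomparable, and
  surjectivity makes them cover everything.\<close>

lemma local_imp_prefix_replacement:
  assumes n: "0 < n" and b: "bij_betw f (cantor n) (cantor n)"
    and op: "order_preserving n f" and loc: "locally_prefix_replacing n f"
  shows "prefix_replacement n f"
proof -
  obtain N where N: "\<forall>u\<in>words n. length u = N \<longrightarrow> (\<exists>v. \<forall>\<omega>\<in>cantor n. f (u \<frown> \<omega>) = v \<frown> \<omega>)"
    using loc by (auto simp: locally_prefix_replacing_def)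
  then obtain h where h: "\<And>u \<omega>. u \<in> words n \<Longrightarrow> length u = N \<Longrightarrow> \<omega> \<in> cantor n \<Longrightarrow> f (u \<frown> \<omega>) = h u \<frown> \<omega>"
    by metis
  obtain us where us: "set us = {u \<in> words n. length u = N}" "ordered_code n us"
    using ordered_code_length_exists by blast
  have fx: "f (us ! i \<frown> \<omega>) = h (us ! i) \<frown> \<omega>" if "i < length us" "\<omega> \<in> cantor n" for i \<omega>
    using h[of "us ! i"] us(1) nth_mem[OF that(1)] that(2) by blast
  have into: "us ! i \<frown> \<omega> \<in> cantor n" if "i < length us" "\<omega> \<in> cantor n" for i \<omega>
    using ordered_code_words[OF us(2)] that by (simp add: conc_in_cantor_iff)
  have z: "(\<lambda>_. 0) \<in> cantor n" using n by (rule const_in_cantor)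
  have hw: "h (us ! i) \<in> words n" if "i < length us" for i
    using bij_betwE[OF b] into[OF that z] fx[OF that z] by (metis conc_in_cantor_iff)
  have "left_of (h (us ! i)) (h (us ! j))" if ij: "i < j" "j < length us" for i j
  proof (rule cylinders_ordered_left_of[OF n hw hw])
    show "i < length us" "j < length us" using ij by auto
    fix x y assume xy: "x \<in> cantor n" "y \<in> cantor n"
    have "left_of (us ! i) (us ! j)" using ordered_code_left_of_iff[OF us(2)] ij by simp
    then have "less_fun (us ! i \<frown> x) (us ! j \<frown> y)" by (rule left_of_less_fun)
    then have "less_fun (f (us ! i \<frown> x)) (f (us ! j \<frown> y))"
      using op into xy ij unfolding order_preserving_def monotone_on_def by simp
    then show "less_fun (h (us ! i) \<frown> x) (h (us ! j) \<frown> y)"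
      using fx xy ij by simp
  qed
  then have "sorted_wrt left_of (map h us)" by (simp add: sorted_wrt_iff_nth_less)
  moreover have "\<exists>v\<in>set (map h us). \<exists>y. \<omega> = v \<frown> y" if o: "\<omega> \<in> cantor n" for \<omega>
  proof -
    obtain x where x: "x \<in> cantor n" "\<omega> = f x" using b o by (auto simp: bij_betw_def)
    obtain i y where "i < length us" "x = us ! i \<frown> y" "y \<in> cantor n"
      using ordered_code_obtain[OF us(2) x(1)] by blast
    then have "h (us ! i) \<in> set (map h us)" "\<omega> = h (us ! i) \<frown> y" using x fx by auto
    then show ?thesis by blast
  qed
  moreover have "set (map h us) \<subseteq> words n"
    using hw by (metis (no_types, lifting) in_set_conv_nth length_map nth_map subsetI)
  ultimately have "ordered_code n (map h us)" by (simp add: ordered_code_def)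
  then show ?thesis
    unfolding prefix_replacement_iff[OF n] using us(2) fx
    by (intro exI[of _ us] exI[of _ "map h us"]) simp
qed

section \<open>The groups\<close>

lemma homeomorphic_map_bij_betw:
  "homeomorphic_map X Y f \<Longrightarrow> bij_betw f (topspace X) (topspace Y)"
  by (simp add: homeomorphic_eq_everything_map bij_betw_def)

lemma homeomorphic_map_inv_into:
  assumes "homeomorphic_map X Y f"
  shows "homeomorphic_map Y X (inv_into (topspace X) f)"
proof -
  obtain g where g: "homeomorphic_maps X Y f g" using assms homeomorphic_map_maps by blast
  then have gm: "homeomorphic_map Y X g" and gf: "\<And>x. x \<in> topspace X \<Longrightarrow> g (f x) = x"
    by (auto simp: homeomorphic_maps_map)
  have f: "inj_on f (topspace X)" "f ` topspace X = topspace Y"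
    using assms by (auto simp: homeomorphic_eq_everything_map)
  show ?thesis
  proof (rule homeomorphic_map_eq[OF gm])
    fix y assume "y \<in> topspace Y"
    then obtain x where "x \<in> topspace X" "y = f x" using f(2) by blast
    then show "g y = inv_into (topspace X) f y" using f(1) gf by simp
  qed
qed

text \<open>The relation \<open>R\<close> is the lexicographic order for increasing maps and its
  converse for decreasing ones, so that one lemma serves both cases.\<close>

lemma inv_into_order:
  fixes f :: "nat word \<Rightarrow> 'b"
  assumes b: "bij_betw f A B" and mono: "\<And>x y. x \<in> A \<Longrightarrow> y \<in> A \<Longrightarrow> less_fun x y \<Longrightarrow> R (f x) (f y)"
    and asym: "\<And>x y. R x y \<Longrightarrow> \<not> R y x"
    and xy: "x \<in> B" "y \<in> B" "R x y"
  shows "less_fun (inv_into A f x) (inv_into A f y)"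
proof -
  have m: "inv_into A f x \<in> A" "inv_into A f y \<in> A"
    and e: "f (inv_into A f x) = x" "f (inv_into A f y) = y"
    using b xy by (auto simp: bij_betw_def inv_into_into f_inv_into_f)
  then show ?thesis using mono[OF m(2,1)] less_fun_total asym xy(3) by metis
qed

lemma locally_prefix_replacing_compose:
  assumes f: "locally_prefix_replacing n f" and g: "locally_prefix_replacing n g"
    and into: "\<And>x. x \<in> cantor n \<Longrightarrow> g x \<in> cantor n" and n: "0 < n"
  shows "locally_prefix_replacing n (f \<circ> g)"
proof -
  obtain N where N: "\<And>u. u \<in> words n \<Longrightarrow> N \<le> length u \<Longrightarrow> \<exists>v. \<forall>\<omega>\<in>cantor n. f (u \<frown> \<omega>) = v \<frown> \<omega>"
    using locally_prefix_replacing_obtain[OF f] by blast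
  obtain M where M: "\<And>u. u \<in> words n \<Longrightarrow> M \<le> length u \<Longrightarrow> \<exists>v. \<forall>\<omega>\<in>cantor n. g (u \<frown> \<omega>) = v \<frown> \<omega>"
    using locally_prefix_replacing_obtain[OF g] by blast
  \<comment> \<open>The first \<open>M\<close> letters let \<open>g\<close> replace a prefix. The
    other \<open>N\<close> letters pass through \<open>g\<close> unchanged, so the word handed to
    \<open>f\<close> is long enough whatever the length of the replacement.\<close>
  have "\<exists>v. \<forall>\<omega>\<in>cantor n. (f \<circ> g) (u \<frown> \<omega>) = v \<frown> \<omega>" if u: "u \<in> words n" "length u = M + N" for u
  proof -
    have w: "take M u \<in> words n" "drop M u \<in> words n"
      using u(1) by (metis append_take_drop_id words_append_iff)+
    obtain v where v: "\<And>\<omega>. \<omega> \<in> cantor n \<Longrightarrow> g (take M u \<frown> \<omega>) = v \<frown> \<omega>"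
      using M[OF w(1)] u(2) by auto
    have g': "g (u \<frown> \<omega>) = (v @ drop M u) \<frown> \<omega>" if "\<omega> \<in> cantor n" for \<omega>
      using v[of "drop M u \<frown> \<omega>"] w(2) that by (simp add: conc_in_cantor_iff)
    have z: "(\<lambda>_. 0) \<in> cantor n" using n by (rule const_in_cantor)
    then have "u \<frown> (\<lambda>_. 0) \<in> cantor n" using u(1) by (simp add: conc_in_cantor_iff)
    then have "v @ drop M u \<in> words n" using g'[OF z] into by (metis conc_in_cantor_iff)
    moreover have "N \<le> length (v @ drop M u)" using u(2) by simp
    ultimately show ?thesis using N[of "v @ drop M u"] g' by (metis comp_apply)
  qed
  then show ?thesis unfolding locally_prefix_replacing_def by blast
qed

lemma prefix_replacement_cong:
  assumes "\<And>x. x \<in> cantor n \<Longrightarrow> f x = g x" "prefix_replacement n f" "0 < n"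
  shows "prefix_replacement n g"
proof -
  obtain us vs where c: "length us = length vs" "ordered_code n us" "ordered_code n vs"
    and f: "\<And>i \<omega>. i < length us \<Longrightarrow> \<omega> \<in> cantor n \<Longrightarrow> f (us ! i \<frown> \<omega>) = vs ! i \<frown> \<omega>"
    using assms(2) by (auto simp: prefix_replacement_iff[OF assms(3)])
  have "g (us ! i \<frown> \<omega>) = vs ! i \<frown> \<omega>" if "i < length us" "\<omega> \<in> cantor n" for i \<omega>
    using f[OF that] assms(1)[of "us ! i \<frown> \<omega>"] ordered_code_words[OF c(2) that(1)] that(2)
    by (simp add: conc_in_cantor_iff)
  then show ?thesis
    unfolding prefix_replacement_iff[OF assms(3)]
    by (intro exI[of _ us] exI[of _ vs]) (use c in simp)
qed

lemma prefix_replacement_inv_into: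
  assumes n: "0 < n" and b: "bij_betw f (cantor n) (cantor n)" and f: "prefix_replacement n f"
  shows "prefix_replacement n (inv_into (cantor n) f)"
proof -
  obtain us vs where c: "length us = length vs" "ordered_code n us" "ordered_code n vs"
    and f: "\<And>i \<omega>. i < length us \<Longrightarrow> \<omega> \<in> cantor n \<Longrightarrow> f (us ! i \<frown> \<omega>) = vs ! i \<frown> \<omega>"
    using f by (auto simp: prefix_replacement_iff[OF n])
  have "inv_into (cantor n) f (vs ! i \<frown> \<omega>) = us ! i \<frown> \<omega>" if i: "i < length vs" "\<omega> \<in> cantor n" for i \<omega>
  proof (rule inv_into_f_eq)
    show "inj_on f (cantor n)" using b by (simp add: bij_betw_def)
    show "us ! i \<frown> \<omega> \<in> cantor n"
      using ordered_code_words[OF c(2)] i c(1) by (simp add: conc_in_cantor_iff)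
    show "f (us ! i \<frown> \<omega>) = vs ! i \<frown> \<omega>" using f i c(1) by simp
  qed
  then show ?thesis
    unfolding prefix_replacement_iff[OF n]
    by (intro exI[of _ vs] exI[of _ us]) (use c in simp)
qed

lemma F_group_carrier_D:
  assumes "f \<in> carrier (F_group n)"
  shows "bij_betw f (cantor n) (cantor n)"
    and "\<And>x. x \<in> cantor n \<Longrightarrow> f x \<in> cantor n"
    and "\<And>x y. x \<in> cantor n \<Longrightarrow> y \<in> cantor n \<Longrightarrow> less_fun x y \<Longrightarrow> less_fun (f x) (f y)"
    and "f \<in> Bij (cantor n)"
proof -
  have f: "f \<in> extensional (cantor n)" "homeomorphic_map (cantor_space n) (cantor_space n) f"
    "order_preserving n f" using assms by (auto simp: F_group_carrier_iff)
  show b: "bij_betw f (cantor n) (cantor n)" using f(2) by (rule homeomorphic_map_bij_betw)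
  then show "\<And>x. x \<in> cantor n \<Longrightarrow> f x \<in> cantor n" by (rule bij_betwE[THEN bspec])
  show "\<And>x y. x \<in> cantor n \<Longrightarrow> y \<in> cantor n \<Longrightarrow> less_fun x y \<Longrightarrow> less_fun (f x) (f y)"
    using f(3) by (auto simp: order_preserving_def monotone_on_def)
  show "f \<in> Bij (cantor n)" using b f(1) by (simp add: Bij_def)
qed

lemma F_group_one_closed:
  assumes "0 < n"
  shows "(\<lambda>x\<in>cantor n. x) \<in> carrier (F_group n)"
proof -
  have "\<exists>f\<in>carrier (F_group n). \<forall>\<omega>\<in>cantor n. f \<omega> = \<omega>"
    using F_group_map_between_codes[OF assms ordered_code_Nil ordered_code_Nil refl] by simp
  then obtain f where f: "f \<in> carrier (F_group n)" and e: "\<forall>\<omega>\<in>cantor n. f \<omega> = \<omega>" by blast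
  have "f = (\<lambda>x\<in>cantor n. x)"
  proof
    fix x
    show "f x = (\<lambda>x\<in>cantor n. x) x"
    proof (cases "x \<in> cantor n")
      case True
      then show ?thesis using e by simp
    next
      case False
      then show ?thesis using f by (simp add: F_group_carrier_iff extensional_def)
    qed
  qed
  with f show ?thesis by simp
qed

lemma F_group_compose_closed:
  assumes n: "0 < n" and f: "f \<in> carrier (F_group n)" and g: "g \<in> carrier (F_group n)"
  shows "compose (cantor n) f g \<in> carrier (F_group n)"
proof -
  note fD = F_group_carrier_D[OF f] and gD = F_group_carrier_D[OF g]
  have eq: "(f \<circ> g) x = compose (cantor n) f g x" if "x \<in> cantor n" for x
    using that by (simp add: compose_def)
  have h: "homeomorphic_map (cantor_space n) (cantor_space n) (f \<circ> g)"
    using f g by (intro homeomorphic_map_compose) (auto simp: F_group_carrier_iff)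
  have op: "order_preserving n (f \<circ> g)"
    using fD gD by (auto simp: order_preserving_def monotone_on_def)
  have "locally_prefix_replacing n (f \<circ> g)"
    by (rule locally_prefix_replacing_compose)
      (use f g n gD(2) in \<open>auto simp: F_group_carrier_iff intro: prefix_replacement_imp_local\<close>)
  then have "prefix_replacement n (f \<circ> g)"
    using local_imp_prefix_replacement n homeomorphic_map_bij_betw[OF h] op by blast
  then have "prefix_replacement n (compose (cantor n) f g)"
    using prefix_replacement_cong eq n by blast
  moreover have "homeomorphic_map (cantor_space n) (cantor_space n) (compose (cantor n) f g)"
    using homeomorphic_map_eq[OF h] eq by blast
  moreover have "order_preserving n (compose (cantor n) f g)"
    using op unfolding order_preserving_def monotone_on_def by (simp add: compose_def)
  ultimately show ?thesis by (simp add: F_group_carrier_iff compose_extensional)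
qed

lemma F_group_inv_closed:
  assumes n: "0 < n" and f: "f \<in> carrier (F_group n)"
  shows "restrict (inv_into (cantor n) f) (cantor n) \<in> carrier (F_group n)"
proof -
  let ?g = "inv_into (cantor n) f"
  note fD = F_group_carrier_D[OF f]
  have eq: "?g x = restrict ?g (cantor n) x" if "x \<in> cantor n" for x
    using that by simp
  have h: "homeomorphic_map (cantor_space n) (cantor_space n) ?g"
    using f by (intro homeomorphic_map_inv_into) (simp add: F_group_carrier_iff)
  have "less_fun (?g x) (?g y)" if "x \<in> cantor n" "y \<in> cantor n" "less_fun x y" for x y
    using inv_into_order[OF fD(1), of less_fun] fD(3) less_fun_asym that by blast
  then have "order_preserving n (restrict ?g (cantor n))"
    by (auto simp: order_preserving_def monotone_on_def)
  moreover have "prefix_replacement n (restrict ?g (cantor n))"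
    by (rule prefix_replacement_cong[OF _ prefix_replacement_inv_into[OF n fD(1)]])
      (use f n in \<open>auto simp: F_group_carrier_iff\<close>)
  moreover have "homeomorphic_map (cantor_space n) (cantor_space n) (restrict ?g (cantor n))"
    using homeomorphic_map_eq[OF h] eq by blast
  ultimately show ?thesis by (simp add: F_group_carrier_iff)
qed

lemma F_group_subgroup:
  assumes "0 < n"
  shows "subgroup (carrier (F_group n)) (BijGroup (cantor n))"
proof
  show "carrier (F_group n) \<subseteq> carrier (BijGroup (cantor n))"
    using F_group_carrier_D(4) by (auto simp: BijGroup_def)
  show "x \<otimes>\<^bsub>BijGroup (cantor n)\<^esub> y \<in> carrier (F_group n)"
    if "x \<in> carrier (F_group n)" "y \<in> carrier (F_group n)" for x y
    using F_group_compose_closed[OF assms that] F_group_carrier_D(4) that by (simp add: BijGroup_def)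
  show "\<one>\<^bsub>BijGroup (cantor n)\<^esub> \<in> carrier (F_group n)"
    using F_group_one_closed[OF assms] by (simp add: BijGroup_def)
  show "inv\<^bsub>BijGroup (cantor n)\<^esub> x \<in> carrier (F_group n)" if "x \<in> carrier (F_group n)" for x
    using F_group_inv_closed[OF assms that] F_group_carrier_D(4)[OF that] by (simp add: inv_BijGroup)
qed

lemma F_group_eq: "F_group n = (BijGroup (cantor n))\<lparr>carrier := carrier (F_group n)\<rparr>"
  by (simp add: F_group_def)

section \<open>Conjugation as a homomorphism\<close>

definition conj_map :: "nat \<Rightarrow> nat \<Rightarrow> (nat word \<Rightarrow> nat word) \<Rightarrow> (nat word \<Rightarrow> nat word) \<Rightarrow> nat word \<Rightarrow> nat word" where
  "conj_map n m \<psi> f = (\<lambda>\<omega>\<in>cantor m. \<psi> (f (inv_into (cantor n) \<psi> \<omega>)))"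

lemma F_conj_eq: "F_conj n m \<psi> = conj_map n m \<psi> ` carrier (F_group n)"
  by (auto simp: F_conj_def conj_map_def)

text \<open>Conjugation by a bijection is a homomorphism into the group of all bijections of
  \<open>cantor m\<close>, so its image is a subgroup there in any case; only the inclusion in
  \<open>F_m\<close> is in question.\<close>

lemma subgroup_F_conj_iff:
  assumes n: "0 < n" and m: "0 < m" and b: "bij_betw \<psi> (cantor n) (cantor m)"
  shows "subgroup (F_conj n m \<psi>) (F_group m) \<longleftrightarrow> F_conj n m \<psi> \<subseteq> carrier (F_group m)"
proof
  show "F_conj n m \<psi> \<subseteq> carrier (F_group m)" if "subgroup (F_conj n m \<psi>) (F_group m)"
    using that by (rule subgroup.subset)
next
  assume sub: "F_conj n m \<psi> \<subseteq> carrier (F_group m)"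
  let ?Gn = "F_group n" and ?Bm = "BijGroup (cantor m)" and ?i = "inv_into (cantor n) \<psi>"
  have bi: "bij_betw ?i (cantor m) (cantor n)" using b by (rule bij_betw_inv_into)
  have cB: "conj_map n m \<psi> f \<in> Bij (cantor m)" if "f \<in> carrier ?Gn" for f
  proof -
    have "bij_betw (\<psi> \<circ> (f \<circ> ?i)) (cantor m) (cantor m)"
      using bij_betw_trans[OF bij_betw_trans[OF bi F_group_carrier_D(1)[OF that]] b] .
    then have "bij_betw (conj_map n m \<psi> f) (cantor m) (cantor m)"
      by (rule bij_betw_cong[THEN iffD1, rotated]) (simp add: conj_map_def)
    then show ?thesis by (simp add: Bij_def conj_map_def)
  qed
  have "conj_map n m \<psi> \<in> hom ?Gn ?Bm"
  proof (rule homI)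
    show "conj_map n m \<psi> f \<in> carrier ?Bm" if "f \<in> carrier ?Gn" for f
      using cB[OF that] by (simp add: BijGroup_def)
    fix f g assume f: "f \<in> carrier ?Gn" and g: "g \<in> carrier ?Gn"
    have "f \<otimes>\<^bsub>?Gn\<^esub> g = compose (cantor n) f g"
      using F_group_carrier_D(4)[OF f] F_group_carrier_D(4)[OF g]
      by (subst F_group_eq) (simp add: BijGroup_def)
    moreover have "conj_map n m \<psi> f \<otimes>\<^bsub>?Bm\<^esub> conj_map n m \<psi> g
        = compose (cantor m) (conj_map n m \<psi> f) (conj_map n m \<psi> g)"
      using cB[OF f] cB[OF g] by (simp add: BijGroup_def)
    moreover have "conj_map n m \<psi> (compose (cantor n) f g)
        = compose (cantor m) (conj_map n m \<psi> f) (conj_map n m \<psi> g)"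
    proof
      fix x
      show "conj_map n m \<psi> (compose (cantor n) f g) x
          = compose (cantor m) (conj_map n m \<psi> f) (conj_map n m \<psi> g) x"
      proof (cases "x \<in> cantor m")
        case True
        then have i: "?i x \<in> cantor n" using bi by (auto dest: bij_betwE)
        then have gi: "g (?i x) \<in> cantor n" using F_group_carrier_D(2)[OF g] by blast
        then have "\<psi> (g (?i x)) \<in> cantor m" "?i (\<psi> (g (?i x))) = g (?i x)"
          using b by (auto simp: bij_betw_def)
        then show ?thesis using True i by (simp add: conj_map_def compose_def)
      qed (simp add: conj_map_def compose_def)
    qed
    ultimately show "conj_map n m \<psi> (f \<otimes>\<^bsub>?Gn\<^esub> g)
        = conj_map n m \<psi> f \<otimes>\<^bsub>?Bm\<^esub> conj_map n m \<psi> g" by simp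
  qed
  moreover have "group ?Gn"
    using subgroup.subgroup_is_group[OF F_group_subgroup[OF n] group_BijGroup]
    by (simp add: F_group_eq[of n, symmetric])
  ultimately have "group_hom ?Gn ?Bm (conj_map n m \<psi>)"
    by (simp add: group_hom_def group_hom_axioms_def group_BijGroup)
  then have "subgroup (F_conj n m \<psi>) ?Bm"
    unfolding F_conj_eq by (rule group_hom.img_is_subgroup)
  then show "subgroup (F_conj n m \<psi>) (F_group m)"
    using group.subgroup_incl[OF group_BijGroup _ F_group_subgroup[OF m] sub]
    by (simp add: F_group_eq[of m, symmetric])
qed

section \<open>Leaf counting\<close>

text \<open>\<open>M\<close> expansions, each at the leftmost leaf of the current block, so that all
  of them stay below \<open>u\<close> and the other leaves are untouched.\<close>

lemma ordered_code_pump_leaf: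
  assumes "0 < n" "ordered_code n (as @ u # bs)"
  shows "\<exists>ws. length ws = 1 + M * (n - 1) \<and> (\<forall>w\<in>set ws. \<exists>r. w = u @ r) \<and> ordered_code n (as @ ws @ bs)"
proof (induction M)
  case 0
  then show ?case by (intro exI[of _ "[u]"]) (use assms in simp)
next
  case (Suc M)
  then obtain vs where v: "length vs = 1 + M * (n - 1)" "\<forall>w\<in>set vs. \<exists>r. w = u @ r"
    "ordered_code n (as @ vs @ bs)" by blast
  then obtain w ws where vs: "vs = w # ws" by (cases vs) auto
  then have w: "length (w # ws) = 1 + M * (n - 1)"
    "\<forall>w\<in>set (w # ws). \<exists>r. w = u @ r" "ordered_code n (as @ w # ws @ bs)"
    using v by simp_all
  let ?ws = "map (\<lambda>i. w @ [i]) [0..<n] @ ws"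
  have "ordered_code n (as @ ?ws @ bs)" using ordered_code_split[OF w(3)] by simp
  moreover have "length ?ws = 1 + Suc M * (n - 1)" using w(1) assms(1) by simp
  moreover have "\<forall>w\<in>set ?ws. \<exists>r. w = u @ r" using w(2) by auto
  ultimately show ?case by blast
qed

lemma ordered_code_pump:
  assumes "0 < n" "ordered_code n (as @ xs @ bs)" "xs \<noteq> []"
  shows "\<exists>ws. length ws = length xs + M * (n - 1) \<and> ordered_code n (as @ ws @ bs)"
proof -
  obtain x xs' where xs: "xs = x # xs'" using assms(3) by (cases xs) auto
  then obtain ws where "length ws = 1 + M * (n - 1)" "ordered_code n (as @ ws @ xs' @ bs)"
    using ordered_code_pump_leaf[of n as x "xs' @ bs" M] assms by auto
  then show ?thesis by (intro exI[of _ "ws @ xs'"]) (simp add: xs)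
qed

text \<open>\<open>K\<close> expansions down the leftmost branch: a long word at the left end costs
  \<open>K * (n - 1)\<close> additional leaves.\<close>

lemma ordered_code_spine:
  assumes "0 < n" "ordered_code n (u # bs)"
  shows "\<exists>ws. length ws = K * (n - 1) \<and> ordered_code n ((u @ replicate K 0) # ws @ bs)"
proof (induction K)
  case (Suc K)
  then obtain ws where ws: "length ws = K * (n - 1)" "ordered_code n ([] @ (u @ replicate K 0) # ws @ bs)"
    by auto
  have up: "[0..<n] = 0 # [1..<n]" using assms(1) by (simp add: upt_conv_Cons)
  have "ordered_code n ((u @ replicate (Suc K) 0) # (map (\<lambda>i. (u @ replicate K 0) @ [i]) [1..<n] @ ws) @ bs)"
    using ordered_code_split[OF ws(2)] unfolding up by (simp add: replicate_append_same)
  then show ?case using ws(1)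
    by (intro exI[of _ "map (\<lambda>i. (u @ replicate K 0) @ [i]) [1..<n] @ ws"]) simp
qed (use assms in simp)

text \<open>The smallest tree with leaf \<open>u\<close> expands exactly the proper prefixes of
  \<open>u\<close>. At a letter \<open>i\<close> of \<open>u\<close> this puts \<open>i\<close>
  siblings on the left of the path and \<open>n - 1 - i\<close> on the right, whence the two
  counts.\<close>

lemma ordered_code_around:
  assumes "u \<in> words n"
  shows "\<exists>xs ys. ordered_code n (xs @ u # ys) \<and> length xs = sum_list u
    \<and> length xs + length ys = length u * (n - 1)"
  using assms
proof (induction u rule: rev_induct)
  case Nil
  then show ?case by (intro exI[of _ "[]"]) (simp add: ordered_code_Nil)
next
  case (snoc i u)
  then obtain xs ys where xy: "ordered_code n (xs @ u # ys)" "length xs = sum_list u"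
    "length xs + length ys = length u * (n - 1)" and i: "i < n" by auto
  let ?m = "\<lambda>i. u @ [i]"
  have up: "[0..<n] = [0..<i] @ i # [Suc i..<n]"
    using i by (metis le_eq_less_or_eq upt_conv_Cons zero_le upt_add_eq_append le_add_diff_inverse)
  have "ordered_code n ((xs @ map ?m [0..<i]) @ (u @ [i]) # (map ?m [Suc i..<n] @ ys))"
    using ordered_code_split[OF xy(1)] unfolding up by simp
  moreover have "length (xs @ map ?m [0..<i]) + length (map ?m [Suc i..<n] @ ys)
      = length (u @ [i]) * (n - 1)"
    using xy(3) i by simp
  ultimately show ?case using xy(2)
    by (intro exI[of _ "xs @ map ?m [0..<i]"] exI[of _ "map ?m [Suc i..<n] @ ys"]) simp
qed

text \<open>Congruent block lengths become equal by expansion. An empty block offers no leaf to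
  expand, hence the second condition in \<open>e\<close>.\<close>

lemma ordered_code_equalize:
  assumes n: "2 \<le> n" and c: "ordered_code n (as @ xs @ bs)" "ordered_code n (cs @ ys @ ds)"
    and e: "length xs mod (n - 1) = length ys mod (n - 1)" "xs = [] \<longleftrightarrow> ys = []"
  shows "\<exists>xs' ys'. length xs' = length ys' \<and> ordered_code n (as @ xs' @ bs) \<and> ordered_code n (cs @ ys' @ ds)"
proof (cases "xs = []")
  case True
  then show ?thesis using c e by (intro exI[of _ "[]"]) simp
next
  case False
  \<comment> \<open>Each block receives as many expansions as the quotient of the length of the
    other one; both lengths become the common remainder plus both quotients times
    \<open>n - 1\<close>.\<close>
  obtain xs' where x: "length xs' = length xs + (length ys div (n - 1)) * (n - 1)"
    "ordered_code n (as @ xs' @ bs)"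
    using ordered_code_pump[OF _ c(1) False] n by fastforce
  obtain ys' where y: "length ys' = length ys + (length xs div (n - 1)) * (n - 1)"
    "ordered_code n (cs @ ys' @ ds)"
    using ordered_code_pump[OF _ c(2)] False e n by fastforce
  have "length xs' = length ys'"
    using x(1) y(1) e(1) div_mult_mod_eq[of "length xs" "n - 1"] div_mult_mod_eq[of "length ys" "n - 1"]
    by linarith
  with x y show ?thesis by blast
qed

text \<open>The smallest trees around \<open>u\<close> and \<open>v\<close> are expanded on the left
  and on the right separately until \<open>u\<close> and \<open>v\<close> have the same index in
  codes of equal size. Assumptions \<open>l\<close> and \<open>r\<close> say that the left,
  respectively right, blocks are empty for both words or for neither.\<close>

lemma F_group_prefix_map_exists:
  assumes n: "2 \<le> n" and uv: "u \<in> words n" "v \<in> words n"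
    and s: "sum_list u mod (n - 1) = sum_list v mod (n - 1)"
    and l: "sum_list u = 0 \<longleftrightarrow> sum_list v = 0"
    and r: "sum_list u = length u * (n - 1) \<longleftrightarrow> sum_list v = length v * (n - 1)"
  shows "\<exists>f\<in>carrier (F_group n). \<forall>\<omega>\<in>cantor n. f (u \<frown> \<omega>) = v \<frown> \<omega>"
proof -
  obtain xs ys where x: "ordered_code n (xs @ u # ys)" "length xs = sum_list u"
    "length xs + length ys = length u * (n - 1)"
    using ordered_code_around[OF uv(1)] by blast
  obtain xs' ys' where y: "ordered_code n (xs' @ v # ys')" "length xs' = sum_list v"
    "length xs' + length ys' = length v * (n - 1)"
    using ordered_code_around[OF uv(2)] by blast
  have xe: "xs = [] \<longleftrightarrow> xs' = []" using x(2) y(2) l by (metis length_0_conv)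
  obtain X X' where X: "length X = length X'" "ordered_code n ([] @ X @ u # ys)" "ordered_code n ([] @ X' @ v # ys')"
    using ordered_code_equalize[OF n, of "[]" xs "u # ys" "[]" xs' "v # ys'"] x(1,2) y(1,2) s xe by auto
  \<comment> \<open>The two blocks together have a multiple of \<open>n - 1\<close> leaves, so the
    right count is minus the left one modulo \<open>n - 1\<close>, and the congruence on the left
    implies the one on the right. The sign requires integers.\<close>
  have m: "int (length b) mod int (n - 1) = (- int (length a)) mod int (n - 1)"
    if "length a + length b = k * (n - 1)" for a b :: "nat list list" and k
  proof -
    have "int (length b) = - int (length a) + int k * int (n - 1)"
      using that by (metis add.commute add_diff_cancel_left' diff_conv_add_uminus of_nat_add of_nat_mult)
    then show ?thesis by (simp only: mod_mult_self1)
  qed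
  have "int (length xs) mod int (n - 1) = int (length xs') mod int (n - 1)"
    using s x(2) y(2) by (metis of_nat_mod)
  then have "int (length ys) mod int (n - 1) = int (length ys') mod int (n - 1)"
    unfolding m[OF x(3)] m[OF y(3)] by (rule mod_minus_cong)
  then have "length ys mod (n - 1) = length ys' mod (n - 1)" by (metis of_nat_mod nat_int)
  moreover have "ys = [] \<longleftrightarrow> ys' = []"
    using x y r by (metis add_cancel_left_right length_0_conv)
  ultimately obtain Y Y' where Y: "length Y = length Y'" "ordered_code n ((X @ [u]) @ Y @ [])"
    "ordered_code n ((X' @ [v]) @ Y' @ [])"
    using ordered_code_equalize[OF n, of "X @ [u]" ys "[]" "X' @ [v]" ys' "[]"] X by auto
  let ?us = "X @ u # Y" and ?vs = "X' @ v # Y'"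
  have "\<exists>f\<in>carrier (F_group n). \<forall>i<length ?us. \<forall>\<omega>\<in>cantor n. f (?us ! i \<frown> \<omega>) = ?vs ! i \<frown> \<omega>"
    using F_group_map_between_codes[of n ?us ?vs] n X Y by simp
  then obtain f where f: "f \<in> carrier (F_group n)"
    "\<forall>i<length ?us. \<forall>\<omega>\<in>cantor n. f (?us ! i \<frown> \<omega>) = ?vs ! i \<frown> \<omega>" by blast
  have "f (u \<frown> \<omega>) = v \<frown> \<omega>" if "\<omega> \<in> cantor n" for \<omega>
    using f(2)[rule_format, of "length X" \<omega>] that X(1) by (simp add: nth_append)
  with f(1) show ?thesis by blast
qed

section \<open>Digit sums of the leaves of an arbitrary code\<close>

lemma ordered_code_index_mono:
  assumes "ordered_code n us" "k < length us" "l < length us"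
    and "us ! k \<frown> y = us ! l \<frown> z \<or> less_fun (us ! k \<frown> y) (us ! l \<frown> z)"
  shows "k \<le> l"
proof (rule ccontr)
  assume "\<not> k \<le> l"
  then have "left_of (us ! l) (us ! k)" using assms ordered_code_left_of_iff by simp
  then show False
    using assms(4) left_of_less_fun[of "us ! l" "us ! k" z y] less_fun_asym less_fun_irrefl by metis
qed

text \<open>The point \<open>000...\<close> is least, so its leaf has no leaf to the left; a prefix
  of that point consists of zeros.\<close>

lemma ordered_code_first:
  assumes n: "0 < n" and us: "ordered_code n us"
  shows "\<exists>a. us ! 0 = replicate a 0"
proof -
  obtain k y where k: "k < length us" "(\<lambda>_. 0) = us ! k \<frown> y"
    using ordered_code_obtain[OF us const_in_cantor[OF n]] by metis
  have "k = 0"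
  proof (rule ccontr)
    assume "k \<noteq> 0"
    then have "left_of (us ! 0) (us ! k)"
      using ordered_code_left_of_iff[OF us _ k(1), of 0] k(1) by linarith
    then have "less_fun (us ! 0 \<frown> y) (\<lambda>_. 0)" unfolding k(2) by (rule left_of_less_fun)
    then show False using not_less_fun_const_0 by blast
  qed
  then show ?thesis using conc_const_cancel[OF k(2)[symmetric]] by blast
qed

lemma ordered_code_last:
  assumes n: "0 < n" and us: "ordered_code n us"
  shows "\<exists>b. us ! (length us - 1) = replicate b (n - 1)"
proof -
  let ?l = "length us - 1"
  have l: "?l < length us" using ordered_code_nonempty[OF n us] by simp
  have c: "(\<lambda>_. n - 1) \<in> cantor n" using n by (intro const_in_cantor) simp
  obtain k y where k: "k < length us" "(\<lambda>_. n - 1) = us ! k \<frown> y" "y \<in> cantor n"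
    using ordered_code_obtain[OF us c] by metis
  have "k = ?l"
  proof (rule ccontr)
    assume "k \<noteq> ?l"
    then have "k < ?l" using k(1) by simp
    then have "left_of (us ! k) (us ! ?l)" using ordered_code_left_of_iff[OF us] k l by simp
    then have "less_fun (\<lambda>_. n - 1) (us ! ?l \<frown> y)" unfolding k(2) by (rule left_of_less_fun)
    then show False using not_const_max_less_fun ordered_code_words[OF us l] k(3)
      by (metis conc_in_cantor_iff)
  qed
  then show ?thesis using conc_const_cancel[OF k(2)[symmetric]] by blast
qed

text \<open>Let \<open>p\<close> be the common prefix, followed by \<open>a\<close> and
  \<open>b\<close>. The largest point below \<open>p @ [a]\<close> is not smaller than points of
  leaf \<open>i\<close> and lies left of leaf \<open>Suc i\<close>, so it belongs to leaf
  \<open>i\<close>; hence this leaf continues with letters \<open>n - 1\<close> only. Symmetrically,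
  the least point below \<open>p @ [Suc a]\<close> belongs to leaf \<open>Suc i\<close>, which gives
  \<open>b = Suc a\<close> and the zeros.\<close>

lemma ordered_code_adjacent:
  assumes n: "0 < n" and us: "ordered_code n us" and i: "Suc i < length us"
  shows "\<exists>p j a b. us ! i = p @ j # replicate a (n - 1) \<and> us ! Suc i = p @ Suc j # replicate b 0"
proof -
  have "left_of (us ! i) (us ! Suc i)" using ordered_code_left_of_iff[OF us] i by simp
  then obtain p a b s t where ab: "a < b" and u: "us ! i = p @ a # s" and v: "us ! Suc i = p @ b # t"
    unfolding left_of_def by blast
  have w: "p @ a # s \<in> words n" "p @ b # t \<in> words n"
    using ordered_code_words[OF us, of i] ordered_code_words[OF us, of "Suc i"] i u v by auto
  have z: "(\<lambda>_. 0) \<in> cantor n" and x: "(\<lambda>_. n - 1) \<in> cantor n" using n by (auto intro: const_in_cantor)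
  have "(p @ [a]) \<frown> (\<lambda>_. n - 1) \<in> cantor n" using w x by (subst conc_in_cantor_iff) simp
  then obtain k y where k: "k < length us" "(p @ [a]) \<frown> (\<lambda>_. n - 1) = us ! k \<frown> y"
    using ordered_code_obtain[OF us] by metis
  have "left_of (p @ [a]) (p @ b # t)" unfolding left_of_def using ab by blast
  then have "less_fun (us ! k \<frown> y) (us ! Suc i \<frown> y)" "k \<noteq> Suc i"
    unfolding k(2)[symmetric] v using left_of_less_fun left_of_incomparable k(2) v by (blast, metis)
  moreover from this have "k \<le> Suc i" by (intro ordered_code_index_mono[OF us k(1) i]) blast
  ultimately have "k \<le> i" by simp
  have "i \<le> k"
  proof -
    have sz: "s \<frown> (\<lambda>_. 0) \<in> cantor n" using w z by (simp add: conc_in_cantor_iff)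
    have "us ! i \<frown> (\<lambda>_. 0) = (p @ [a]) \<frown> s \<frown> (\<lambda>_. 0)" unfolding u conc_conc by simp
    moreover have "s \<frown> (\<lambda>_. 0) = (\<lambda>_. n - 1) \<or> less_fun (s \<frown> (\<lambda>_. 0)) (\<lambda>_. n - 1)"
      using less_fun_total not_const_max_less_fun[OF sz] by blast
    ultimately have "us ! i \<frown> (\<lambda>_. 0) = us ! k \<frown> y \<or> less_fun (us ! i \<frown> (\<lambda>_. 0)) (us ! k \<frown> y)"
      unfolding k(2)[symmetric] by (metis less_fun_conc_cancel)
    then show ?thesis using i by (intro ordered_code_index_mono[OF us _ k(1)]) simp
  qed
  with \<open>k \<le> i\<close> have "k = i" by simp
  then have "(p @ [a]) \<frown> (\<lambda>_. n - 1) = (p @ [a]) \<frown> s \<frown> y" unfolding k(2) conc_conc using u by simp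
  then have "s \<frown> y = (\<lambda>_. n - 1)" by (simp only: same_concat_eq)
  then have s: "s = replicate (length s) (n - 1)" by (rule conc_const_cancel)
  have "(p @ [Suc a]) \<frown> (\<lambda>_. 0) \<in> cantor n" using w z ab by (subst conc_in_cantor_iff) auto
  then obtain l y' where l: "l < length us" "(p @ [Suc a]) \<frown> (\<lambda>_. 0) = us ! l \<frown> y'"
    using ordered_code_obtain[OF us] by metis
  have "left_of (p @ a # s) (p @ [Suc a])" unfolding left_of_def by blast
  then have "less_fun (us ! i \<frown> y') (us ! l \<frown> y')" "l \<noteq> i"
    unfolding l(2)[symmetric] u using left_of_less_fun left_of_incomparable l(2) u by (blast, metis)
  moreover from this have "i \<le> l" using i by (intro ordered_code_index_mono[OF us _ l(1)]) auto
  ultimately have "Suc i \<le> l" by simp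
  \<comment> \<open>If \<open>b\<close> were larger than \<open>Suc a\<close>, the leaf
    \<open>l\<close> of the second point would fall strictly between two consecutive
    indices.\<close>
  have "l \<le> Suc i \<and> b = Suc a"
  proof (cases "b = Suc a")
    case True
    have "us ! Suc i \<frown> (\<lambda>_. 0) = (p @ [Suc a]) \<frown> t \<frown> (\<lambda>_. 0)" unfolding v True conc_conc by simp
    moreover have "t \<frown> (\<lambda>_. 0) = (\<lambda>_. 0) \<or> less_fun (\<lambda>_. 0) (t \<frown> (\<lambda>_. 0))"
      using less_fun_total not_less_fun_const_0 by blast
    ultimately have "us ! l \<frown> y' = us ! Suc i \<frown> (\<lambda>_. 0) \<or> less_fun (us ! l \<frown> y') (us ! Suc i \<frown> (\<lambda>_. 0))"
      unfolding l(2)[symmetric] by (metis less_fun_conc_cancel)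
    then have "l \<le> Suc i" by (rule ordered_code_index_mono[OF us l(1) i])
    then show ?thesis using True by simp
  next
    case False
    then have lo: "left_of (p @ [Suc a]) (p @ b # t)" unfolding left_of_def using ab
      by (metis Suc_lessI)
    then have "less_fun (us ! l \<frown> y') (us ! Suc i \<frown> y')"
      unfolding l(2)[symmetric] v by (rule left_of_less_fun)
    then have "l \<le> Suc i" by (intro ordered_code_index_mono[OF us l(1) i]) blast
    moreover have "l \<noteq> Suc i" using left_of_incomparable[OF lo] l(2) v by metis
    ultimately show ?thesis using \<open>Suc i \<le> l\<close> by simp
  qed
  with \<open>Suc i \<le> l\<close> have "l = Suc i" and b: "b = Suc a" by auto
  then have "(p @ [Suc a]) \<frown> (\<lambda>_. 0) = (p @ [Suc a]) \<frown> t \<frown> y'" unfolding l(2) conc_conc using v by simp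
  then have "t \<frown> y' = (\<lambda>_. 0)" by (simp only: same_concat_eq)
  then have "t = replicate (length t) 0" by (rule conc_const_cancel)
  then show ?thesis using u v s b by metis
qed

text \<open>Induction along the leaves. The first leaf has sum 0, and by the shape of adjacent
  leaves each step adds one and removes a number of letters \<open>n - 1\<close>, which do not count
  modulo \<open>n - 1\<close>.\<close>

lemma ordered_code_sum_mod:
  assumes n: "0 < n" and us: "ordered_code n us" and i: "i < length us"
  shows "sum_list (us ! i) mod (n - 1) = i mod (n - 1)"
  using i
proof (induction i)
  case 0
  then show ?case using ordered_code_first[OF n us] by (auto simp: sum_list_replicate)
next
  case (Suc i)
  obtain p j a b where e: "us ! i = p @ j # replicate a (n - 1)" "us ! Suc i = p @ Suc j # replicate b 0"
    using ordered_code_adjacent[OF n us Suc.prems] by blast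
  have "sum_list (us ! Suc i) + a * (n - 1) = Suc (sum_list (us ! i))"
    unfolding e by (simp add: sum_list_replicate)
  then have "sum_list (us ! Suc i) mod (n - 1) = Suc (sum_list (us ! i)) mod (n - 1)"
    by (metis mod_mult_self1)
  also have "\<dots> = Suc i mod (n - 1)" using Suc by (metis Suc_lessD mod_Suc_eq)
  finally show ?case .
qed

section \<open>Inner words\<close>

lemma words_sum_list_le: "u \<in> words n \<Longrightarrow> sum_list u \<le> length u * (n - 1)"
  by (induction u) auto

lemma sum_list_eq_0_iff_replicate: "sum_list u = 0 \<longleftrightarrow> u = replicate (length u) 0" for u :: "nat list"
  by (induction u) auto

lemma sum_list_max_iff_replicate:
  assumes "u \<in> words n"
  shows "sum_list u = length u * (n - 1) \<longleftrightarrow> u = replicate (length u) (n - 1)"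
  using assms
proof (induction u)
  case (Cons i u)
  then have w: "u \<in> words n" "i < n" by auto
  have "sum_list u \<le> length u * (n - 1)" "i \<le> n - 1" using words_sum_list_le[OF w(1)] w(2) by auto
  then have "sum_list (i # u) = length (i # u) * (n - 1) \<longleftrightarrow>
      i = n - 1 \<and> sum_list u = length u * (n - 1)" by auto
  then show ?case using Cons.IH by simp
qed simp

text \<open>In terms of leaf counts: in the smallest tree with leaf \<open>u\<close> there are
  leaves on both sides of \<open>u\<close>. This is the form in which
  \<open>F_group_prefix_map_exists\<close> applies to any two inner words of the same class.\<close>

lemma inner_iff:
  "inner n u \<longleftrightarrow> u \<in> words n \<and> sum_list u \<noteq> 0 \<and> sum_list u \<noteq> length u * (n - 1)"
proof
  assume i: "inner n u"
  then have w: "u \<in> words n" by (simp add: inner_def)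
  have "sum_list u \<noteq> 0" using i sum_list_eq_0_iff_replicate[of u] unfolding inner_def by metis
  moreover have "sum_list u \<noteq> length u * (n - 1)"
    using i sum_list_max_iff_replicate[OF w] unfolding inner_def by metis
  ultimately show "u \<in> words n \<and> sum_list u \<noteq> 0 \<and> sum_list u \<noteq> length u * (n - 1)" using w by blast
next
  assume a: "u \<in> words n \<and> sum_list u \<noteq> 0 \<and> sum_list u \<noteq> length u * (n - 1)"
  then have "u \<noteq> []" "u \<noteq> replicate k 0" "u \<noteq> replicate k (n - 1)" for k
    by (auto simp: sum_list_replicate simp del: sum_list_eq_0_iff)
  with a show "inner n u" by (simp add: inner_def)
qed

lemma inner_append:
  assumes "inner n u" "v \<in> words n"
  shows "inner n (u @ v)"
proof -
  have "sum_list u < length u * (n - 1)"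
    using assms words_sum_list_le[of u n] by (simp add: inner_iff)
  moreover have "sum_list v \<le> length v * (n - 1)" using assms(2) by (rule words_sum_list_le)
  ultimately have "sum_list (u @ v) < length (u @ v) * (n - 1)" by (simp add: add_mult_distrib)
  then show ?thesis using assms by (auto simp: inner_iff)
qed

lemma sigma_append_cong:
  "sigma n u = sigma n v \<Longrightarrow> sigma n (u @ w) = sigma n (v @ w)"
  unfolding sigma_def sum_list_append by (rule mod_add_cong) auto

text \<open>The representative of a residue class among \<open>1, ..., n - 1\<close>. Class 0 gets
  \<open>n - 1\<close>, since the letter 0 after zeros would not give an inner word.\<close>

definition residue_letter :: "nat \<Rightarrow> nat \<Rightarrow> nat" where
  "residue_letter n s = (if s mod (n - 1) = 0 then n - 1 else s mod (n - 1))"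

lemma residue_letter:
  assumes "2 \<le> n"
  shows "0 < residue_letter n s" "residue_letter n s \<le> n - 1" "residue_letter n s < n"
    "residue_letter n s mod (n - 1) = s mod (n - 1)"
proof -
  have "s mod (n - 1) < n - 1" using assms by simp
  then show l: "residue_letter n s \<le> n - 1" by (simp add: residue_letter_def)
  then show "residue_letter n s < n" using assms by linarith
  show "0 < residue_letter n s" "residue_letter n s mod (n - 1) = s mod (n - 1)"
    using assms by (auto simp: residue_letter_def)
qed

text \<open>Canonical inner words of every class. At least one zero must precede the letter, because
  the letter can be \<open>n - 1\<close> and then is not inner by itself.\<close>

lemma inner_zeros_residue_letter:
  assumes n: "2 \<le> n" and k: "0 < k"
  shows "inner n (replicate k 0 @ [residue_letter n s])"
    and "sigma n (replicate k 0 @ [residue_letter n s]) = s mod (n - 1)"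
proof -
  have "1 * (n - 1) \<le> k * (n - 1)" using k by (intro mult_right_mono) auto
  then have "residue_letter n s < Suc k * (n - 1)"
    unfolding mult_Suc using residue_letter(2)[OF n, of s] n by linarith
  then show "inner n (replicate k 0 @ [residue_letter n s])"
    unfolding inner_iff using residue_letter[OF n, of s] n
    by (simp add: sum_list_replicate words_replicate)
  show "sigma n (replicate k 0 @ [residue_letter n s]) = s mod (n - 1)"
    using residue_letter[OF n, of s] by (simp add: sigma_def sum_list_replicate)
qed

lemma F_group_inner_map_exists:
  assumes n: "2 \<le> n" and u: "inner n u" and v: "inner n v" and s: "sigma n u = sigma n v"
  shows "\<exists>f\<in>carrier (F_group n). \<forall>\<omega>\<in>cantor n. f (u \<frown> \<omega>) = v \<frown> \<omega>"
  using F_group_prefix_map_exists[OF n, of u v] u v s by (simp add: inner_iff sigma_def del: sum_list_eq_0_iff)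

text \<open>A prefix of \<open>x\<close> that contains a letter other than 0 and a letter other than
  \<open>n - 1\<close> is inner, so it can be carried to a canonical word with so many zeros that a
  nonzero letter of \<open>x\<close> becomes 0.\<close>

lemma F_group_moves:
  assumes n: "2 \<le> n" and x: "x \<in> cantor n" "x \<noteq> (\<lambda>_. 0)" "x \<noteq> (\<lambda>_. n - 1)"
  shows "\<exists>f\<in>carrier (F_group n). f x \<noteq> x"
proof -
  obtain i j where ij: "x i \<noteq> 0" "x j \<noteq> n - 1" using x by fastforce
  define K where "K = Suc (max i j)"
  let ?q = "prefix K x"
  have iK: "i < K" "j < K" unfolding K_def by auto
  then have mem: "x i \<in> set ?q" "x j \<in> set ?q" by auto
  have q: "inner n ?q"
    unfolding inner_def
  proof (intro conjI allI)
    show "?q \<in> words n" using x(1) by (rule prefix_in_words)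
    show "?q \<noteq> []" by (simp add: K_def)
    show "?q \<noteq> replicate k 0" for k using mem(1) ij(1) by (metis in_set_replicate)
    show "?q \<noteq> replicate k (n - 1)" for k using mem(2) ij(2) by (metis in_set_replicate)
  qed
  let ?v = "replicate K 0 @ [residue_letter n (sum_list ?q)]"
  have "0 < K" by (simp add: K_def)
  note v = inner_zeros_residue_letter[OF n this, of "sum_list ?q"]
  obtain f where f: "f \<in> carrier (F_group n)" "\<forall>\<omega>\<in>cantor n. f (?q \<frown> \<omega>) = ?v \<frown> \<omega>"
    using F_group_inner_map_exists[OF n q v(1)] v(2) unfolding sigma_def[of n ?q] by metis
  have "f x = ?v \<frown> suffix K x"
    using f(2)[rule_format, OF suffix_in_cantor[OF x(1), of K]] by simp
  moreover have "i < length ?v" using iK by simp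
  ultimately have "f x i = ?v ! i" by (simp only: conc_fst)
  also have "\<dots> = 0" using iK by (simp add: nth_append)
  finally have "f x \<noteq> x" using ij(1) by auto
  with f(1) show ?thesis by blast
qed

lemma F_group_fixes_ends:
  assumes g: "g \<in> carrier (F_group m)" and m: "0 < m"
  shows "g (\<lambda>_. 0) = (\<lambda>_. 0)" "g (\<lambda>_. m - 1) = (\<lambda>_. m - 1)"
proof -
  note gD = F_group_carrier_D[OF g]
  have c: "(\<lambda>_. 0) \<in> cantor m" "(\<lambda>_. m - 1) \<in> cantor m" using m by (auto intro: const_in_cantor)
  obtain z where z: "z \<in> cantor m" "g z = (\<lambda>_. 0)"
    using gD(1) c by (metis bij_betw_imp_surj_on imageE)
  have "z = (\<lambda>_. 0)"
    using less_fun_total not_less_fun_const_0 gD(3)[OF c(1) z(1)] z(2) by metis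
  with z show "g (\<lambda>_. 0) = (\<lambda>_. 0)" by simp
  obtain y where y: "y \<in> cantor m" "g y = (\<lambda>_. m - 1)"
    using gD(1) c by (metis bij_betw_imp_surj_on imageE)
  have "y = (\<lambda>_. m - 1)"
    using less_fun_total not_const_max_less_fun gD(2,3) y c(2) by metis
  with y show "g (\<lambda>_. m - 1) = (\<lambda>_. m - 1)" by simp
qed

text \<open>
  The point \<open>x\<close> can be pushed towards the left end while \<open>y\<close> stays fixed, provided that a
  whole cylinder lies between them: subdividing that cylinder pays for the subdivisions needed
  at the left end.
\<close>

lemma F_group_push_left:
  assumes n: "2 \<le> n" and xy: "x \<in> cantor n" "y \<in> cantor n" and q: "q \<in> words n"
    and sep: "\<And>\<omega>. \<omega> \<in> cantor n \<Longrightarrow> less_fun x (q \<frown> \<omega>)" "\<And>\<omega>. \<omega> \<in> cantor n \<Longrightarrow> less_fun (q \<frown> \<omega>) y"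
  shows "\<exists>f\<in>carrier (F_group n). f y = y \<and> prefix K (f x) = replicate K 0"
proof -
  have n0: "0 < n" using n by simp
  obtain xs ys where c: "ordered_code n (xs @ q # ys)" using ordered_code_around[OF q] by blast
  let ?us = "xs @ q # ys"
  obtain i z where i: "i < length ?us" "x = ?us ! i \<frown> z" "z \<in> cantor n"
    using ordered_code_obtain[OF c xy(1)] by blast
  obtain j z' where j: "j < length ?us" "y = ?us ! j \<frown> z'" "z' \<in> cantor n"
    using ordered_code_obtain[OF c xy(2)] by blast
  have uq: "?us ! length xs = q" by simp
  have "i \<le> length xs"
    by (rule ordered_code_index_mono[OF c i(1), of _ z z]) (use sep(1)[OF i(3)] i(2) uq in auto)
  moreover have "i \<noteq> length xs" using sep(1)[OF i(3)] i(2) uq less_fun_irrefl by metis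
  ultimately have il: "i < length xs" by simp
  have "length xs \<le> j"
    by (rule ordered_code_index_mono[OF c _ j(1), of _ z' z']) (use sep(2)[OF j(3)] j(2) uq in auto)
  moreover have "j \<noteq> length xs" using sep(2)[OF j(3)] j(2) uq less_fun_irrefl by metis
  ultimately obtain k where k: "j = length xs + Suc k" by (metis less_iff_Suc_add linorder_neqE_nat not_le add_Suc_right)
  then have kl: "k < length ys" and yk: "y = ys ! k \<frown> z'" using j by (auto simp: nth_append)
  obtain x0 xs' where xs: "xs = x0 # xs'" using il by (cases xs) auto
  obtain a where a: "x0 = replicate a 0" using ordered_code_first[OF n0 c] by (auto simp: xs)
  \<comment> \<open>Accounting of expansions: the \<open>length xs + K\<close> expansions below
    \<open>q\<close> in the domain match \<open>K\<close> expansions along the left spine and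
    \<open>length xs\<close> expansions at its tip in the range.\<close>
  obtain ws where ws: "length ws = 1 + (length xs + K) * (n - 1)" "ordered_code n (xs @ ws @ ys)"
    using ordered_code_pump_leaf[OF n0 c, of "length xs + K"] by blast
  obtain ws1 where ws1: "length ws1 = K * (n - 1)"
    "ordered_code n ((x0 @ replicate K 0) # ws1 @ xs' @ q # ys)"
    using ordered_code_spine[OF n0, of x0 "xs' @ q # ys" K] c xs by auto
  obtain ws2 where ws2: "length ws2 = 1 + length xs * (n - 1)"
    "\<forall>w\<in>set ws2. \<exists>r. w = (x0 @ replicate K 0) @ r" "ordered_code n (ws2 @ ws1 @ xs' @ q # ys)"
    using ordered_code_pump_leaf[OF n0, of "[]" "x0 @ replicate K 0" "ws1 @ xs' @ q # ys" "length xs"] ws1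
    by auto
  let ?u = "xs @ ws @ ys" and ?v = "ws2 @ ws1 @ xs' @ q # ys"
  have l: "length (xs @ ws) = length (ws2 @ ws1 @ xs' @ [q])"
    using ws(1) ws1(1) ws2(1) xs by (simp add: add_mult_distrib)
  then have len: "length ?u = length ?v" by simp
  obtain f where f: "f \<in> carrier (F_group n)"
    "\<forall>i<length ?u. \<forall>\<omega>\<in>cantor n. f (?u ! i \<frown> \<omega>) = ?v ! i \<frown> \<omega>"
    using F_group_map_between_codes[OF n0 ws(2) ws2(3) len] by blast
  \<comment> \<open>The block below the tip of the spine has more than \<open>length xs\<close>
    leaves, so all leaves to the left of \<open>q\<close> are sent below \<open>0^K\<close>.\<close>
  have i2: "i < length ws2"
  proof -
    have "length xs * 1 \<le> length xs * (n - 1)" using n by (intro mult_left_mono) auto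
    then show ?thesis using il ws2(1) by linarith
  qed
  have "f x = ws2 ! i \<frown> z"
    using f(2)[rule_format, of i z] il i(2,3) i2 by (simp add: nth_append)
  moreover obtain r where "ws2 ! i = (x0 @ replicate K 0) @ r" using ws2(2) i2 by (meson nth_mem)
  then have "ws2 ! i = replicate K 0 @ replicate a 0 @ r"
    by (simp add: a replicate_add[symmetric] add.commute)
  ultimately have "prefix K (f x) = replicate K 0" by simp
  moreover have "f y = y"
  proof -
    \<comment> \<open>By \<open>l\<close>, the leaves \<open>ys\<close> to the right of
      \<open>q\<close> occupy the same indices in both codes, so everything below them is
      fixed.\<close>
    let ?j = "length (xs @ ws) + k"
    have uj: "?u ! ?j = ys ! k" by (metis append.assoc nth_append_length_plus)
    have vj: "?v ! ?j = ys ! k"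
      unfolding l using nth_append_length_plus[of "ws2 @ ws1 @ xs' @ [q]" ys k] by simp
    have "?j < length ?u" using kl by simp
    then have "f (?u ! ?j \<frown> z') = ?v ! ?j \<frown> z'" using f(2) j(3) by blast
    then show ?thesis unfolding uj vj yk .
  qed
  ultimately show ?thesis using f(1) by blast
qed


section \<open>Homeomorphisms that conjugate \<open>F_n\<close> into \<open>F_m\<close>\<close>

locale cantor_homeomorphism =
  fixes n m :: nat and \<psi> :: "nat word \<Rightarrow> nat word"
  assumes n: "2 \<le> n" and m: "2 \<le> m"
    and \<psi>: "homeomorphic_map (cantor_space n) (cantor_space m) \<psi>"
begin

lemmas psi_inj = psi_bij(1)[OF n m \<psi>]
lemmas psi_image = psi_bij(2)[OF n m \<psi>]

lemma psi_in: "x \<in> cantor n \<Longrightarrow> \<psi> x \<in> cantor m"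
  using psi_image by blast

lemma inv_psi [simp]: "x \<in> cantor n \<Longrightarrow> inv_into (cantor n) \<psi> (\<psi> x) = x"
  using psi_inj by simp

lemma conj_map_psi: "x \<in> cantor n \<Longrightarrow> conj_map n m \<psi> f (\<psi> x) = \<psi> (f x)"
  by (simp add: conj_map_def psi_in)

lemma psi_prefix_continuous:
  assumes "x \<in> cantor n"
  shows "\<exists>k. \<forall>y\<in>cantor n. prefix k y = prefix k x \<longrightarrow> prefix N (\<psi> y) = prefix N (\<psi> x)"
  using continuous_prefix[OF homeomorphic_imp_continuous_map[OF \<psi>] assms] .

lemmas psi_local_action = theta_local_action[OF n psi_inj]
lemmas psi_inj_local_action = inj_local_action[OF n psi_inj]
lemmas psi_theta_append = theta_append[OF n psi_inj]
lemmas psi_local_action_append = local_action_append[OF n psi_inj]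

lemma theta_words: "u \<in> words n \<Longrightarrow> theta n \<psi> u \<in> words m"
  and local_action_in: "u \<in> words n \<Longrightarrow> \<omega> \<in> cantor n \<Longrightarrow> local_action n \<psi> u \<omega> \<in> cantor m"
proof -
  have *: "theta n \<psi> u \<in> words m \<and> local_action n \<psi> u \<omega> \<in> cantor m"
    if "u \<in> words n" "\<omega> \<in> cantor n" for u \<omega>
    using psi_in[of "u \<frown> \<omega>"] that unfolding psi_local_action[OF that] by (simp add: conc_in_cantor_iff)
  show "u \<in> words n \<Longrightarrow> \<omega> \<in> cantor n \<Longrightarrow> local_action n \<psi> u \<omega> \<in> cantor m" using * by blast
  show "u \<in> words n \<Longrightarrow> theta n \<psi> u \<in> words m"
    using *[of u "\<lambda>_. 0"] const_in_cantor[of 0 n] n by simp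
qed

lemma local_action_eq_append:
  assumes "local_action n \<psi> u = local_action n \<psi> v" "u \<in> words n" "v \<in> words n" "w \<in> words n"
  shows "local_action n \<psi> (u @ w) = local_action n \<psi> (v @ w)"
  using psi_local_action_append[OF assms(2,4)] psi_local_action_append[OF assms(3,4)] assms(1) by simp

text \<open>Along each infinite continuation the output grows by continuity of
  \<open>\<psi>\<close>, and output only grows under extension; the fan argument makes the required
  length uniform.\<close>

lemma theta_unbounded:
  assumes u: "u \<in> words n"
  shows "\<exists>k. \<forall>w\<in>words n. length w = k \<longrightarrow> N \<le> length (theta n \<psi> (u @ w))"
proof -
  \<comment> \<open>The monotonicity hypothesis of \<open>fan\<close> ranges over all lists, whereas
    \<open>psi_theta_append\<close> concerns words over the alphabet; the guard
    \<open>w \<in> words n\<close> bridges the gap.\<close>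
  have "\<exists>k. \<forall>w\<in>words n. length w = k \<longrightarrow> (w \<in> words n \<longrightarrow> N \<le> length (theta n \<psi> (u @ w)))"
  proof (rule fan)
    fix w v assume *: "w \<in> words n \<longrightarrow> N \<le> length (theta n \<psi> (u @ w))" "v \<in> words n"
    show "w @ v \<in> words n \<longrightarrow> N \<le> length (theta n \<psi> (u @ w @ v))"
    proof
      assume "w @ v \<in> words n"
      then have w: "u @ w \<in> words n" "w \<in> words n" using u by auto
      show "N \<le> length (theta n \<psi> (u @ w @ v))"
        using psi_theta_append[OF w(1) *(2)] * w(2) by simp
    qed
  next
    fix \<omega> assume o: "\<omega> \<in> cantor n"
    show "\<exists>k. prefix k \<omega> \<in> words n \<longrightarrow> N \<le> length (theta n \<psi> (u @ prefix k \<omega>))"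
      using mt_unbounded[OF n m \<psi> u o, of N] mt_emit_word[OF n m \<psi> u prefix_in_words[OF o]]
      by (metis length_append trans_le_add2)
  qed
  then show ?thesis by simp
qed

text \<open>The values of a local action have no common first letter. Hence a factorization of
  \<open>\<psi>\<close> below \<open>x\<close> into a fixed word and a local action is the one that
  defines \<open>theta\<close> and \<open>local_action\<close> at \<open>x\<close>.\<close>

lemma local_action_eqI:
  assumes u: "u \<in> words n" and x: "x \<in> words n"
    and e: "\<And>\<omega>. \<omega> \<in> cantor n \<Longrightarrow> \<psi> (x \<frown> \<omega>) = v \<frown> local_action n \<psi> u \<omega>"
  shows "theta n \<psi> x = v" "local_action n \<psi> x = local_action n \<psi> u"
proof -
  let ?a = "\<lambda>_::nat. 0::nat" and ?b = "\<lambda>_::nat. 1::nat"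
  let ?h = "local_action n \<psi> u"
  have ab: "?a \<in> cantor n" "?b \<in> cantor n" "?a \<noteq> ?b"
    using n by (auto simp: cantor_iff dest: fun_cong)
  then have ne: "?h ?a \<in> ?h ` cantor n" "?h ?b \<in> ?h ` cantor n" "?h ?a \<noteq> ?h ?b"
    using psi_inj_local_action[OF u] by (auto dest: inj_onD)
  \<comment> \<open>Appending the empty word to \<open>u\<close> leaves
    \<open>theta n \<psi> u\<close> unchanged, so the second factor in
    \<open>psi_theta_append\<close> is empty.\<close>
  have "theta n ?h [] = []" using psi_theta_append[OF u, of "[]"] by simp
  then have g: "gcp (?h ` cantor n) = []" by (simp add: theta_def cylinder_Nil)
  have "\<psi> ` cylinder n x = (\<lambda>y. v \<frown> y) ` ?h ` cantor n"
    unfolding cylinder_def image_image by (rule image_cong) (use e in auto)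
  then have t: "theta n \<psi> x = gcp ((\<lambda>y. v \<frown> y) ` ?h ` cantor n)" by (simp add: theta_def)
  show "theta n \<psi> x = v" unfolding t gcp_conc[OF ne] g by simp
  then show "local_action n \<psi> x = ?h"
    unfolding local_action_def[of n \<psi> x] using e
    by (intro ext) (simp add: local_action_def[of n \<psi> u])
qed

text \<open>Once \<open>theta n \<psi> (u @ w)\<close> reaches the depth \<open>N\<close> of the
  conjugate, the conjugate replaces it by one word \<open>v'\<close>. So \<open>\<psi>\<close> below
  \<open>v @ w\<close> is \<open>v'\<close> followed by the local action at \<open>u @ w\<close>,
  and \<open>local_action_eqI\<close> applies.\<close>

lemma synchronizes_if_conj_in_F_group:
  assumes g: "conj_map n m \<psi> f \<in> carrier (F_group m)"
    and uv: "u \<in> words n" "v \<in> words n" and f: "\<And>\<omega>. \<omega> \<in> cantor n \<Longrightarrow> f (u \<frown> \<omega>) = v \<frown> \<omega>"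
  shows "\<exists>k. \<forall>w\<in>words n. length w = k \<longrightarrow> local_action n \<psi> (u @ w) = local_action n \<psi> (v @ w)"
proof -
  let ?g = "conj_map n m \<psi> f"
  have "locally_prefix_replacing m ?g"
    using g m by (intro prefix_replacement_imp_local) (auto simp: F_group_carrier_iff)
  from locally_prefix_replacing_obtain[OF this]
  obtain N where N: "\<And>u. u \<in> words m \<Longrightarrow> N \<le> length u \<Longrightarrow> \<exists>v. \<forall>\<omega>\<in>cantor m. ?g (u \<frown> \<omega>) = v \<frown> \<omega>"
    by blast
  obtain k where k: "\<And>w. w \<in> words n \<Longrightarrow> length w = k \<Longrightarrow> N \<le> length (theta n \<psi> (u @ w))"
    using theta_unbounded[OF uv(1)] by blast
  have "local_action n \<psi> (u @ w) = local_action n \<psi> (v @ w)" if w: "w \<in> words n" "length w = k" for w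
  proof -
    have uw: "u @ w \<in> words n" "v @ w \<in> words n" using uv w by auto
    obtain v' where v': "\<And>y. y \<in> cantor m \<Longrightarrow> ?g (theta n \<psi> (u @ w) \<frown> y) = v' \<frown> y"
      using N[OF theta_words[OF uw(1)] k[OF w]] by blast
    have "\<psi> ((v @ w) \<frown> \<omega>) = v' \<frown> local_action n \<psi> (u @ w) \<omega>" if o: "\<omega> \<in> cantor n" for \<omega>
    proof -
      have wo: "w \<frown> \<omega> \<in> cantor n" "(u @ w) \<frown> \<omega> \<in> cantor n"
        using w o uw by (simp_all add: conc_in_cantor_iff)
      have "\<psi> ((v @ w) \<frown> \<omega>) = \<psi> (f ((u @ w) \<frown> \<omega>))" using f[OF wo(1)] by simp
      also have "\<dots> = ?g (\<psi> ((u @ w) \<frown> \<omega>))" using conj_map_psi[OF wo(2)] by simp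
      also have "\<dots> = ?g (theta n \<psi> (u @ w) \<frown> local_action n \<psi> (u @ w) \<omega>)"
        by (simp only: psi_local_action[OF uw(1) o])
      also have "\<dots> = v' \<frown> local_action n \<psi> (u @ w) \<omega>"
        by (rule v'[OF local_action_in[OF uw(1) o]])
      finally show ?thesis .
    qed
    from local_action_eqI(2)[OF uw this] show ?thesis by simp
  qed
  then show ?thesis by blast
qed

end

locale conjugator = cantor_homeomorphism +
  assumes conj_closed: "f \<in> carrier (F_group n) \<Longrightarrow> conj_map n m \<psi> f \<in> carrier (F_group m)"
begin

text \<open>The argument runs from the target to the source. Both ends of \<open>cantor m\<close>
  are fixed by \<open>F_m\<close>, in particular by all conjugates, so their preimages are fixed by
  \<open>F_n\<close> and are ends of \<open>cantor n\<close>. The two ends have different preimages,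
  so one of these is \<open>000...\<close>.\<close>

lemma psi_left_end: "\<psi> (\<lambda>_. 0) = (\<lambda>_. 0) \<or> \<psi> (\<lambda>_. 0) = (\<lambda>_. m - 1)"
proof -
  have end_from_end: "\<psi> (\<lambda>_. 0) = e \<or> \<psi> (\<lambda>_. n - 1) = e"
    if e: "e \<in> cantor m" and fixed: "\<And>g. g \<in> carrier (F_group m) \<Longrightarrow> g e = e" for e
  proof -
    obtain z where z: "z \<in> cantor n" "\<psi> z = e" using e unfolding psi_image[symmetric] by blast
    have "f z = z" if f: "f \<in> carrier (F_group n)" for f
    proof -
      have "\<psi> (f z) = \<psi> z"
        using fixed[OF conj_closed[OF f]] conj_map_psi[OF z(1), of f] z(2) by simp
      then show ?thesis using F_group_carrier_D(2)[OF f z(1)] z(1) psi_inj by (meson inj_onD)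
    qed
    then have "z = (\<lambda>_. 0) \<or> z = (\<lambda>_. n - 1)" using F_group_moves[OF n z(1)] by blast
    then show ?thesis using z(2) by blast
  qed
  have c: "(\<lambda>_. 0) \<in> cantor m" "(\<lambda>_. m - 1) \<in> cantor m" using m by (auto intro: const_in_cantor)
  have m0: "0 < m" using m by simp
  have ne: "(\<lambda>_::nat. 0) \<noteq> (\<lambda>_. m - 1)" using m by (auto dest: fun_cong)
  have "\<psi> (\<lambda>_. 0) = (\<lambda>_. 0) \<or> \<psi> (\<lambda>_. n - 1) = (\<lambda>_. 0)"
    by (rule end_from_end[OF c(1)]) (rule F_group_fixes_ends(1)[OF _ m0])
  moreover have "\<psi> (\<lambda>_. 0) = (\<lambda>_. m - 1) \<or> \<psi> (\<lambda>_. n - 1) = (\<lambda>_. m - 1)"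
    by (rule end_from_end[OF c(2)]) (rule F_group_fixes_ends(2)[OF _ m0])
  ultimately show ?thesis using ne by (elim disjE) (blast, blast, blast, metis)
qed

text \<open>
  Both the lexicographic order of \<open>cantor m\<close> and its converse play the role of \<open>lt\<close>, with \<open>c\<close>
  the letter of the corresponding minimal word.
\<close>

lemma psi_monotone_aux:
  fixes lt :: "nat word \<Rightarrow> nat word \<Rightarrow> bool"
  assumes asym: "\<And>x y. lt x y \<Longrightarrow> \<not> lt y x"
    and total: "\<And>x y. x \<noteq> y \<Longrightarrow> lt x y \<or> lt y x"
    and inv: "\<forall>g\<in>carrier (F_group m). \<forall>x\<in>cantor m. \<forall>y\<in>cantor m. lt x y \<longrightarrow> lt (g x) (g y)"
    and opn: "\<And>x y. lt x y \<Longrightarrow> \<exists>M. \<forall>y'. prefix M y' = prefix M y \<longrightarrow> lt x y'"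
    and low: "\<And>x y M. x \<in> cantor m \<Longrightarrow> lt x y \<Longrightarrow> prefix M y = replicate M c \<Longrightarrow> prefix M x = replicate M c"
    and left: "\<psi> (\<lambda>_. 0) = (\<lambda>_. c)"
    and xy: "x \<in> cantor n" "y \<in> cantor n" "less_fun x y"
  shows "lt (\<psi> x) (\<psi> y)"
proof -
  have z: "(\<lambda>_. 0) \<in> cantor n" using n by (intro const_in_cantor) simp
  \<comment> \<open>First the case with a cylinder between \<open>x\<close> and \<open>y\<close>. If
    the images were in the wrong order, pushing \<open>x\<close> towards \<open>000...\<close> with
    \<open>y\<close> fixed would keep them so, while the image of the pushed point tends to the
    \<open>lt\<close>-minimal point; \<open>\<psi> y\<close> would be squeezed into an arbitrarily
    small neighbourhood of that point.\<close>
  have sep: "lt (\<psi> x) (\<psi> y)"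
    if xy: "x \<in> cantor n" "y \<in> cantor n" and q: "q \<in> words n"
      and s: "\<And>\<omega>. \<omega> \<in> cantor n \<Longrightarrow> less_fun x (q \<frown> \<omega>)" "\<And>\<omega>. \<omega> \<in> cantor n \<Longrightarrow> less_fun (q \<frown> \<omega>) y"
    for x y q
  proof (rule ccontr)
    assume nl: "\<not> lt (\<psi> x) (\<psi> y)"
    have "less_fun x y" using s[OF z] less_fun_trans by blast
    then have "x \<noteq> y" using less_fun_irrefl by blast
    then have "\<psi> x \<noteq> \<psi> y" using psi_inj xy by (auto dest: inj_onD)
    then have yx: "lt (\<psi> y) (\<psi> x)" using total nl by blast
    have "y \<noteq> (\<lambda>_. 0)" using \<open>less_fun x y\<close> not_less_fun_const_0 by blast
    then have "\<psi> y \<noteq> (\<lambda>_. c)" using psi_inj xy z left[symmetric] by (auto dest: inj_onD)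
    then obtain i where i: "\<psi> y i \<noteq> c" by auto
    let ?M = "Suc i"
    obtain K where K: "\<And>x. x \<in> cantor n \<Longrightarrow> prefix K x = prefix K (\<lambda>_. 0) \<Longrightarrow>
        prefix ?M (\<psi> x) = prefix ?M (\<psi> (\<lambda>_. 0))"
      using psi_prefix_continuous[OF z] by blast
    obtain f where f: "f \<in> carrier (F_group n)" "f y = y" "prefix K (f x) = replicate K 0"
      using F_group_push_left[OF n xy q s] by blast
    have fx: "f x \<in> cantor n" using F_group_carrier_D(2)[OF f(1) xy(1)] .
    have "lt (\<psi> y) (\<psi> (f x))"
      using inv[rule_format, OF conj_closed[OF f(1)] psi_in[OF xy(2)] psi_in[OF xy(1)] yx]
        conj_map_psi xy f(2)
      by simp
    moreover have "prefix ?M (\<psi> (f x)) = replicate ?M c"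
      using K[OF fx] f(3) unfolding left prefix_const by blast
    ultimately have "prefix ?M (\<psi> y) = replicate ?M c" using low psi_in[OF xy(2)] by blast
    then have "prefix ?M (\<psi> y) ! i = replicate ?M c ! i" by (rule arg_cong)
    then show False using i by (simp del: subseq_to_Suc replicate_Suc)
  qed
  \<comment> \<open>There may be no cylinder between \<open>x\<close> and \<open>y\<close>. If the
    images were in the wrong order, this would persist when \<open>x\<close> is replaced by a nearby
    point \<open>?x\<close> ending in zeros, by \<open>opn\<close> and continuity. The cylinder of
    \<open>?u @ [1]\<close> separates \<open>?x\<close> from \<open>y\<close>, against
    \<open>sep\<close>.\<close>
  show ?thesis
  proof (rule ccontr)
    assume nl: "\<not> lt (\<psi> x) (\<psi> y)"
    have "x \<noteq> y" using xy(3) less_fun_irrefl by blast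
    then have "\<psi> x \<noteq> \<psi> y" using psi_inj xy by (auto dest: inj_onD)
    then have "lt (\<psi> y) (\<psi> x)" using total nl by blast
    then obtain M where M: "\<And>y'. prefix M y' = prefix M (\<psi> x) \<Longrightarrow> lt (\<psi> y) y'" using opn by blast
    obtain k where k: "\<And>x'. x' \<in> cantor n \<Longrightarrow> prefix k x' = prefix k x \<Longrightarrow>
        prefix M (\<psi> x') = prefix M (\<psi> x)"
      using psi_prefix_continuous[OF xy(1)] by blast
    obtain p a b x1 y1 where d: "x = (p @ [a]) \<frown> x1" "y = (p @ [b]) \<frown> y1" "a < b"
      by (rule less_fun_decomp[OF xy(3)])
    let ?u = "p @ [a] @ prefix k x1"
    have x1: "x1 \<in> cantor n" and pw: "p @ [a] \<in> words n"
      using xy(1) unfolding d(1) conc_in_cantor_iff by auto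
    then have u: "?u \<in> words n" using prefix_in_words[OF x1] by simp
    let ?x = "?u \<frown> (\<lambda>_. 0)"
    have xc: "?x \<in> cantor n" using u z by (subst conc_in_cantor_iff) blast
    have "lt (\<psi> ?x) (\<psi> y)"
    proof (rule sep[OF xc xy(2), of "?u @ [1]"])
      show "?u @ [1] \<in> words n" using u n by simp
      fix \<omega> assume "\<omega> \<in> cantor n"
      have "?x = (?u @ [0]) \<frown> (\<lambda>_. 0)"
        using conc_replicate_const[of 1 "0::nat"] by (metis One_nat_def conc_conc replicate_0 replicate_Suc)
      then show "less_fun ?x ((?u @ [1]) \<frown> \<omega>)"
        using less_funI_conc[of 0 1 ?u "[]" "\<lambda>_. 0" "[]" \<omega>] by simp
      show "less_fun ((?u @ [1]) \<frown> \<omega>) y"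
        unfolding d(2) using less_funI_conc[OF d(3), of p "prefix k x1 @ [1]" \<omega> "[]" y1] by simp
    qed
    moreover have "prefix k ?x = prefix k x"
    proof -
      have l: "k \<le> length ?u" by simp
      have "x = ?u \<frown> suffix k x1" unfolding d(1) by (metis append.assoc conc_conc prefix_suffix)
      then show ?thesis using prefix_conc_fst[OF l] by metis
    qed
    then have "lt (\<psi> y) (\<psi> ?x)" using M k[OF xc] by blast
    ultimately show False using asym by blast
  qed
qed

lemma psi_monotone: "order_preserving n \<psi> \<or> order_reversing n \<psi>"
  using psi_left_end
proof
  assume l: "\<psi> (\<lambda>_. 0) = (\<lambda>_. 0)"
  have "less_fun (\<psi> x) (\<psi> y)" if "x \<in> cantor n" "y \<in> cantor n" "less_fun x y" for x y
  proof (rule psi_monotone_aux[where lt = less_fun and c = 0, OF _ _ _ _ _ l that])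
    show "less_fun x y \<Longrightarrow> \<not> less_fun y x" for x y :: "nat word" by (rule less_fun_asym)
    show "x \<noteq> y \<Longrightarrow> less_fun x y \<or> less_fun y x" for x y :: "nat word" by (rule less_fun_total)
    show "\<forall>g\<in>carrier (F_group m). \<forall>x\<in>cantor m. \<forall>y\<in>cantor m. less_fun x y \<longrightarrow> less_fun (g x) (g y)"
      using F_group_carrier_D(3) by blast
    show "\<exists>M. \<forall>y'. prefix M y' = prefix M y \<longrightarrow> less_fun x y'" if "less_fun x y" for x y :: "nat word"
      by (rule less_fun_open(1)[OF that])
    show "prefix M x = replicate M 0" if "less_fun x y" "prefix M y = replicate M 0"
      for x y :: "nat word" and M
    proof -
      obtain p a b x' y' where d: "x = (p @ [a]) \<frown> x'" "y = (p @ [b]) \<frown> y'" "a < b"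
        by (rule less_fun_decomp[OF \<open>less_fun x y\<close>])
      have "\<not> length p < M"
      proof
        assume "length p < M"
        then have "prefix M y ! length p = b" unfolding d by (simp add: nth_append)
        then show False using that(2) \<open>length p < M\<close> d(3) by simp
      qed
      then have "prefix M x = prefix M y" unfolding d by simp
      then show ?thesis using that(2) by simp
    qed
  qed
  then show ?thesis by (simp add: order_preserving_def monotone_on_def)
next
  assume l: "\<psi> (\<lambda>_. 0) = (\<lambda>_. m - 1)"
  have "less_fun (\<psi> y) (\<psi> x)" if "x \<in> cantor n" "y \<in> cantor n" "less_fun x y" for x y
  proof (rule psi_monotone_aux[where lt = "\<lambda>x y. less_fun y x" and c = "m - 1", OF _ _ _ _ _ l that])
    show "less_fun y x \<Longrightarrow> \<not> less_fun x y" for x y :: "nat word" by (rule less_fun_asym)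
    show "x \<noteq> y \<Longrightarrow> less_fun y x \<or> less_fun x y" for x y :: "nat word" using less_fun_total by blast
    show "\<forall>g\<in>carrier (F_group m). \<forall>x\<in>cantor m. \<forall>y\<in>cantor m. less_fun y x \<longrightarrow> less_fun (g y) (g x)"
      using F_group_carrier_D(3) by blast
    show "\<exists>M. \<forall>y'. prefix M y' = prefix M y \<longrightarrow> less_fun y' x" if "less_fun y x" for x y :: "nat word"
      by (rule less_fun_open(2)[OF that])
    show "prefix M x = replicate M (m - 1)"
      if xc: "x \<in> cantor m" and "less_fun y x" "prefix M y = replicate M (m - 1)"
      for x y :: "nat word" and M
    proof -
      obtain p a b y' x' where d: "y = (p @ [a]) \<frown> y'" "x = (p @ [b]) \<frown> x'" "a < b"
        by (rule less_fun_decomp[OF \<open>less_fun y x\<close>])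
      have "\<not> length p < M"
      proof
        assume "length p < M"
        then have "prefix M y ! length p = a" unfolding d by (simp add: nth_append)
        moreover have "b < m" using xc unfolding d(2) conc_in_cantor_iff by simp
        ultimately show False using that(3) \<open>length p < M\<close> d(3) by simp
      qed
      then have "prefix M x = prefix M y" unfolding d by simp
      then show ?thesis using that(3) by simp
    qed
  qed
  then show ?thesis by (simp add: order_reversing_def monotone_on_def)
qed

end

section \<open>Synchronization\<close>

context cantor_homeomorphism
begin

abbreviation act :: "nat list \<Rightarrow> nat word \<Rightarrow> nat word" where
  "act \<equiv> local_action n \<psi>"

abbreviation mt :: "(nat word \<Rightarrow> nat word) transducer" where
  "mt \<equiv> minimal_transducer n \<psi>"

lemma letters: "0 < n" "n - 1 < n" "0 \<noteq> n - 1"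
  using n by auto

lemma mt_states: "states mt = act ` words n"
  by (simp add: minimal_transducer_def)

lemma mt_start: "start mt = act []"
  using local_action_Nil[OF n m \<psi>] by (simp add: minimal_transducer_def)

lemma mt_step_start: "u \<in> words n \<Longrightarrow> step_word mt (start mt) u = act u"
  unfolding mt_start using mt_step_word[OF n m \<psi>, of "[]" u] by simp

lemma mt_step: "u \<in> words n \<Longrightarrow> d < n \<Longrightarrow> step mt (act u) d = act (u @ [d])"
  using mt_step_word[OF n m \<psi>, of u "[d]"] by simp

text \<open>The word \<open>d^r\<close> leads to the state \<open>act (replicate r d)\<close>, so a
  loop labelled \<open>d\<close> on that state is a repetition in this sequence of local
  actions.\<close>

lemma fixed_state_iff:
  assumes d: "d < n"
  shows "(\<exists>s\<in>states mt. step mt s d = s \<and> (\<exists>r. step_word mt (start mt) (replicate r d) = s))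
    \<longleftrightarrow> (\<exists>r. act (replicate (Suc r) d) = act (replicate r d))"
proof -
  have w: "replicate r d \<in> words n" for r using d by (rule words_replicate)
  have st: "step mt (act (replicate r d)) d = act (replicate (Suc r) d)" for r
    using mt_step[OF w d] by (simp add: replicate_append_same)
  show ?thesis
  proof
    assume "\<exists>s\<in>states mt. step mt s d = s \<and> (\<exists>r. step_word mt (start mt) (replicate r d) = s)"
    then obtain r where "step mt (act (replicate r d)) d = act (replicate r d)"
      using mt_step_start[OF w] by metis
    then show "\<exists>r. act (replicate (Suc r) d) = act (replicate r d)" unfolding st by blast
  next
    assume "\<exists>r. act (replicate (Suc r) d) = act (replicate r d)"
    then obtain r where "act (replicate (Suc r) d) = act (replicate r d)" by blast
    then have "step mt (act (replicate r d)) d = act (replicate r d)" unfolding st .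
    moreover have "act (replicate r d) \<in> states mt" unfolding mt_states using w by (rule imageI)
    ultimately show "\<exists>s\<in>states mt. step mt s d = s \<and> (\<exists>r. step_word mt (start mt) (replicate r d) = s)"
      using mt_step_start[OF w] by blast
  qed
qed

text \<open>Condition (ii) for a given \<open>k\<close>, with the states of \<open>mt\<close>
  written as local actions.\<close>

definition synchronized :: "nat \<Rightarrow> bool" where
  "synchronized k \<longleftrightarrow> (\<forall>u v w. inner n u \<longrightarrow> inner n v \<longrightarrow> sigma n u = sigma n v \<longrightarrow>
     w \<in> words n \<longrightarrow> length w = k \<longrightarrow> act (u @ w) = act (v @ w))"

lemma semi_synchronizing_iff:
  "semi_synchronizing n mt \<longleftrightarrow>
    (\<exists>r. act (replicate (Suc r) 0) = act (replicate r 0))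
    \<and> (\<exists>r. act (replicate (Suc r) (n - 1)) = act (replicate r (n - 1)))
    \<and> (\<exists>k. synchronized k)"
proof -
  have "(\<forall>u v w. inner n u \<and> inner n v \<and> sigma n u = sigma n v \<and> w \<in> words n \<and> length w = k
      \<longrightarrow> step_word mt (start mt) (u @ w) = step_word mt (start mt) (v @ w)) \<longleftrightarrow> synchronized k" for k
    unfolding synchronized_def
    by (intro iff_allI) (auto simp: mt_step_start inner_def simp del: step_word_Cons)
  then show ?thesis
    unfolding semi_synchronizing_def fixed_state_iff[OF letters(1)] fixed_state_iff[OF letters(2)] by simp
qed

lemma act_replicate_stable:
  assumes e: "act (replicate (Suc r) d) = act (replicate r d)" and d: "d < n" and j: "r \<le> j"
  shows "act (replicate j d) = act (replicate r d)"
  using j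
proof (induction j rule: dec_induct)
  case (step j)
  have w: "replicate k d \<in> words n" for k using d by (rule words_replicate)
  have "act (replicate j d @ [d]) = act (replicate r d @ [d])"
    using local_action_eq_append[OF step.IH w w w[of 1]] by simp
  then show ?case using e by (simp add: replicate_append_same)
qed simp

lemma act_append_mono:
  assumes h: "\<And>w. w \<in> words n \<Longrightarrow> length w = k \<Longrightarrow> act (u @ w) = act (v @ w)"
    and uv: "u \<in> words n" "v \<in> words n" and w: "w \<in> words n" "k \<le> length w"
  shows "act (u @ w) = act (v @ w)"
proof -
  have t: "take k w \<in> words n" "drop k w \<in> words n"
    using w(1) by (metis append_take_drop_id words_append_iff)+
  have "act (u @ take k w) = act (v @ take k w)" using h[OF t(1)] w(2) by simp
  from local_action_eq_append[OF this _ _ t(2)] uv t(1) show ?thesis by simp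
qed

text \<open>Every state is reached by a short word. From a long word the last \<open>k\<close>
  letters are cut off; the rest is either inner and may be exchanged for a canonical word of length
  2, or a power \<open>d^j\<close> that the loop at \<open>d\<close> shortens.\<close>

lemma finite_states_if_semi_synchronizing:
  assumes ss: "semi_synchronizing n mt"
  shows "finite (states mt)"
proof -
  obtain r0 r1 k where r0: "act (replicate (Suc r0) 0) = act (replicate r0 0)"
    and r1: "act (replicate (Suc r1) (n - 1)) = act (replicate r1 (n - 1))" and k: "synchronized k"
    using ss unfolding semi_synchronizing_iff by blast
  \<comment> \<open>The summands pay for the powers \<open>d^r\<close> with
    \<open>r \<le> r0 + r1\<close>, for the canonical word of length 2, and for the \<open>k\<close>
    letters that follow.\<close>
  define N where "N = r0 + r1 + 2 + k"
  have "\<exists>u'\<in>words n. length u' \<le> N \<and> act u = act u'" if u: "u \<in> words n" for u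
  proof (cases "length u \<le> N")
    case False
    define u1 w where "u1 = take (length u - k) u" and "w = drop (length u - k) u"
    have uw: "u = u1 @ w" "length w = k" "r0 + r1 + 2 < length u1"
      using False by (auto simp: u1_def w_def N_def)
    then have wd: "u1 \<in> words n" "w \<in> words n" using u by auto
    show ?thesis
    proof (cases "inner n u1")
      case True
      let ?c = "replicate 1 0 @ [residue_letter n (sum_list u1)]"
      note c = inner_zeros_residue_letter[OF n zero_less_one, of "sum_list u1"]
      have "sigma n u1 = sigma n ?c" unfolding c(2) by (simp add: sigma_def)
      then have "act u = act (?c @ w)"
        unfolding uw(1)
        by (intro k[unfolded synchronized_def, rule_format] True c(1) wd(2) uw(2))
      moreover have "?c @ w \<in> words n" using c(1) wd(2) unfolding inner_def words_append_iff by blast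
      moreover have "length (?c @ w) \<le> N" using uw(2) by (simp add: N_def)
      ultimately show ?thesis by blast
    next
      case False
      then obtain j d where d: "u1 = replicate j d" "d = 0 \<or> d = n - 1"
        using wd(1) uw(3) unfolding inner_def by auto
      then have dn: "d < n" using letters by auto
      obtain r where r: "act (replicate (Suc r) d) = act (replicate r d)" "r \<le> r0 + r1"
        using r0 r1 d(2) by (metis le_add1 le_add2)
      have "r \<le> j" using d(1) uw(3) r(2) by simp
      then have "act u1 = act (replicate r d)"
        unfolding d(1) by (rule act_replicate_stable[OF r(1) dn])
      then have "act u = act (replicate r d @ w)"
        unfolding uw(1) by (rule local_action_eq_append) (use wd dn words_replicate in auto)
      moreover have "replicate r d @ w \<in> words n" using wd(2) words_replicate[OF dn] by simp
      moreover have "length (replicate r d @ w) \<le> N" using uw(2) r(2) by (simp add: N_def)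
      ultimately show ?thesis by blast
    qed
  qed (use u in blast)
  then have "states mt \<subseteq> act ` {u \<in> words n. length u \<le> N}" unfolding mt_states by blast
  then show ?thesis using finite_words_length_le finite_imageI finite_subset by metis
qed

end

section \<open>Semi-synchronization of a homeomorphism that conjugates \<open>F_n\<close> into
  \<open>F_m\<close>\<close>

context conjugator
begin

lemma synchronizes:
  assumes "f \<in> carrier (F_group n)" "u \<in> words n" "v \<in> words n"
    and "\<forall>\<omega>\<in>cantor n. f (u \<frown> \<omega>) = v \<frown> \<omega>"
  shows "\<exists>k. \<forall>w\<in>words n. length w = k \<longrightarrow> act (u @ w) = act (v @ w)"
  using synchronizes_if_conj_in_F_group[OF conj_closed[OF assms(1)] assms(2,3)] assms(4) by blast

lemma replicate_eventually_stable:
  assumes d: "d = 0 \<or> d = n - 1"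
  shows "\<exists>r. act (replicate (Suc r) d) = act (replicate r d)"
proof -
  have dn: "d < n" using d letters by auto
  have w: "replicate k d \<in> words n" for k using dn by (rule words_replicate)
  have "\<exists>f\<in>carrier (F_group n). \<forall>\<omega>\<in>cantor n. f (replicate 1 d \<frown> \<omega>) = replicate 2 d \<frown> \<omega>"
    by (rule F_group_prefix_map_exists[OF n w w]) (use d n in \<open>auto simp: sum_list_replicate\<close>)
  then obtain f where "f \<in> carrier (F_group n)" "\<forall>\<omega>\<in>cantor n. f (replicate 1 d \<frown> \<omega>) = replicate 2 d \<frown> \<omega>"
    by blast
  from synchronizes[OF this(1) w w this(2)] obtain k where
    "\<forall>w\<in>words n. length w = k \<longrightarrow> act (replicate 1 d @ w) = act (replicate 2 d @ w)" by blast
  \<comment> \<open>The synchronization of \<open>d\<close> with \<open>dd\<close>, applied to the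
    extension \<open>d^k\<close>, is the wanted repetition.\<close>
  then have "act (replicate 1 d @ replicate k d) = act (replicate 2 d @ replicate k d)"
    using w by simp
  then have "act (replicate (Suc k) d) = act (replicate (Suc (Suc k)) d)"
    by (simp add: numeral_2_eq_2)
  then show ?thesis by metis
qed

lemma synchronized_short:
  "\<exists>K. \<forall>u v w. inner n u \<longrightarrow> inner n v \<longrightarrow> sigma n u = sigma n v \<longrightarrow> length u \<le> B \<longrightarrow> length v \<le> B \<longrightarrow>
     w \<in> words n \<longrightarrow> length w = K \<longrightarrow> act (u @ w) = act (v @ w)"
proof -
  define S where "S = {p \<in> {u \<in> words n. length u \<le> B} \<times> {u \<in> words n. length u \<le> B}.
    inner n (fst p) \<and> inner n (snd p) \<and> sigma n (fst p) = sigma n (snd p)}"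
  have fin: "finite S" unfolding S_def using finite_words_length_le by simp
  have "\<exists>k. \<forall>w\<in>words n. length w = k \<longrightarrow> act (fst p @ w) = act (snd p @ w)" if "p \<in> S" for p
  proof -
    have p: "inner n (fst p)" "inner n (snd p)" "sigma n (fst p) = sigma n (snd p)"
      "fst p \<in> words n" "snd p \<in> words n" using that by (auto simp: S_def)
    then obtain f where "f \<in> carrier (F_group n)" "\<forall>\<omega>\<in>cantor n. f (fst p \<frown> \<omega>) = snd p \<frown> \<omega>"
      using F_group_inner_map_exists[OF n] by blast
    then show ?thesis using synchronizes p(4,5) by blast
  qed
  then obtain k where k: "\<And>p w. p \<in> S \<Longrightarrow> w \<in> words n \<Longrightarrow> length w = k p \<Longrightarrow> act (fst p @ w) = act (snd p @ w)"
    by metis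
  define K where "K = Max (insert 0 (k ` S))"
  have "act (u @ w) = act (v @ w)"
    if "inner n u" "inner n v" "sigma n u = sigma n v" "length u \<le> B" "length v \<le> B"
      "w \<in> words n" "length w = K" for u v w
  proof -
    have p: "(u, v) \<in> S" "u \<in> words n" "v \<in> words n" using that by (auto simp: S_def inner_def)
    have kl: "k (u, v) \<le> length w" unfolding that(7) K_def using p(1) fin by (intro Max_ge) auto
    show ?thesis
      by (rule act_append_mono[OF _ p(2,3) that(6) kl]) (use k[OF p(1)] in simp)
  qed
  then show ?thesis by blast
qed

text \<open>Every inner word acts, after any \<open>K\<close> letters, like the canonical word
  \<open>c s\<close> of its class. This goes by induction on the length, and \<open>K\<close>,
  obtained from the words of length at most \<open>B\<close>, stays the same throughout.\<close>

lemma synchronized_exists: "\<exists>k. synchronized k"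
proof -
  obtain r0 where r0: "act (replicate (Suc r0) 0) = act (replicate r0 0)"
    using replicate_eventually_stable by blast
  obtain r1 where r1: "act (replicate (Suc r1) (n - 1)) = act (replicate r1 (n - 1))"
    using replicate_eventually_stable by blast
  \<comment> \<open>\<open>B\<close> covers the words \<open>c s @ [x]\<close> of length 3, and a
    longer word whose initial part is a power of \<open>0\<close> or \<open>n - 1\<close> has enough
    equal letters to delete one of them by means of the loop.\<close>
  define B where "B = r0 + r1 + 4"
  obtain K where K: "\<And>u v w. inner n u \<Longrightarrow> inner n v \<Longrightarrow> sigma n u = sigma n v \<Longrightarrow> length u \<le> B \<Longrightarrow>
      length v \<le> B \<Longrightarrow> w \<in> words n \<Longrightarrow> length w = K \<Longrightarrow> act (u @ w) = act (v @ w)"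
    using synchronized_short[of B] by blast
  define c where "c s = replicate 1 0 @ [residue_letter n s]" for s
  have c: "inner n (c s)" "sigma n (c s) = s mod (n - 1)" "length (c s) = 2" for s
    using inner_zeros_residue_letter[OF n zero_less_one] by (auto simp: c_def)
  have canon: "act (u @ w) = act (c (sum_list u) @ w)"
    if "inner n u" "w \<in> words n" "length w = K" for u w
    using that
  proof (induction "length u" arbitrary: u w rule: less_induct)
    case less
    show ?case
    proof (cases "length u \<le> B")
      case True
      then show ?thesis
        by (intro K) (use less.prems c in \<open>auto simp: B_def sigma_def\<close>)
    next
      case False
      then obtain u1 x where u: "u = u1 @ [x]" by (metis B_def le0 list.size(3) rev_exhaust)
      have uw: "u1 \<in> words n" "[x] \<in> words n" using less.prems(1) by (auto simp: inner_def u)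
      have l: "B \<le> length u1" using False u by simp
      show ?thesis
      proof (cases "inner n u1")
        case True
        have cx: "inner n (c (sum_list u1) @ [x])" using inner_append[OF c(1) uw(2)] .
        have "sigma n u1 = sigma n (c (sum_list u1))" unfolding c(2) by (simp add: sigma_def)
        then have s: "sigma n u = sigma n (c (sum_list u1) @ [x])"
          unfolding u by (rule sigma_append_cong)
        \<comment> \<open>Here \<open>x\<close> counts as part of the extension: the induction
          hypothesis for \<open>u1\<close> needs \<open>K\<close> further letters, and
          \<open>[x] @ w\<close> has one more. This leaves two short words of the same class, which
          \<open>K\<close> already covers.\<close>
        have "act (u1 @ ([x] @ w)) = act (c (sum_list u1) @ ([x] @ w))"
        proof (rule act_append_mono[of K])
          show "act (u1 @ w) = act (c (sum_list u1) @ w)" if "w \<in> words n" "length w = K" for w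
            using less.hyps[of u1] True that u by simp
          show "c (sum_list u1) \<in> words n" using c(1) by (simp add: inner_def)
        qed (use uw less.prems in auto)
        also have "\<dots> = act ((c (sum_list u1) @ [x]) @ w)" by simp
        also have "\<dots> = act (c (sum_list u) @ w)"
          by (rule K) (use cx c less.prems s in \<open>auto simp: B_def sigma_def[of n u]\<close>)
        finally show ?thesis unfolding u by simp
      next
        case False
        then obtain j d where d: "u1 = replicate j d" "d = 0 \<or> d = n - 1"
          using uw(1) l unfolding inner_def B_def by auto
        then have dn: "d < n" using letters by auto
        obtain r where r: "act (replicate (Suc r) d) = act (replicate r d)" "r \<le> r0 + r1"
          using r0 r1 d(2) by (metis le_add1 le_add2)
        have j: "r0 + r1 + 4 \<le> j" using l d(1) by (simp add: B_def)
        \<comment> \<open>One of the \<open>j\<close> letters \<open>d\<close> is dropped. The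
          action is the same by the loop, the digit sum changes by 0 or \<open>n - 1\<close>, and
          since \<open>i\<close> is positive the set of letters is the same, so the shorter word is
          still inner.\<close>
        then obtain i where i: "j = Suc i" "0 < i" "r \<le> i" using r(2) by (cases j) auto
        let ?v = "replicate i d @ [x]"
        have vw: "replicate i d \<in> words n" using dn by (rule words_replicate)
        have "act (replicate j d) = act (replicate r d)"
          by (rule act_replicate_stable[OF r(1) dn]) (use i in simp)
        moreover have "act (replicate i d) = act (replicate r d)"
          by (rule act_replicate_stable[OF r(1) dn i(3)])
        ultimately have "act u1 = act (replicate i d)" unfolding d(1) by metis
        then have "act (u1 @ [x] @ w) = act (replicate i d @ [x] @ w)"
          by (rule local_action_eq_append) (use uw less.prems vw in auto)
        moreover have "inner n ?v"
        proof -
          have "set ?v = set u" using i d by (cases i) (auto simp: u)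
          moreover have "u \<noteq> replicate k e" if "e = 0 \<or> e = n - 1" for k e
            using less.prems(1) that unfolding inner_def by blast
          ultimately have "?v \<noteq> replicate k e" if "e = 0 \<or> e = n - 1" for k e
            using that by (metis replicate_length_same in_set_replicate)
          then show ?thesis using vw uw(2) unfolding inner_def by auto
        qed
        moreover have "length ?v < length u" using u i d by simp
        ultimately have "act (u @ w) = act (c (sum_list ?v) @ w)"
          using less.hyps[of ?v w] less.prems u by simp
        moreover have "sum_list u mod (n - 1) = sum_list ?v mod (n - 1)"
          using d(2) i by (auto simp: u d(1) sum_list_replicate mult_Suc add.assoc)
        then have "c (sum_list u) = c (sum_list ?v)" by (simp add: c_def residue_letter_def)
        ultimately show ?thesis by simp
      qed
    qed
  qed
  have "act (u @ w) = act (v @ w)"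
    if h: "inner n u" "inner n v" "sigma n u = sigma n v" "w \<in> words n" "length w = K" for u v w
  proof -
    have "c (sum_list u) = c (sum_list v)" using h(3) by (simp add: c_def residue_letter_def sigma_def)
    then show ?thesis using canon[OF h(1,4,5)] canon[OF h(2,4,5)] by simp
  qed
  then show ?thesis unfolding synchronized_def by blast
qed

lemma semi_synchronizing: "semi_synchronizing n mt"
  unfolding semi_synchronizing_iff
  using replicate_eventually_stable synchronized_exists by blast

end

section \<open>Rationality\<close>

text \<open>Renaming the states along an injection into \<open>nat\<close> changes no output word;
  this meets the state type fixed in \<open>rational\<close>.\<close>

lemma rational_if_finite_transducer:
  fixes T :: "'s transducer"
  assumes T: "is_transducer n m T" and fin: "finite (states T)" and rep: "represents n T \<psi>"
  shows "rational n m \<psi>"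
proof -
  obtain h :: "'s \<Rightarrow> nat" where h: "inj_on h (states T)"
    using finite_imp_inj_to_nat_seg[OF fin] by blast
  define g where "g = inv_into (states T) h"
  have gh [simp]: "g (h s) = s" if "s \<in> states T" for s using h that by (simp add: g_def)
  define T' :: "nat transducer" where "T' = \<lparr>states = h ` states T, step = (\<lambda>s i. h (step T (g s) i)),
    emit = (\<lambda>s i. emit T (g s) i), start = h (start T)\<rparr>"
  have closed: "step T s i \<in> states T" if "s \<in> states T" "i < n" for s i
    using T that by (simp add: is_transducer_def)
  have em: "emit_word T' (h s) u = emit_word T s u" if "u \<in> words n" "s \<in> states T" for u s
    using that by (induction u arbitrary: s) (auto simp: T'_def closed)
  have pre: "prefix k \<omega> \<in> words n" if "\<omega> \<in> cantor n" for k \<omega>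
    using that by (rule prefix_in_words)
  have "is_transducer n m T'"
    unfolding is_transducer_def
  proof (intro conjI ballI allI impI)
    show "start T' \<in> states T'" using T by (simp add: T'_def is_transducer_def)
    fix s assume "s \<in> states T'"
    then obtain s' where s': "s' \<in> states T" "s = h s'" by (auto simp: T'_def)
    show "step T' s i \<in> states T'" if "i < n" for i
      using closed[OF s'(1) that] s' by (simp add: T'_def)
    show "emit T' s i \<in> words m" if "i < n" for i
      using T that s' by (simp add: T'_def is_transducer_def)
    show "\<exists>k. N \<le> length (emit_word T' s (prefix k \<omega>))" if "\<omega> \<in> cantor n" for \<omega> N
      unfolding s'(2) em[OF pre[OF that] s'(1)] using T s'(1) that unfolding is_transducer_def by blast
  qed
  moreover have "represents n T' \<psi>"
    unfolding represents_def
  proof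
    fix \<omega> assume o: "\<omega> \<in> cantor n"
    have st: "start T \<in> states T" using T by (simp add: is_transducer_def)
    have "start T' = h (start T)" by (simp add: T'_def)
    then have "state_map T' (start T') \<omega> = state_map T (start T) \<omega>"
      unfolding state_map_def by (simp only: em[OF pre[OF o] st])
    then show "state_map T' (start T') \<omega> = \<psi> \<omega>" using rep o by (simp add: represents_def)
  qed
  moreover have "finite (states T')" using fin by (simp add: T'_def)
  ultimately show ?thesis unfolding rational_def by blast
qed

context cantor_homeomorphism
begin

lemma rational_if_semi_synchronizing:
  assumes "semi_synchronizing n mt"
  shows "rational n m \<psi>"
proof (rule rational_if_finite_transducer)
  show "finite (states mt)" using assms by (rule finite_states_if_semi_synchronizing)
  show "is_transducer n m mt" "represents n mt \<psi>"
    using minimal_transducer_is_minimal[OF n m \<psi>] by (simp_all add: is_minimal_transducer_def)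
qed


section \<open>Semi-synchronizing homeomorphisms\<close>

lemma inner_replicate_append:
  assumes d: "d = 0 \<or> d = n - 1" and a: "0 < a" and w: "w \<in> words n" "w \<noteq> replicate (length w) d"
  shows "inner n (replicate a d @ w)"
proof -
  obtain e where e: "e \<in> set w" "e \<noteq> d" using w(2) by (metis replicate_eqI)
  have mem: "d \<in> set (replicate a d @ w)" "e \<in> set (replicate a d @ w)" using a e by auto
  have "replicate a d @ w \<noteq> replicate k c" for k c
    using mem e(2) by (metis in_set_replicate)
  moreover have "replicate a d @ w \<in> words n"
    using w(1) d letters words_replicate by auto
  ultimately show ?thesis using a by (simp add: inner_def)
qed

text \<open>The outer leaves are a power of 0 and a power of \<open>n - 1\<close>. Powers of the
  same letter are comparable, so no other leaf is of either form.\<close>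

lemma inner_middle_leaf:
  assumes us: "ordered_code n us" and i: "0 < i" "i < length us - 1"
  shows "inner n (us ! i)"
proof -
  have n0: "0 < n" using n by simp
  have nrep: "\<not> left_of (replicate a d) (replicate b d)" for a b d
    using left_of_incomparable[of "replicate a d" "replicate b d" "\<lambda>_. d" "\<lambda>_. d"] by auto
  obtain a where a: "us ! 0 = replicate a 0" using ordered_code_first[OF n0 us] by blast
  obtain b where b: "us ! (length us - 1) = replicate b (n - 1)" using ordered_code_last[OF n0 us] by blast
  have len: "0 < length us" "i < length us" "length us - 1 < length us" using i by linarith+
  have l: "left_of (us ! 0) (us ! i)" "left_of (us ! i) (us ! (length us - 1))"
    using ordered_code_left_of_iff[OF us len(1,2)] ordered_code_left_of_iff[OF us len(2,3)] i
    by blast+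
  have "us ! i \<noteq> replicate k 0" "us ! i \<noteq> replicate k (n - 1)" for k
    using l nrep unfolding a b by metis+
  moreover have "us ! i \<noteq> []" using calculation(1)[of 0] by simp
  moreover have "us ! i \<in> words n" using ordered_code_words[OF us] i by simp
  ultimately show ?thesis by (simp add: inner_def)
qed

text \<open>An end leaf \<open>d^a\<close> is not inner, so the extension has two stages. If
  \<open>w1\<close> is the power \<open>d^r\<close>, the loop at \<open>d\<close> identifies both
  states. Otherwise \<open>w1\<close> contains another letter, which makes both words inner, and the
  \<open>k\<close> letters of \<open>w2\<close> synchronize them.\<close>

lemma sync_end_leaf:
  assumes d: "d = 0 \<or> d = n - 1" and ab: "0 < a" "0 < b"
    and st: "\<And>j. r \<le> j \<Longrightarrow> act (replicate j d) = act (replicate r d)"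
    and k: "synchronized k" and w: "w1 \<in> words n" "length w1 = r" "w2 \<in> words n" "length w2 = k"
    and s: "sigma n (replicate a d) = sigma n (replicate b d)"
  shows "act ((replicate a d @ w1) @ w2) = act ((replicate b d @ w1) @ w2)"
proof (cases "w1 = replicate (length w1) d")
  case True
  have dn: "d < n" using d letters by auto
  have e: "replicate c d @ w1 = replicate (c + r) d" for c
    using True w(2) by (metis replicate_add)
  have "act (replicate (a + r) d) = act (replicate (b + r) d)"
    using st[of "a + r"] st[of "b + r"] by simp
  then show ?thesis
    unfolding e by (rule local_action_eq_append) (use dn w words_replicate in auto)
next
  case False
  show ?thesis
    by (rule k[unfolded synchronized_def, rule_format])
      (use inner_replicate_append[OF d _ w(1) False] ab sigma_append_cong[OF s] w in auto)
qed

text \<open>Leaves with the same index have congruent digit sums by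
  \<open>ordered_code_sum_mod\<close>. Middle leaves are inner; the first and last leaf are powers
  of 0 and of \<open>n - 1\<close>, handled by \<open>sync_end_leaf\<close>.\<close>

lemma synchronized_leaves:
  assumes us: "ordered_code n us" and vs: "ordered_code n vs" and len: "length us = length vs"
    and i: "i < length us"
    and st: "\<And>j d. d = 0 \<or> d = n - 1 \<Longrightarrow> r \<le> j \<Longrightarrow> act (replicate j d) = act (replicate r d)"
    and k: "synchronized k" and w: "w1 \<in> words n" "length w1 = r" "w2 \<in> words n" "length w2 = k"
  shows "act ((us ! i @ w1) @ w2) = act ((vs ! i @ w1) @ w2)"
proof -
  have n0: "0 < n" using n by simp
  have iv: "i < length vs" using i len by simp
  have s: "sigma n (us ! i) = sigma n (vs ! i)"
    using ordered_code_sum_mod[OF n0 us i] ordered_code_sum_mod[OF n0 vs iv] by (simp add: sigma_def)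
  obtain a where a: "us ! 0 = replicate a 0" using ordered_code_first[OF n0 us] by blast
  obtain b where b: "us ! (length us - 1) = replicate b (n - 1)" using ordered_code_last[OF n0 us] by blast
  obtain a' where a': "vs ! 0 = replicate a' 0" using ordered_code_first[OF n0 vs] by blast
  obtain b' where b': "vs ! (length vs - 1) = replicate b' (n - 1)" using ordered_code_last[OF n0 vs] by blast
  \<comment> \<open>The empty word covers everything, so it is a leaf only of the one-leaf code;
    this makes the exponents at the ends positive.\<close>
  have nonempty: "xs ! j \<noteq> []" if xs: "ordered_code n xs" and j: "j < length xs" "1 < length xs" for xs j
  proof
    assume e: "xs ! j = []"
    define l :: nat where "l = (if j = 0 then 1 else 0)"
    have l: "l < length xs" "l \<noteq> j" using j by (auto simp: l_def)
    show False
      using ordered_code_index_unique[OF xs l(1) j(1), of "\<lambda>_. 0" "xs ! l \<frown> (\<lambda>_. 0)"] l(2) e by simp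
  qed
  consider "length us = 1" | "1 < length us" "i = 0" | "1 < length us" "i = length us - 1"
    | "0 < i" "i < length us - 1" using i by linarith
  then show ?thesis
  proof cases
    case 1
    \<comment> \<open>A single leaf is first and last at once, hence a power of 0 and of
      \<open>n - 1\<close>, which are different letters.\<close>
    have nil: "u = []" if "u = replicate c 0" "u = replicate c' (n - 1)" for u :: "nat list" and c c'
      using that letters(3) by (cases c; cases c') auto
    have "i = 0" using i 1 by simp
    then have "us ! i = []" "vs ! i = []" using nil[OF a] nil[OF a'] b b' len 1 by simp_all
    then show ?thesis by simp
  next
    case 2
    have "us ! i \<noteq> []" "vs ! i \<noteq> []" using nonempty[OF us i] nonempty[OF vs iv] 2 len by simp_all
    moreover have e: "us ! i = replicate a 0" "vs ! i = replicate a' 0" using a a' 2(2) by simp_all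
    ultimately have "0 < a" "0 < a'" by simp_all
    show ?thesis
      unfolding e
    proof (rule sync_end_leaf[OF _ \<open>0 < a\<close> \<open>0 < a'\<close> _ k w s[unfolded e]])
      show "act (replicate j 0) = act (replicate r 0)" if "r \<le> j" for j using st that by blast
    qed simp
  next
    case 3
    have "us ! i \<noteq> []" "vs ! i \<noteq> []" using nonempty[OF us i] nonempty[OF vs iv] 3 len by simp_all
    moreover have e: "us ! i = replicate b (n - 1)" "vs ! i = replicate b' (n - 1)"
      using b b' 3(2) len by simp_all
    ultimately have "0 < b" "0 < b'" by simp_all
    show ?thesis
      unfolding e
    proof (rule sync_end_leaf[OF _ \<open>0 < b\<close> \<open>0 < b'\<close> _ k w s[unfolded e]])
      show "act (replicate j (n - 1)) = act (replicate r (n - 1))" if "r \<le> j" for j using st that by blast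
    qed simp
  next
    case 4
    then have "inner n (us ! i)" "inner n (vs ! i)"
      using inner_middle_leaf[OF us] inner_middle_leaf[OF vs] len by auto
    then have "inner n (us ! i @ w1)" "inner n (vs ! i @ w1)" using inner_append w(1) by blast+
    moreover have "sigma n (us ! i @ w1) = sigma n (vs ! i @ w1)" using s by (rule sigma_append_cong)
    ultimately show ?thesis using k w unfolding synchronized_def by blast
  qed
qed

text \<open>Around a point \<open>x\<close> the inverse of \<open>\<psi>\<close> gives a leaf of
  \<open>f\<close>, extended to a word \<open>u\<close> whose partner \<open>v\<close> has the same
  local action. Near \<open>x\<close> the conjugate then replaces \<open>theta n \<psi> u\<close> by
  \<open>theta n \<psi> v\<close>, and \<open>fan\<close> turns this pointwise statement into a
  uniform depth.\<close>

lemma conj_map_local: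
  assumes ss: "semi_synchronizing n mt" and f: "f \<in> carrier (F_group n)"
  shows "locally_prefix_replacing m (conj_map n m \<psi> f)"
proof -
  let ?g = "conj_map n m \<psi> f" and ?i = "inv_into (cantor n) \<psi>"
  have n0: "0 < n" using n by simp
  have hi: "homeomorphic_map (cantor_space m) (cantor_space n) ?i"
    using \<psi> by (rule homeomorphic_map_inv_into)
  obtain r0 r1 k where r0: "act (replicate (Suc r0) 0) = act (replicate r0 0)"
    and r1: "act (replicate (Suc r1) (n - 1)) = act (replicate r1 (n - 1))" and k: "synchronized k"
    using ss unfolding semi_synchronizing_iff by blast
  define r where "r = max r0 r1"
  have st: "act (replicate j d) = act (replicate r d)" if d: "d = 0 \<or> d = n - 1" and j: "r \<le> j" for j d
  proof -
    have dn: "d < n" using d letters by auto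
    obtain q where q: "act (replicate (Suc q) d) = act (replicate q d)" "q \<le> r"
      using r0 r1 d by (metis max.cobounded1 max.cobounded2 r_def)
    have "act (replicate j d) = act (replicate q d)" "act (replicate r d) = act (replicate q d)"
      using act_replicate_stable[OF q(1) dn] q(2) j by (meson le_trans)+
    then show ?thesis by metis
  qed
  obtain us vs where us: "ordered_code n us" and vs: "ordered_code n vs" and len: "length us = length vs"
    and fe: "\<And>i \<omega>. i < length us \<Longrightarrow> \<omega> \<in> cantor n \<Longrightarrow> f (us ! i \<frown> \<omega>) = vs ! i \<frown> \<omega>"
    using f unfolding F_group_carrier_iff prefix_replacement_iff[OF n0] by blast
  have "\<exists>N. \<forall>w\<in>words m. length w = N \<longrightarrow> (\<exists>v. \<forall>\<omega>\<in>cantor m. ?g (w \<frown> \<omega>) = v \<frown> \<omega>)"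
  proof (rule fan)
    fix w v assume "\<exists>v. \<forall>\<omega>\<in>cantor m. ?g (w \<frown> \<omega>) = v \<frown> \<omega>" and v: "v \<in> words m"
    then obtain v' where v': "\<And>\<omega>. \<omega> \<in> cantor m \<Longrightarrow> ?g (w \<frown> \<omega>) = v' \<frown> \<omega>" by blast
    have "?g ((w @ v) \<frown> \<omega>) = (v' @ v) \<frown> \<omega>" if "\<omega> \<in> cantor m" for \<omega>
      using v'[of "v \<frown> \<omega>"] v that by (simp add: conc_in_cantor_iff)
    then show "\<exists>v'. \<forall>\<omega>\<in>cantor m. ?g ((w @ v) \<frown> \<omega>) = v' \<frown> \<omega>" by blast
  next
    fix x assume x: "x \<in> cantor m"
    then have z: "?i x \<in> cantor n" "\<psi> (?i x) = x"
      using psi_image by (auto simp: inv_into_into f_inv_into_f)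
    obtain i \<zeta> where i: "i < length us" "?i x = us ! i \<frown> \<zeta>" "\<zeta> \<in> cantor n"
      by (rule ordered_code_obtain[OF us z(1)])
    define w1 where "w1 = prefix r \<zeta>"
    define w2 where "w2 = prefix k (suffix r \<zeta>)"
    have w: "w1 \<in> words n" "length w1 = r" "w2 \<in> words n" "length w2 = k"
      using prefix_in_words[OF i(3)] prefix_in_words[OF suffix_in_cantor[OF i(3)]]
      by (simp_all only: w1_def w2_def subsequence_length diff_zero)
    define u v where "u = (us ! i @ w1) @ w2" and "v = (vs ! i @ w1) @ w2"
    have uv: "u \<in> words n" "v \<in> words n"
      unfolding u_def v_def words_append_iff
      using w ordered_code_words[OF us] ordered_code_words[OF vs] i(1) len by auto
    have ac: "act u = act v"
      unfolding u_def v_def by (rule synchronized_leaves[OF us vs len i(1) st k w])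
    have xu: "?i x = u \<frown> suffix k (suffix r \<zeta>)"
      unfolding i(2) u_def w1_def w2_def by (metis conc_conc prefix_suffix)
    have fuv: "f (u \<frown> \<omega>) = v \<frown> \<omega>" if "\<omega> \<in> cantor n" for \<omega>
    proof -
      have "(w1 @ w2) \<frown> \<omega> \<in> cantor n" using w that by (simp add: conc_in_cantor_iff)
      from fe[OF i(1) this] show ?thesis by (simp add: u_def v_def)
    qed
    obtain k0 where k0: "\<And>y. y \<in> cantor m \<Longrightarrow> prefix k0 y = prefix k0 x \<Longrightarrow>
        prefix (length u) (?i y) = prefix (length u) (?i x)"
      using continuous_prefix[OF homeomorphic_imp_continuous_map[OF hi] x] by blast
    \<comment> \<open>The first bound makes the preimage start with \<open>u\<close>, by continuity
      of the inverse; the second makes the prefix of \<open>x\<close> contain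
      \<open>theta n \<psi> u\<close>.\<close>
    define K where "K = max k0 (length (theta n \<psi> u))"
    let ?a = "prefix K x" and ?t = "length (theta n \<psi> u)"
    have "?g (?a \<frown> \<omega>) = (theta n \<psi> v @ drop ?t ?a) \<frown> \<omega>" if o: "\<omega> \<in> cantor m" for \<omega>
    proof -
      let ?y = "?a \<frown> \<omega>"
      have y: "?y \<in> cantor m" using prefix_in_words[OF x] o by (simp add: conc_in_cantor_iff)
      then have yi: "?i ?y \<in> cantor n" "\<psi> (?i ?y) = ?y"
        using psi_image by (auto simp: inv_into_into f_inv_into_f)
      have "prefix k0 ?y = take k0 ?a" by (rule prefix_conc_fst) (simp add: K_def)
      also have "\<dots> = prefix k0 x" by (simp add: K_def min_def)
      finally have "prefix (length u) (?i ?y) = prefix (length u) (?i x)" by (rule k0[OF y])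
      also have "\<dots> = u" unfolding xu by (rule prefix_conc_length)
      finally have yu: "?i ?y = u \<frown> suffix (length u) (?i ?y)" by (metis prefix_suffix)
      define \<omega>' where "\<omega>' = suffix (length u) (?i ?y)"
      have o': "\<omega>' \<in> cantor n" unfolding \<omega>'_def using yi(1) by (rule suffix_in_cantor)
      have yu': "?i ?y = u \<frown> \<omega>'" using yu by (simp add: \<omega>'_def)
      have "theta n \<psi> u \<frown> act u \<omega>' = ?a \<frown> \<omega>"
        using yi(2) unfolding yu' psi_local_action[OF uv(1) o'] .
      moreover have "?t \<le> length ?a" by (simp add: K_def)
      ultimately obtain a' where a': "?a = theta n \<psi> u @ a'" "act u \<omega>' = a' \<frown> \<omega>"
        by (rule conc_eq_longer)
      have "?g ?y = \<psi> (f (u \<frown> \<omega>'))" using y yu' by (simp add: conj_map_def)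
      also have "\<dots> = theta n \<psi> v \<frown> act v \<omega>'"
        unfolding fuv[OF o'] by (rule psi_local_action[OF uv(2) o'])
      also have "\<dots> = theta n \<psi> v \<frown> a' \<frown> \<omega>" by (simp only: ac[symmetric] a'(2))
      also have "a' = drop ?t ?a" unfolding a'(1) by simp
      finally show ?thesis by (simp only: conc_conc)
    qed
    then show "\<exists>K v. \<forall>\<omega>\<in>cantor m. ?g (prefix K x \<frown> \<omega>) = v \<frown> \<omega>" by blast
  qed
  then show ?thesis unfolding locally_prefix_replacing_def .
qed

text \<open>For a reversing \<open>\<psi>\<close> its inverse reverses as well, and the two
  reversals cancel.\<close>

lemma conj_map_order_preserving:
  assumes mono: "order_preserving n \<psi> \<or> order_reversing n \<psi>" and f: "f \<in> carrier (F_group n)"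
  shows "order_preserving m (conj_map n m \<psi> f)"
proof -
  let ?i = "inv_into (cantor n) \<psi>"
  have b: "bij_betw \<psi> (cantor n) (cantor m)" using psi_inj psi_image by (simp add: bij_betw_def)
  have ic: "?i x \<in> cantor n" if "x \<in> cantor m" for x
    using that psi_image by (auto simp: inv_into_into)
  note fD = F_group_carrier_D[OF f]
  have "less_fun (\<psi> (f (?i x))) (\<psi> (f (?i y)))" if xy: "x \<in> cantor m" "y \<in> cantor m" "less_fun x y" for x y
    using mono
  proof
    assume "order_preserving n \<psi>"
    then have p: "less_fun (\<psi> x) (\<psi> y)" if "x \<in> cantor n" "y \<in> cantor n" "less_fun x y" for x y
      using that by (simp add: order_preserving_def monotone_on_def)
    have "less_fun (?i x) (?i y)"
      by (rule inv_into_order[where R = less_fun, OF b p less_fun_asym xy])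
    from p[OF fD(2)[OF ic[OF xy(1)]] fD(2)[OF ic[OF xy(2)]] fD(3)[OF ic[OF xy(1)] ic[OF xy(2)] this]]
    show ?thesis .
  next
    assume "order_reversing n \<psi>"
    then have p: "less_fun (\<psi> y) (\<psi> x)" if "x \<in> cantor n" "y \<in> cantor n" "less_fun x y" for x y
      using that by (simp add: order_reversing_def monotone_on_def)
    have "less_fun (?i y) (?i x)"
      by (rule inv_into_order[where R = "\<lambda>x y. less_fun y x", OF b p less_fun_asym xy(2,1,3)])
    from p[OF fD(2)[OF ic[OF xy(2)]] fD(2)[OF ic[OF xy(1)]] fD(3)[OF ic[OF xy(2)] ic[OF xy(1)] this]]
    show ?thesis .
  qed
  then show ?thesis by (simp add: order_preserving_def monotone_on_def conj_map_def)
qed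

lemma conj_map_in_F_group:
  assumes "order_preserving n \<psi> \<or> order_reversing n \<psi>" "semi_synchronizing n mt"
    and f: "f \<in> carrier (F_group n)"
  shows "conj_map n m \<psi> f \<in> carrier (F_group m)"
proof -
  let ?i = "inv_into (cantor n) \<psi>"
  have "homeomorphic_map (cantor_space n) (cantor_space n) f" using f by (simp add: F_group_carrier_iff)
  then have "homeomorphic_map (cantor_space m) (cantor_space m) (\<psi> \<circ> (f \<circ> ?i))"
    using homeomorphic_map_compose homeomorphic_map_inv_into[OF \<psi>] \<psi> by metis
  then have h: "homeomorphic_map (cantor_space m) (cantor_space m) (conj_map n m \<psi> f)"
    by (rule homeomorphic_map_eq) (simp add: conj_map_def)
  note op = conj_map_order_preserving[OF assms(1) f]
  have "prefix_replacement m (conj_map n m \<psi> f)"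
    using m by (intro local_imp_prefix_replacement homeomorphic_map_bij_betw[OF h] op
        conj_map_local[OF assms(2) f]) simp
  moreover have "conj_map n m \<psi> f \<in> extensional (cantor m)" by (simp add: conj_map_def)
  ultimately show ?thesis using h op by (simp add: F_group_carrier_iff)
qed

end

theorem theorem1p2:
  fixes n m :: nat and \<psi> :: "nat word \<Rightarrow> nat word"
  assumes "2 \<le> n" and "2 \<le> m"
    and "homeomorphic_map (cantor_space n) (cantor_space m) \<psi>"
  shows "subgroup (F_conj n m \<psi>) (F_group m) \<longleftrightarrow>
    (order_preserving n \<psi> \<or> order_reversing n \<psi>)
    \<and> rational n m \<psi> \<and> semi_synchronizing n (minimal_transducer n \<psi>)"
proof -
  interpret cantor_homeomorphism n m \<psi> using assms by unfold_locales
  have "subgroup (F_conj n m \<psi>) (F_group m) \<longleftrightarrow> F_conj n m \<psi> \<subseteq> carrier (F_group m)"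
    using assms by (intro subgroup_F_conj_iff homeomorphic_map_bij_betw) auto
  also have "\<dots> \<longleftrightarrow> (order_preserving n \<psi> \<or> order_reversing n \<psi>) \<and> semi_synchronizing n mt"
  proof
    assume "F_conj n m \<psi> \<subseteq> carrier (F_group m)"
    then interpret conjugator n m \<psi> by unfold_locales (auto simp: F_conj_eq)
    show "(order_preserving n \<psi> \<or> order_reversing n \<psi>) \<and> semi_synchronizing n mt"
      using psi_monotone semi_synchronizing by blast
  next
    assume "(order_preserving n \<psi> \<or> order_reversing n \<psi>) \<and> semi_synchronizing n mt"
    then show "F_conj n m \<psi> \<subseteq> carrier (F_group m)"
      unfolding F_conj_eq using conj_map_in_F_group by blast
  qed
  finally show ?thesis using rational_if_semi_synchronizing by blast
qed

end
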